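(* Let $(X,\mathcal B,\mu,T)$ be a system satisfying conditions (c1)--(c6) listed in the context, assume that $\mu$ is liftable to the Hofbauer tower, and let $(Y,\mathcal C,\nu,F)$ with $Y=\bigsqcup_{u\in\alpha}R_u$ be the system of rugs defined in the context. For each $u\in\alpha$ let $\tau_u(z)=\inf\{n\ge1: F^nz\in R_u\}$ be the first return time of $z\in R_u$ (finite for $\nu$-a.e. $z\in R_u$) and let $F_u:R_u\to R_u$, $F_uz=F^{\tau_u(z)}z$, be the induced map. Then each map $F_u$, $u\in\alpha$, is Bernoulli (with respect to the normalized restriction of $\nu$ to $R_u$).
   Context: **Setting.** $X\subset\mathbb R^n$ is compact, $\mathcal B$ is the Lebesgue $\sigma$-algebra on $X$, $\mu$ is a probability measure on $(X,\mathcal B)$ (not assumed $T$-invariant). $\mathcal Z=\{Z_1,\dots,Z_N\}$ is a collection of closed sets with $\mu(Z_j)>0$, $\mu(Z_i\cap Z_j)=0$ for $i\ne j$, $\mu(\bigcup_j Z_j)=1$, and $T:X\to X$. Conditions: (c1) for each $Z\in\mathcal Z$, $T$ can be extended uniquely to a continuous injective map $T_Z:Z\to\overline{T(\operatorname{int}Z)}$; (c2) for each $A\in\mathcal B$ also $TA,T^{-1}A\in\mathcal B$, and $\mu(A)=0$ implies $\mu(T^{-1}A)=0$; (c3) $\bigvee_{k\ge0}T^{-k}\mathcal Z=\mathcal B$, i.e. $\mathcal B$ is the smallest $\sigma$-algebra containing all cylinder sets (elements of $\mathcal Z_n:=\bigvee_{k=0}^nT^{-k}\mathcal Z$); (c4)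 for each $j$ there is a constant $s_j\ge1$ with $\mu(TA)=s_j\mu(A)$ for all measurable $A\subseteq Z_j$; (c5) $\mu$ is ergodic: $T^{-1}A=A$, $A\in\mathcal B$, implies $\mu(A)\in\{0,1\}$ (no invariance implied); (c6) $\mu\big(\bigcup_nT^n(\bigcup_{j=1}^N\partial Z_j)\big)=0$, with $\partial$ the topological boundary. **Hofbauer tower.** $\mathcal Z_n$ consists of the $(n+1)$-cylinders $Z_{j_0\cdots j_n}=Z_{j_0}\cap T^{-1}Z_{j_1}\cap\dots\cap T^{-n}Z_{j_n}$ of positive $\mu$-measure. $\mathcal D$ is the set of equivalence classes of the closures of the sets $T^nZ_{j_0\cdots j_n}$ ($n\ge0$), where two sets are equivalent if their symmetric difference has $\mu$-measure $0$; elements of $\mathcal D$ are also treated as subsets of $X$. Write $\mathcal D=\{D_u:u\in\alpha\}$ with $\alpha\subseteq\mathbb N$ an ordered index set and $D_u=Z_u$ for $1\le u\le N$. The tower is the disjoint union $\hat X=\bigsqcup_{u\in\alpha}D_u$, with points $\hat x=(x,D)$; its base is $\hat X_0=\bigsqcup_{u=1}^ND_u$; $\pi(x,D)=x$; $\hat{\mathcal B}=\mathcal D\vee\pi^{-1}(\mathcal B)$ is the Lebesgue $\sigma$-algebra on $\hat X$. If $\mu(Z_j\cap TD)>0$ then $D'=Z_j\cap TD\in\mathcal D$ and one writes $D\to D'$. The map $\hat T:\hat X\to\hat X$ is $\hat T(x,D)=(Tx,Z_j\cap TD)$ if $Tx\in Z_j$. So $\pi\circ\hat T=T\circ\pi$.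 **Lifting.** $\bar\mu(A)=\sum_{D\in\mathcal D}\mu(\pi(A\cap D))$ for $A\in\hat{\mathcal B}$, and $\hat\mu_n(A)=\frac1n\sum_{k=0}^{n-1}\bar\mu(\hat T^{-k}A\cap\hat X_0)$. $\mu$ is liftable, and lifts to $\hat\mu$, if $(\hat\mu_n)$ converges in the vague topology (weak topology on compacta) to a non-zero measure $\hat\mu$ (then a probability measure). On each $D\in\mathcal D$ the density $\frac{d\hat\mu}{d\bar\mu}$ is the constant $\rho(D)=\hat\mu(D)/\bar\mu(D)$. **The system $(Y,\mathcal C,\nu,F)$.** Only the $D_u$ with $\hat\mu(D_u)>0$ are kept, and $\alpha$ denotes the set of their indices. The rug of $D_u$ is $R_u=D_u\times[0,\rho(D_u)]$; $Y=\bigsqcup_{u\in\alpha}R_u$; $\mathcal C$ is the Borel $\sigma$-algebra on $Y$; $\nu$ is $\bar\mu\times m$ on each rug, $m$ being one-dimensional Lebesgue measure. For $z=(\hat x,y,u)\in R_u$ with $\pi(\hat x)\in Z_j$ and $\hat T\hat x\in D_v$, $$F(\hat x,y,u)=\Big(\hat T\hat x,\ \frac y{s_j}+\sum_{1\le k\le N}\ \sum_{t<u:\ \pi^{-1}(Z_k)\supset D_t\to D_v}\frac{\rho(D_t)}{s_k},\ v\Big),$$ which is well-defined on a set of full $\nu$-measure and preserves the probability measure $\nu$. **Bernoulli.** A two-sided Bernoulli shift is $(\mathcal A^{\mathbb Z},\sigma)$ with $\mathcal A$ a finite or countable alphabet, $\sigma$ the left shift, with a stationary product measure given by a probability vector.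 An invertible measure preserving system is Bernoulli if it is (measure-theoretically) isomorphic to a two-sided Bernoulli shift.
   Formalization: Added hypothesis: μ has no atoms. It is needed: for X a single point with T the identity, (c1)–(c6) and liftability hold, but F_1 is the identity on {p}×[0,1], which is not Bernoulli; for any μ with an atom the claim fails in the same way. *)

theory Defs
  imports "HOL-Probability.Probability"
begin

text \<open>
  The space \<open>X\<close> is \<^term>\<open>space M\<close>, the \<open>\<sigma>\<close>-algebra \<open>\<B>\<close> is \<^term>\<open>sets M\<close>.
  ``Lebesgue \<open>\<sigma>\<close>-algebra'' is taken relative to \<open>\<mu>\<close>: the Borel sets of \<open>X\<close> are measurable, and every
  measurable set lies between two Borel sets that differ by a \<open>\<mu>\<close>-null set.  This admits the
  \<open>\<mu>\<close>-completion of the Borel sets as well as, for \<open>\<mu>\<close> absolutely continuous, the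
  Lebesgue measurable subsets of \<open>X\<close>.

  Absence of atoms is not part of this and has to be assumed separately.  It cannot be dropped: if
  \<open>X\<close> is one point, the rug map is the identity of \<open>X \<times> [0,1]\<close>, which is not Bernoulli.
\<close>

definition lebesgue_prob_on :: "(real ^ 'n) set \<Rightarrow> (real ^ 'n) measure \<Rightarrow> bool" where
  "lebesgue_prob_on X M \<longleftrightarrow>
     prob_space M \<and> space M = X \<and>
     sets (restrict_space borel X) \<subseteq> sets M \<and>
     (\<forall>A\<in>sets M. \<exists>B\<in>sets (restrict_space borel X). \<exists>C\<in>sets (restrict_space borel X).
        B \<subseteq> A \<and> A \<subseteq> C \<and> emeasure M (C - B) = 0)"

definition partition_mod_null :: "'a::topological_space measure \<Rightarrow> nat \<Rightarrow> (nat \<Rightarrow> 'a set) \<Rightarrow> bool" where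
  "partition_mod_null M N Z \<longleftrightarrow>
     (\<forall>j\<in>{1..N}. closed (Z j) \<and> Z j \<subseteq> space M \<and> emeasure M (Z j) > 0) \<and>
     (\<forall>i\<in>{1..N}. \<forall>j\<in>{1..N}. i \<noteq> j \<longrightarrow> emeasure M (Z i \<inter> Z j) = 0) \<and>
     emeasure M (\<Union>j\<in>{1..N}. Z j) = 1"

text \<open>Interiors and boundaries are those of the topological space \<open>X\<close>, not of the ambient space.\<close>

definition extends_uniquely :: "'a::topological_space set \<Rightarrow> ('a \<Rightarrow> 'a) \<Rightarrow> 'a set \<Rightarrow> bool" where
  "extends_uniquely X T A \<longleftrightarrow>
     (\<exists>!g. g \<in> extensional A \<and> continuous_on A g \<and> inj_on g A \<and>
        g ` A \<subseteq> closure (T ` (top_of_set X interior_of A)) \<and>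
        (\<forall>x \<in> top_of_set X interior_of A. g x = T x))"

definition eq_mod_null :: "'a measure \<Rightarrow> 'a set \<Rightarrow> 'a set \<Rightarrow> bool" where
  "eq_mod_null M A B \<longleftrightarrow> sym_diff A B \<in> null_sets M"

definition cylinder :: "'a measure \<Rightarrow> ('a \<Rightarrow> 'a) \<Rightarrow> (nat \<Rightarrow> 'a set) \<Rightarrow> nat list \<Rightarrow> 'a set" where
  "cylinder M T Z js = {x \<in> space M. \<forall>i<length js. (T ^^ i) x \<in> Z (js ! i)}"

definition cylinder_words ::
    "'a measure \<Rightarrow> nat \<Rightarrow> (nat \<Rightarrow> 'a set) \<Rightarrow> ('a \<Rightarrow> 'a) \<Rightarrow> nat \<Rightarrow> nat list set" where
  "cylinder_words M N Z T n =
     {js. length js = Suc n \<and> set js \<subseteq> {1..N} \<and> emeasure M (cylinder M T Z js) > 0}"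

text \<open>
  Equality of \<open>\<sigma>\<close>-algebras is understood modulo null sets, as usual for generators: a complete
  \<open>\<sigma>\<close>-algebra is in general not countably generated.
\<close>

definition generating_mod_null :: "'a measure \<Rightarrow> nat \<Rightarrow> (nat \<Rightarrow> 'a set) \<Rightarrow> ('a \<Rightarrow> 'a) \<Rightarrow> bool" where
  "generating_mod_null M N Z T \<longleftrightarrow>
     (\<forall>A\<in>sets M. \<exists>C\<in>sigma_sets (space M) (\<Union>n. cylinder M T Z ` cylinder_words M N Z T n).
        eq_mod_null M A C)"

definition tower_levels :: "'a::topological_space measure \<Rightarrow> nat \<Rightarrow> (nat \<Rightarrow> 'a set) \<Rightarrow> ('a \<Rightarrow> 'a) \<Rightarrow> 'a set set" where
  "tower_levels M N Z T =
     (\<Union>n. (\<lambda>js. closure ((T ^^ n) ` cylinder M T Z js)) ` cylinder_words M N Z T n)"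

text \<open>
  \<open>level_step M Z T D j u v\<close>: the set \<open>Z j \<inter> T (D u)\<close> has positive measure and represents the class
  of \<open>D v\<close>.
\<close>

definition level_step ::
    "'a measure \<Rightarrow> (nat \<Rightarrow> 'a set) \<Rightarrow> ('a \<Rightarrow> 'a) \<Rightarrow> (nat \<Rightarrow> 'a set) \<Rightarrow> nat \<Rightarrow> nat \<Rightarrow> nat \<Rightarrow> bool" where
  "level_step M Z T D j u v \<longleftrightarrow>
     emeasure M (Z j \<inter> T ` D u) > 0 \<and> eq_mod_null M (Z j \<inter> T ` D u) (D v)"

definition level_arrow ::
    "'a measure \<Rightarrow> nat \<Rightarrow> (nat \<Rightarrow> 'a set) \<Rightarrow> ('a \<Rightarrow> 'a) \<Rightarrow> (nat \<Rightarrow> 'a set) \<Rightarrow> nat \<Rightarrow> nat \<Rightarrow> bool" where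
  "level_arrow M N Z T D u v \<longleftrightarrow> (\<exists>j\<in>{1..N}. level_step M Z T D j u v)"

text \<open>
  \<open>D\<close> enumerates, without repetition, representatives of the classes of levels modulo null sets.
  The last conjunct says that \<open>Z j \<inter> T (D u)\<close>, if not null, is again a level, so that the tower map
  is defined almost everywhere.
\<close>

definition tower_enumeration ::
    "'a::topological_space measure \<Rightarrow> nat \<Rightarrow> (nat \<Rightarrow> 'a set) \<Rightarrow> ('a \<Rightarrow> 'a) \<Rightarrow> nat set \<Rightarrow> (nat \<Rightarrow> 'a set) \<Rightarrow> bool" where
  "tower_enumeration M N Z T \<alpha> D \<longleftrightarrow>
     {1..N} \<subseteq> \<alpha> \<and> (\<forall>u\<in>{1..N}. D u = Z u) \<and>
     D ` \<alpha> \<subseteq> tower_levels M N Z T \<and>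
     (\<forall>C\<in>tower_levels M N Z T. \<exists>!u. u \<in> \<alpha> \<and> eq_mod_null M C (D u)) \<and>
     (\<forall>u\<in>\<alpha>. \<forall>j\<in>{1..N}. emeasure M (Z j \<inter> T ` D u) > 0 \<longrightarrow> (\<exists>v\<in>\<alpha>. level_step M Z T D j u v))"

text \<open>
  A point \<open>(x, D u)\<close> of the tower is the pair \<open>(x, u)\<close>.  As \<open>nat\<close> is discrete, the topology
  induced from the product type is the disjoint union topology.
\<close>

definition tower_level :: "(nat \<Rightarrow> 'a set) \<Rightarrow> nat \<Rightarrow> ('a \<times> nat) set" where
  "tower_level D u = D u \<times> {u}"

definition tower_space :: "nat set \<Rightarrow> (nat \<Rightarrow> 'a set) \<Rightarrow> ('a \<times> nat) set" where
  "tower_space \<alpha> D = (\<Union>u\<in>\<alpha>. tower_level D u)"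

definition tower_base :: "nat \<Rightarrow> (nat \<Rightarrow> 'a set) \<Rightarrow> ('a \<times> nat) set" where
  "tower_base N D = (\<Union>u\<in>{1..N}. tower_level D u)"

definition tower_generators :: "'a measure \<Rightarrow> nat set \<Rightarrow> (nat \<Rightarrow> 'a set) \<Rightarrow> ('a \<times> nat) set set" where
  "tower_generators M \<alpha> D =
     tower_level D ` \<alpha> \<union> (\<lambda>B. fst -` B \<inter> tower_space \<alpha> D) ` sets M"

text \<open>
  The choice of the least index matters only for points in two of the sets \<open>Z j\<close> (or in
  none), hence on a null set.
\<close>

definition cell_index :: "nat \<Rightarrow> (nat \<Rightarrow> 'a set) \<Rightarrow> 'a \<Rightarrow> nat" where
  "cell_index N Z x = (LEAST j. j \<in> {1..N} \<and> x \<in> Z j)"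

definition tower_map ::
    "'a measure \<Rightarrow> nat \<Rightarrow> (nat \<Rightarrow> 'a set) \<Rightarrow> ('a \<Rightarrow> 'a) \<Rightarrow> nat set \<Rightarrow> (nat \<Rightarrow> 'a set) \<Rightarrow> 'a \<times> nat \<Rightarrow> 'a \<times> nat" where
  "tower_map M N Z T \<alpha> D = (\<lambda>(x, u).
     (T x, THE v. v \<in> \<alpha> \<and> level_step M Z T D (cell_index N Z (T x)) u v))"

definition tower_measure :: "'a measure \<Rightarrow> nat set \<Rightarrow> (nat \<Rightarrow> 'a set) \<Rightarrow> ('a \<times> nat) measure" where
  "tower_measure M \<alpha> D =
     measure_of (tower_space \<alpha> D) (tower_generators M \<alpha> D)
       (\<lambda>A. \<integral>\<^sup>+u. emeasure M (fst ` (A \<inter> tower_level D u)) \<partial>count_space \<alpha>)"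

definition lift_average ::
    "'a measure \<Rightarrow> nat \<Rightarrow> (nat \<Rightarrow> 'a set) \<Rightarrow> ('a \<Rightarrow> 'a) \<Rightarrow> nat set \<Rightarrow> (nat \<Rightarrow> 'a set) \<Rightarrow> nat \<Rightarrow> ('a \<times> nat) measure" where
  "lift_average M N Z T \<alpha> D n =
     measure_of (tower_space \<alpha> D) (tower_generators M \<alpha> D)
       (\<lambda>A. (\<Sum>k<n. emeasure (tower_measure M \<alpha> D)
                 ((tower_map M N Z T \<alpha> D ^^ k) -` A \<inter> tower_base N D)) / of_nat n)"

definition vague_limit :: "(nat \<Rightarrow> 'a::topological_space measure) \<Rightarrow> 'a measure \<Rightarrow> bool" where
  "vague_limit \<mu> \<mu>' \<longleftrightarrow>
     (\<forall>K. compact K \<and> K \<subseteq> space \<mu>' \<longrightarrow> emeasure \<mu>' K < \<infinity>) \<and>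
     (\<forall>f::'a \<Rightarrow> real. continuous_on (space \<mu>') f \<and>
        (\<exists>K. compact K \<and> K \<subseteq> space \<mu>' \<and> (\<forall>x\<in>space \<mu>' - K. f x = 0)) \<longrightarrow>
        (\<lambda>n. \<integral>x. f x \<partial>\<mu> n) \<longlonglongrightarrow> (\<integral>x. f x \<partial>\<mu>'))"

definition lifts_to ::
    "'a::topological_space measure \<Rightarrow> nat \<Rightarrow> (nat \<Rightarrow> 'a set) \<Rightarrow> ('a \<Rightarrow> 'a) \<Rightarrow> nat set \<Rightarrow> (nat \<Rightarrow> 'a set)
      \<Rightarrow> ('a \<times> nat) measure \<Rightarrow> bool" where
  "lifts_to M N Z T \<alpha> D \<mu>h \<longleftrightarrow>
     sets \<mu>h = sets (tower_measure M \<alpha> D) \<and>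
     vague_limit (lift_average M N Z T \<alpha> D) \<mu>h \<and>
     emeasure \<mu>h (space \<mu>h) \<noteq> 0"

definition level_density ::
    "'a measure \<Rightarrow> nat set \<Rightarrow> (nat \<Rightarrow> 'a set) \<Rightarrow> ('a \<times> nat) measure \<Rightarrow> nat \<Rightarrow> real" where
  "level_density M \<alpha> D \<mu>h u =
     measure \<mu>h (tower_level D u) / measure (tower_measure M \<alpha> D) (tower_level D u)"

definition charged_levels :: "nat set \<Rightarrow> (nat \<Rightarrow> 'a set) \<Rightarrow> ('a \<times> nat) measure \<Rightarrow> nat set" where
  "charged_levels \<alpha> D \<mu>h = {u\<in>\<alpha>. emeasure \<mu>h (tower_level D u) > 0}"

text \<open>
  A point \<open>(p, y, u)\<close> with \<open>p = (x, D u)\<close> is represented as \<open>((x, u), y)\<close>; the index \<open>u\<close> is already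
  part of the point of the tower.
\<close>

definition rug ::
    "'a measure \<Rightarrow> nat set \<Rightarrow> (nat \<Rightarrow> 'a set) \<Rightarrow> ('a \<times> nat) measure \<Rightarrow> nat \<Rightarrow> (('a \<times> nat) \<times> real) set" where
  "rug M \<alpha> D \<mu>h u = tower_level D u \<times> {0..level_density M \<alpha> D \<mu>h u}"

definition rug_space ::
    "'a measure \<Rightarrow> nat set \<Rightarrow> (nat \<Rightarrow> 'a set) \<Rightarrow> ('a \<times> nat) measure \<Rightarrow> (('a \<times> nat) \<times> real) set" where
  "rug_space M \<alpha> D \<mu>h = (\<Union>u\<in>charged_levels \<alpha> D \<mu>h. rug M \<alpha> D \<mu>h u)"

definition rug_measure ::
    "'a::topological_space measure \<Rightarrow> nat set \<Rightarrow> (nat \<Rightarrow> 'a set) \<Rightarrow> ('a \<times> nat) measure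
      \<Rightarrow> (('a \<times> nat) \<times> real) measure" where
  "rug_measure M \<alpha> D \<mu>h =
     measure_of (rug_space M \<alpha> D \<mu>h) (sets (restrict_space borel (rug_space M \<alpha> D \<mu>h)))
       (emeasure (tower_measure M \<alpha> D \<Otimes>\<^sub>M lborel))"

definition rug_map ::
    "'a measure \<Rightarrow> nat \<Rightarrow> (nat \<Rightarrow> 'a set) \<Rightarrow> ('a \<Rightarrow> 'a) \<Rightarrow> (nat \<Rightarrow> real) \<Rightarrow> nat set \<Rightarrow> (nat \<Rightarrow> 'a set)
      \<Rightarrow> ('a \<times> nat) measure \<Rightarrow> ('a \<times> nat) \<times> real \<Rightarrow> ('a \<times> nat) \<times> real" where
  "rug_map M N Z T s \<alpha> D \<mu>h = (\<lambda>((x, u), y).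
     let v = snd (tower_map M N Z T \<alpha> D (x, u)) in
     (tower_map M N Z T \<alpha> D (x, u),
      y / s (cell_index N Z x) +
      (\<Sum>k=1..N. \<Sum>t | t \<in> charged_levels \<alpha> D \<mu>h \<and> t < u \<and> D t \<subseteq> Z k \<and> level_arrow M N Z T D t v.
         level_density M \<alpha> D \<mu>h t / s k)))"

definition normalized_restriction :: "'a measure \<Rightarrow> 'a set \<Rightarrow> 'a measure" where
  "normalized_restriction M A = scale_measure (1 / emeasure M A) (restrict_space M A)"

definition first_return_time :: "('a \<Rightarrow> 'a) \<Rightarrow> 'a set \<Rightarrow> 'a \<Rightarrow> nat" where
  "first_return_time F R z = (LEAST n. n \<ge> 1 \<and> (F ^^ n) z \<in> R)"

definition induced_map :: "('a \<Rightarrow> 'a) \<Rightarrow> 'a set \<Rightarrow> 'a \<Rightarrow> 'a" where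
  "induced_map F R z = (F ^^ first_return_time F R z) z"

text \<open>
  Both maps are bijective on the sets of full measure that remain.  Measurability and invariance of the
  measure under \<open>S\<close> are not required separately: for the Bernoulli shift they hold, and \<open>\<phi>\<close>
  transports them to \<open>S\<close> on \<open>A\<close>.
\<close>

definition isomorphic_mod_null ::
    "'a measure \<Rightarrow> ('a \<Rightarrow> 'a) \<Rightarrow> 'b measure \<Rightarrow> ('b \<Rightarrow> 'b) \<Rightarrow> bool" where
  "isomorphic_mod_null M S M' S' \<longleftrightarrow>
     (\<exists>A\<in>sets M. \<exists>A'\<in>sets M'. \<exists>\<phi>.
        emeasure M (space M - A) = 0 \<and> emeasure M' (space M' - A') = 0 \<and>
        bij_betw S A A \<and> bij_betw S' A' A' \<and>
        bij_betw \<phi> A A' \<and>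
        \<phi> \<in> restrict_space M A \<rightarrow>\<^sub>M restrict_space M' A' \<and>
        the_inv_into A \<phi> \<in> restrict_space M' A' \<rightarrow>\<^sub>M restrict_space M A \<and>
        distr (restrict_space M A) (restrict_space M' A') \<phi> = restrict_space M' A' \<and>
        (\<forall>x\<in>A. \<phi> (S x) = S' (\<phi> x)))"

definition bernoulli_measure :: "'b pmf \<Rightarrow> (int \<Rightarrow> 'b) measure" where
  "bernoulli_measure p = (\<Pi>\<^sub>M i\<in>UNIV. measure_pmf p)"

definition left_shift :: "(int \<Rightarrow> 'b) \<Rightarrow> int \<Rightarrow> 'b" where
  "left_shift \<omega> = (\<lambda>i. \<omega> (i + 1))"

text \<open>
  Every probability vector on a finite or countable alphabet is a distribution on \<open>nat\<close>, up to
  letters of probability zero.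
\<close>

definition is_bernoulli :: "'a measure \<Rightarrow> ('a \<Rightarrow> 'a) \<Rightarrow> bool" where
  "is_bernoulli M S \<longleftrightarrow> (\<exists>p :: nat pmf. isomorphic_mod_null M S (bernoulli_measure p) left_shift)"

end

theory Submission
  imports Defs "HOL-Library.Nat_Bijection"
begin

text \<open>
  On each level of the tower the map \<open>T\<close> stretches the measure \<open>M\<close> by a constant factor, and up to null sets the
  image of a level is again a union of levels.  Hence the tower is a Markov chain: given that an orbit is on level \<open>u\<close>, its
  next level is \<open>v\<close> with a probability that depends on \<open>u\<close> and \<open>v\<close> only, and its position on \<open>v\<close> is
  again distributed as \<open>M\<close> (\<open>entry_law\<close>).  Iterating, the points that follow a prescribed path of levels
  are mapped onto the last level of the path with constant Jacobian (\<open>path_law\<close>).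

  Levels are compact and open in the tower, so the vague limit gives convergence of the mass of each
  single level.  Passing to the limit in the recursion for these masses shows that the limits form a
  finite subinvariant measure of the chain (\<open>density_subinvariant\<close>, \<open>density_mass_le\<close>).  This has two
  consequences.
  First, almost every point of a charged level \<open>u\<close> returns to it (\<open>AE_return\<close>).  Second, the pieces which
  the rug map puts into a rug fit on top of each other without overlap.

  Now fix a charged level \<open>u\<close>.  A first return to \<open>u\<close> follows a loop \<open>w\<close> of levels.  By the Markov property
  the points of \<open>D u\<close> that follow \<open>w\<close> form a set of relative measure \<open>p w\<close> which is mapped onto \<open>D u\<close>; so the
  successive loops of a point are independent with distribution \<open>p\<close>, and recurrence makes \<open>p\<close> a probability
  vector (\<open>base_law\<close>, \<open>loop_weights_sum\<close>).  In the vertical direction \<open>w\<close> contracts the fibre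
  \<open>[0, \<rho> u)\<close> affinely onto an interval of relative length \<open>p w\<close>, and these intervals tile the fibre,
  because different loops have different pasts (\<open>path_map_disjoint\<close>).  Thus the induced map is a generalized
  baker's map.  Coding a point of the rug by the loops that its base coordinate is going to follow and by the
  tiles that contain its fibre coordinate yields a map to the two-sided shift over \<open>p\<close> which
  intertwines the induced map with the shift and carries the normalized measure of the rug to the product
  measure.

  The coding is invertible.  The fibre coordinate is recovered as the intersection of nested tiles, whose
  lengths tend to zero unless \<open>p\<close> is concentrated on one loop.  The base coordinate is recovered because the
  loops determine the itinerary with respect to \<open>Z\<close>, which generates the \<open>\<sigma>\<close>-algebra (\<open>code_generates\<close>).
  The degenerate case of a single loop would leave only one code, hence an atom (\<open>pmf_less_1\<close>).
\<close>

section \<open>Isomorphism with a Bernoulli shift\<close>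

lemma space_bernoulli_measure [simp]: "space (bernoulli_measure p) = UNIV"
  by (simp add: bernoulli_measure_def space_PiM PiE_UNIV_domain)

lemma prob_space_bernoulli_measure: "prob_space (bernoulli_measure p)"
  unfolding bernoulli_measure_def by (intro prob_space_PiM prob_space_measure_pmf)

lemma measurable_bernoulli_component [measurable]:
  "(\<lambda>\<omega>. \<omega> i) \<in> bernoulli_measure p \<rightarrow>\<^sub>M count_space UNIV"
proof -
  have "(\<lambda>\<omega>. \<omega> i) \<in> bernoulli_measure p \<rightarrow>\<^sub>M measure_pmf p"
    unfolding bernoulli_measure_def by measurable
  then show ?thesis by simp
qed

lemma measurable_into_bernoulli:
  assumes "\<And>i. (\<lambda>x. f x i) \<in> M \<rightarrow>\<^sub>M count_space UNIV"
  shows "f \<in> M \<rightarrow>\<^sub>M bernoulli_measure p"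
  unfolding bernoulli_measure_def
  by (rule measurable_PiM_single') (use assms in \<open>auto simp: space_PiM PiE_UNIV_domain cong: measurable_cong_sets\<close>)

lemma sets_Collect_eq_bernoulli:
  assumes [measurable]: "f \<in> M \<rightarrow>\<^sub>M bernoulli_measure p" "g \<in> M \<rightarrow>\<^sub>M bernoulli_measure (q :: nat pmf)"
  shows "{x\<in>space M. f x = g x} \<in> sets M"
proof -
  have [measurable]: "(\<lambda>x. f x i) \<in> M \<rightarrow>\<^sub>M count_space UNIV" "(\<lambda>x. g x i) \<in> M \<rightarrow>\<^sub>M count_space UNIV" for i
    by (rule measurable_compose[OF _ measurable_bernoulli_component], fact)+
  have "{x\<in>space M. f x = g x} = {x\<in>space M. \<forall>i. f x i = g x i}" by auto
  also have "\<dots> \<in> sets M" by measurable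
  finally show ?thesis .
qed

lemma distr_shift_bernoulli:
  "distr (bernoulli_measure p) (bernoulli_measure p) (\<lambda>\<omega> j. \<omega> (j + k)) = bernoulli_measure p"
  using distr_PiM_reindex[of UNIV "\<lambda>_. measure_pmf p" "\<lambda>j::int. j + k" UNIV]
  by (simp add: bernoulli_measure_def prob_space_measure_pmf restrict_UNIV)

lemma AE_all_shifts_bernoulli:
  assumes "AE \<omega> in bernoulli_measure p. P \<omega>"
  shows "AE \<omega> in bernoulli_measure p. \<forall>k::int. P (\<lambda>j. \<omega> (j + k))"
proof -
  have "AE \<omega> in bernoulli_measure p. P (\<lambda>j. \<omega> (j + k))" for k
  proof (rule AE_distrD[where f="\<lambda>\<omega> j. \<omega> (j + k)"])
    show "(\<lambda>\<omega> j. \<omega> (j + k)) \<in> bernoulli_measure p \<rightarrow>\<^sub>M bernoulli_measure p"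
      by (intro measurable_into_bernoulli) measurable
    show "AE \<omega> in distr (bernoulli_measure p) (bernoulli_measure p) (\<lambda>\<omega> j. \<omega> (j + k)). P \<omega>"
      unfolding distr_shift_bernoulli by (rule assms)
  qed
  then show ?thesis by (simp add: AE_all_countable)
qed

text \<open>
  It suffices to have measurable maps in both directions that are inverse to each other almost everywhere.  The points \<open>\<omega>\<close> with \<open>\<Phi> (\<Psi> \<omega>) = \<omega>\<close> form a measurable set, and
  the points of the shift space all of whose translates lie in it form an invariant one; pulling this set back
  gives the invariant set on which \<open>\<Phi>\<close> is an isomorphism.
\<close>
lemma isomorphic_mod_nullI:
  fixes p :: "nat pmf" and R :: "'a measure"
  assumes R: "prob_space R"
    and \<Phi>[measurable]: "\<Phi> \<in> R \<rightarrow>\<^sub>M bernoulli_measure p"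
    and law: "distr R (bernoulli_measure p) \<Phi> = bernoulli_measure p"
    and \<Psi>[measurable]: "\<Psi> \<in> bernoulli_measure p \<rightarrow>\<^sub>M R"
    and inv: "AE z in R. \<Psi> (\<Phi> z) = z \<and> \<Psi> (left_shift (\<Phi> z)) = S z"
  shows "isomorphic_mod_null R S (bernoulli_measure p) left_shift"
proof -
  let ?B = "bernoulli_measure p"
  let ?sh = "\<lambda>k::int. \<lambda>\<omega>::int\<Rightarrow>nat. \<lambda>j. \<omega> (j + k)"
  interpret R: prob_space R by fact
  interpret B: prob_space ?B by (rule prob_space_bernoulli_measure)
  from inv obtain E where E: "E \<in> null_sets R" "\<And>z. z \<in> space R - E \<Longrightarrow> \<Psi> (\<Phi> z) = z"
    "\<And>z. z \<in> space R - E \<Longrightarrow> \<Psi> (left_shift (\<Phi> z)) = S z"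
    by (auto elim!: AE_E3)
  define G where "G = space R - E"
  have G[measurable]: "G \<in> sets R" using E by (auto simp: G_def)
  \<comment> \<open>\<open>A1\<close> is where \<open>\<Psi>\<close> inverts \<open>\<Phi>\<close>; it need not be invariant, so it is replaced by the set \<open>A2\<close> of points
    whose whole orbit stays in \<open>A1\<close>.\<close>
  define A1 where "A1 = {\<omega>. \<Psi> \<omega> \<in> G \<and> \<Phi> (\<Psi> \<omega>) = \<omega>}"
  have A1_alt: "A1 = (\<Psi> -` G \<inter> space ?B) \<inter> {\<omega>\<in>space ?B. \<Phi> (\<Psi> \<omega>) = \<omega>}" by (auto simp: A1_def)
  have A1[measurable]: "A1 \<in> sets ?B"
    unfolding A1_alt
    by (intro sets.Int[OF measurable_sets[OF \<Psi> G]] sets_Collect_eq_bernoulli[where p=p and q=p]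
        measurable_compose[OF \<Psi> \<Phi>]) simp
  have "AE z in R. \<Phi> z \<in> A1"
    using AE_not_in[OF E(1)] by (rule AE_mp) (auto intro!: AE_I2 simp: A1_def G_def E)
  then have AE1: "AE \<omega> in ?B. \<omega> \<in> A1"
    by (subst law[symmetric], subst AE_distr_iff) auto
  have sh[measurable]: "?sh k \<in> ?B \<rightarrow>\<^sub>M ?B" for k by (intro measurable_into_bernoulli) measurable
  define A2 where "A2 = {\<omega>. \<forall>k. ?sh k \<omega> \<in> A1}"
  have A2_alt: "A2 = (\<Inter>k. ?sh k -` A1 \<inter> space ?B)" by (auto simp: A2_def)
  have A2[measurable]: "A2 \<in> sets ?B"
    unfolding A2_alt by (intro sets.countable_INT image_subsetI measurable_sets[OF sh A1]) simp_all
  have AE2: "AE \<omega> in ?B. \<omega> \<in> A2"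
    using AE_all_shifts_bernoulli[OF AE1] by (simp add: A2_def)
  define A where "A = {z\<in>G. \<Phi> z \<in> A2}"
  have A_alt: "A = G \<inter> (\<Phi> -` A2 \<inter> space R)" by (auto simp: A_def G_def)
  have A[measurable]: "A \<in> sets R" unfolding A_alt by measurable
  have "AE \<omega> in distr R ?B \<Phi>. \<omega> \<in> A2" unfolding law by (rule AE2)
  then have "AE z in R. \<Phi> z \<in> A2" by (rule AE_distrD[OF \<Phi>])
  moreover have "AE z in R. z \<in> G"
    using AE_not_in[OF E(1)] AE_space[of R] by eventually_elim (simp add: G_def)
  ultimately have AER: "AE z in R. z \<in> A" by eventually_elim (simp add: A_def)
  have A2_shift: "left_shift \<omega> \<in> A2" if "\<omega> \<in> A2" for \<omega>
  proof -
    have "?sh k (left_shift \<omega>) = ?sh (k + 1) \<omega>" for k by (simp add: left_shift_def add.assoc)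
    then show ?thesis using that by (simp add: A2_def)
  qed
  have A2_unshift: "?sh (-1) \<omega> \<in> A2" if "\<omega> \<in> A2" for \<omega>
  proof -
    have "?sh k (?sh (-1) \<omega>) = ?sh (k - 1) \<omega>" for k by (simp add: algebra_simps)
    then show ?thesis using that by (simp add: A2_def)
  qed
  have A2_A1: "\<omega> \<in> A1" if "\<omega> \<in> A2" for \<omega>
    using that unfolding A2_def by (auto dest: spec[of _ 0])
  have bij_shift: "bij_betw left_shift A2 A2"
    by (rule bij_betwI[where g="?sh (-1)"])
       (use A2_shift A2_unshift in \<open>simp_all only: Pi_iff, simp_all add: left_shift_def\<close>)
  have \<Phi>A: "\<Phi> z \<in> A2" "\<Psi> (\<Phi> z) = z" if "z \<in> A" for z
    using that E(2)[of z] by (simp_all add: A_def G_def)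
  have \<Psi>A: "\<Psi> \<omega> \<in> A" "\<Phi> (\<Psi> \<omega>) = \<omega>" if "\<omega> \<in> A2" for \<omega>
    using that A2_A1[OF that] by (simp_all add: A_def A1_def)
  have bij\<Phi>: "bij_betw \<Phi> A A2"
    by (rule bij_betwI[where g=\<Psi>]) (use \<Phi>A \<Psi>A in \<open>simp_all add: Pi_iff\<close>)
  have bij\<Psi>: "bij_betw \<Psi> A2 A"
    by (rule bij_betwI[where g=\<Phi>]) (use \<Phi>A \<Psi>A in \<open>simp_all add: Pi_iff\<close>)
  have S: "S z = \<Psi> (left_shift (\<Phi> z))" if "z \<in> A" for z
    using that E(3)[of z] by (auto simp: A_def G_def)
  have bijS: "bij_betw S A A"
    using bij_betw_trans[OF bij_betw_trans[OF bij\<Phi> bij_shift] bij\<Psi>]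
    by (subst bij_betw_cong[where g="\<Psi> \<circ> (left_shift \<circ> \<Phi>)"]) (simp_all add: S)
  have inv: "the_inv_into A \<Phi> \<omega> = \<Psi> \<omega>" if "\<omega> \<in> A2" for \<omega>
    using bij\<Phi> \<Psi>A[OF that] by (intro the_inv_into_f_eq) (simp_all add: bij_betw_def)
  have sp: "space (restrict_space R A) = A" "space (restrict_space ?B A2) = A2"
    using sets.sets_into_space[OF A] by (auto simp: space_restrict_space)
  show ?thesis
    unfolding isomorphic_mod_null_def
  proof (intro bexI[OF _ A] bexI[OF _ A2] exI[of _ \<Phi>] conjI ballI)
    show "emeasure R (space R - A) = 0"
      using AER by (subst (asm) AE_iff_measurable[OF _ refl]) (auto simp: set_diff_eq)
    show "emeasure ?B (space ?B - A2) = 0"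
      using AE2 sets.compl_sets[OF A2] by (subst (asm) AE_iff_measurable[OF _ refl]) (auto simp: set_diff_eq Compl_eq)
    show "\<Phi> \<in> restrict_space R A \<rightarrow>\<^sub>M restrict_space ?B A2"
      by (intro measurable_restrict_space3 \<Phi>) (auto simp: A_def)
    have "\<Psi> \<in> restrict_space ?B A2 \<rightarrow>\<^sub>M restrict_space R A"
      using bij\<Psi> by (intro measurable_restrict_space3 \<Psi>) (auto simp: bij_betw_def)
    then show "the_inv_into A \<Phi> \<in> restrict_space ?B A2 \<rightarrow>\<^sub>M restrict_space R A"
      by (subst measurable_cong[where g=\<Psi>]) (auto simp: inv sp)
    show "distr (restrict_space R A) (restrict_space ?B A2) \<Phi> = restrict_space ?B A2"
    proof (rule measure_eqI)
      fix C assume "C \<in> sets (distr (restrict_space R A) (restrict_space ?B A2) \<Phi>)"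
      then have C: "C \<in> sets ?B" "C \<subseteq> A2" "C \<in> sets (restrict_space ?B A2)"
        by (auto simp: sets_restrict_space_iff)
      have "emeasure (distr (restrict_space R A) (restrict_space ?B A2) \<Phi>) C =
          emeasure R (\<Phi> -` C \<inter> A)"
        using C \<open>\<Phi> \<in> restrict_space R A \<rightarrow>\<^sub>M restrict_space ?B A2\<close>
        by (subst emeasure_distr) (auto simp: sp emeasure_restrict_space)
      also have "\<dots> = emeasure R (\<Phi> -` C \<inter> space R)"
      proof (rule emeasure_eq_AE)
        show "AE z in R. z \<in> \<Phi> -` C \<inter> A \<longleftrightarrow> z \<in> \<Phi> -` C \<inter> space R"
          using AER AE_space[of R] by eventually_elim simp
        have "\<Phi> -` C \<inter> A = (\<Phi> -` C \<inter> space R) \<inter> A" using sp by (auto simp: G_def A_def)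
        then show "\<Phi> -` C \<inter> A \<in> sets R" using measurable_sets[OF \<Phi> C(1)] A by simp
      qed (rule measurable_sets[OF \<Phi> C(1)])
      also have "\<dots> = emeasure (distr R ?B \<Phi>) C"
        using C by (subst emeasure_distr) auto
      also have "\<dots> = emeasure (restrict_space ?B A2) C"
        using C by (simp add: law emeasure_restrict_space)
      finally show "emeasure (distr (restrict_space R A) (restrict_space ?B A2) \<Phi>) C =
          emeasure (restrict_space ?B A2) C" .
    qed simp
    show "\<Phi> (S z) = left_shift (\<Phi> z)" if "z \<in> A" for z
    proof -
      have "left_shift (\<Phi> z) \<in> A1" using that by (intro A2_A1 A2_shift) (auto simp: A_def)
      then show ?thesis by (simp add: S[OF that] A1_def)
    qed
  qed (use bijS bij_shift bij\<Phi> in auto)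
qed

section \<open>Factoring functions through a generating map\<close>

text \<open>
  If every measurable set is, up to a null set, the preimage of a set under \<open>\<Phi>\<close>, then every measurable function
  is almost everywhere a function of \<open>\<Phi>\<close>: the property passes from indicators to their linear combinations
  and monotone limits.  Applied to the identity, this inverts a generating coding.
\<close>
lemma factor_through_ennreal:
  fixes h :: "'a \<Rightarrow> ennreal"
  assumes \<Phi>: "\<Phi> \<in> M \<rightarrow>\<^sub>M M'"
    and gen: "\<And>A. A \<in> sets M \<Longrightarrow> \<exists>C\<in>sets M'. AE x in M. x \<in> A \<longleftrightarrow> \<Phi> x \<in> C"
    and h: "h \<in> borel_measurable M"
  shows "\<exists>g\<in>borel_measurable M'. AE x in M. h x = g (\<Phi> x)"
  using h
proof (induction rule: borel_measurable_induct)
  case (cong f g)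
  then obtain k where k: "k \<in> borel_measurable M'" "AE x in M. g x = k (\<Phi> x)" by blast
  from k(2) AE_space have "AE x in M. f x = k (\<Phi> x)" by eventually_elim (simp add: cong)
  with k(1) show ?case by blast
next
  case (set A)
  then obtain C where [measurable]: "C \<in> sets M'" and C: "AE x in M. x \<in> A \<longleftrightarrow> \<Phi> x \<in> C"
    using gen by auto
  from C have "AE x in M. indicator A x = (indicator C (\<Phi> x) :: ennreal)"
    by eventually_elim (simp add: indicator_def)
  then show ?case by (intro bexI[of _ "indicator C"]) simp_all
next
  case (mult f c)
  then obtain k where k: "k \<in> borel_measurable M'" "AE x in M. f x = k (\<Phi> x)" by blast
  from k(2) have "AE x in M. c * f x = c * k (\<Phi> x)" by eventually_elim simp
  with k(1) show ?case by (intro bexI[of _ "\<lambda>x. c * k x"] borel_measurable_times_ennreal) simp_all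
next
  case (add f1 f2)
  from add.IH obtain k l where kl: "k \<in> borel_measurable M'" "AE x in M. f1 x = k (\<Phi> x)"
    "l \<in> borel_measurable M'" "AE x in M. f2 x = l (\<Phi> x)" by blast
  from kl(2,4) have "AE x in M. f2 x + f1 x = l (\<Phi> x) + k (\<Phi> x)" by eventually_elim simp
  with kl(1,3) show ?case by (intro bexI[of _ "\<lambda>x. l x + k x"]) simp_all
next
  case (seq U)
  then have "\<exists>k. \<forall>i. k i \<in> borel_measurable M' \<and> (AE x in M. U i x = k i (\<Phi> x))"
    by (intro choice) blast
  then obtain k where k: "\<And>i. k i \<in> borel_measurable M'" "\<And>i. AE x in M. U i x = k i (\<Phi> x)" by auto
  have "AE x in M. \<forall>i. U i x = k i (\<Phi> x)" using k(2) by (simp add: AE_all_countable)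
  then have "AE x in M. (SUP i. U i) x = (SUP i. k i (\<Phi> x))" by eventually_elim (simp add: SUP_apply image_image)
  moreover have "(\<lambda>x. SUP i. k i x) \<in> borel_measurable M'" using k(1) by (intro borel_measurable_SUP) simp_all
  ultimately show ?case by (intro bexI[of _ "\<lambda>x. SUP i. k i x"]) simp_all
qed

lemma factor_through_real:
  fixes h :: "'a \<Rightarrow> real"
  assumes \<Phi>: "\<Phi> \<in> M \<rightarrow>\<^sub>M M'"
    and gen: "\<And>A. A \<in> sets M \<Longrightarrow> \<exists>C\<in>sets M'. AE x in M. x \<in> A \<longleftrightarrow> \<Phi> x \<in> C"
    and [measurable]: "h \<in> borel_measurable M"
  shows "\<exists>g\<in>borel_measurable M'. AE x in M. h x = g (\<Phi> x)"
proof -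
  obtain k where [measurable]: "k \<in> borel_measurable M'" and k: "AE x in M. ennreal (h x) = k (\<Phi> x)"
    using factor_through_ennreal[OF \<Phi> gen, of "\<lambda>x. ennreal (h x)"] by auto
  obtain l where [measurable]: "l \<in> borel_measurable M'" and l: "AE x in M. ennreal (- h x) = l (\<Phi> x)"
    using factor_through_ennreal[OF \<Phi> gen, of "\<lambda>x. ennreal (- h x)"] by auto
  have *: "y = enn2real (ennreal y) - enn2real (ennreal (- y))" for y :: real
    by (cases "y \<ge> 0") (auto simp: ennreal_neg)
  have "AE x in M. h x = enn2real (k (\<Phi> x)) - enn2real (l (\<Phi> x))"
    using k l by eventually_elim (subst *, simp)
  then show ?thesis by (intro bexI[of _ "\<lambda>x. enn2real (k x) - enn2real (l x)"]) auto
qed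

lemma factor_through_vec:
  fixes h :: "'a \<Rightarrow> real ^ 'n"
  assumes \<Phi>: "\<Phi> \<in> M \<rightarrow>\<^sub>M M'"
    and gen: "\<And>A. A \<in> sets M \<Longrightarrow> \<exists>C\<in>sets M'. AE x in M. x \<in> A \<longleftrightarrow> \<Phi> x \<in> C"
    and [measurable]: "h \<in> borel_measurable M"
  shows "\<exists>g\<in>borel_measurable M'. AE x in M. h x = g (\<Phi> x)"
proof -
  have h: "(\<lambda>x. h x $ i) \<in> borel_measurable M" for i
    using borel_measurable_inner[OF assms(3) measurable_const, of "axis i 1"] by (simp add: inner_axis)
  have "\<exists>g. g \<in> borel_measurable M' \<and> (AE x in M. h x $ i = g (\<Phi> x))" for i
    using factor_through_real[OF \<Phi> gen h] by blast
  then have "\<exists>g. \<forall>i. g i \<in> borel_measurable M' \<and> (AE x in M. h x $ i = g i (\<Phi> x))" by (intro choice) blast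
  then obtain g where g: "\<And>i. g i \<in> borel_measurable M'" "\<And>i. AE x in M. h x $ i = g i (\<Phi> x)" by auto
  have "AE x in M. \<forall>i. h x $ i = g i (\<Phi> x)" using g(2) by (simp add: AE_all_countable)
  then have "AE x in M. h x = (\<chi> i. g i (\<Phi> x))" by eventually_elim (simp add: vec_eq_iff)
  moreover have "(\<lambda>x. \<chi> i. g i x) \<in> borel_measurable M'"
    using g(1) by (subst borel_measurable_euclidean_space) (auto simp: Basis_vec_def inner_axis)
  ultimately show ?thesis by (intro bexI[of _ "\<lambda>x. \<chi> i. g i x"]) auto
qed

section \<open>Codings with independent letters\<close>

text \<open>
  The hypothesis \<open>law\<close> says that under \<open>M\<close> the letter \<open>\<gamma> x\<close> has distribution \<open>p\<close> and is independent of \<open>f x\<close>,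
  which in turn is distributed according to \<open>M\<close>.  It is stated for single letters, where it can be checked on
  one branch of \<open>f\<close> at a time.
\<close>
lemma letter_set_law:
  fixes p :: "nat pmf"
  assumes \<gamma>[measurable]: "\<gamma> \<in> M \<rightarrow>\<^sub>M count_space UNIV" and f[measurable]: "f \<in> M \<rightarrow>\<^sub>M M"
    and law: "\<And>a B. B \<in> sets M \<Longrightarrow> emeasure M {x\<in>space M. \<gamma> x = a \<and> f x \<in> B} = ennreal (pmf p a) * emeasure M B"
    and B: "B \<in> sets M"
  shows "emeasure M {x\<in>space M. \<gamma> x \<in> A \<and> f x \<in> B} = emeasure (measure_pmf p) A * emeasure M B"
proof -
  have [measurable]: "{x\<in>space M. \<gamma> x = a \<and> f x \<in> B} \<in> sets M" for a using B by measurable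
  have "emeasure M {x\<in>space M. \<gamma> x \<in> A \<and> f x \<in> B} = emeasure M (\<Union>a\<in>A. {x\<in>space M. \<gamma> x = a \<and> f x \<in> B})"
    by (rule arg_cong[where f="emeasure M"]) auto
  also have "\<dots> = (\<integral>\<^sup>+a. emeasure M {x\<in>space M. \<gamma> x = a \<and> f x \<in> B} \<partial>count_space A)"
    by (intro emeasure_UN_countable) (auto simp: disjoint_family_on_def)
  also have "\<dots> = (\<integral>\<^sup>+a. ennreal (pmf p a) * emeasure M B \<partial>count_space A)" by (simp add: law B)
  also have "\<dots> = (\<integral>\<^sup>+a. ennreal (pmf p a) \<partial>count_space A) * emeasure M B" by (intro nn_integral_multc) simp
  finally show ?thesis by (simp add: nn_integral_pmf)
qed

text \<open>
  Since \<open>f x\<close> is again distributed as \<open>x\<close> and is independent of the first letter, the letters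
  \<open>\<gamma> x, \<gamma> (f x), \<dots>\<close> are independent with distribution \<open>p\<close>.
\<close>
lemma word_law:
  fixes p :: "nat pmf"
  assumes M: "prob_space M"
    and \<gamma>[measurable]: "\<gamma> \<in> M \<rightarrow>\<^sub>M count_space UNIV" and f[measurable]: "f \<in> M \<rightarrow>\<^sub>M M"
    and law: "\<And>a B. B \<in> sets M \<Longrightarrow> emeasure M {x\<in>space M. \<gamma> x = a \<and> f x \<in> B} = ennreal (pmf p a) * emeasure M B"
  shows "emeasure M {x\<in>space M. \<forall>i<n. \<gamma> ((f ^^ i) x) \<in> A i} = (\<Prod>i<n. emeasure (measure_pmf p) (A i))"
proof (induction n arbitrary: A)
  case 0
  then show ?case using prob_space.emeasure_space_1[OF M] by simp
next
  case (Suc n)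
  have [measurable]: "(\<lambda>x. \<gamma> ((f ^^ i) x)) \<in> M \<rightarrow>\<^sub>M count_space UNIV" for i
    by (rule measurable_compose[OF measurable_compose_n[OF f] \<gamma>])
  let ?B = "{x\<in>space M. \<forall>i<n. \<gamma> ((f ^^ i) x) \<in> A (Suc i)}"
  have B: "?B \<in> sets M" by measurable
  have "{x\<in>space M. \<forall>i<Suc n. \<gamma> ((f ^^ i) x) \<in> A i} = {x\<in>space M. \<gamma> x \<in> A 0 \<and> f x \<in> ?B}"
    using measurable_space[OF f] by (auto simp: All_less_Suc2 funpow_swap1 simp del: funpow.simps(2))
       (simp_all add: funpow_Suc_right del: funpow.simps(2))
  then have "emeasure M {x\<in>space M. \<forall>i<Suc n. \<gamma> ((f ^^ i) x) \<in> A i} = emeasure (measure_pmf p) (A 0) * emeasure M ?B"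
    using letter_set_law[OF \<gamma> f law B] by simp
  also have "\<dots> = (\<Prod>i<Suc n. emeasure (measure_pmf p) (A i))"
    by (simp only: Suc prod.lessThan_Suc_shift)
  finally show ?case .
qed

lemma law_invariant:
  fixes p :: "nat pmf"
  assumes \<gamma>: "\<gamma> \<in> M \<rightarrow>\<^sub>M count_space UNIV" and f: "f \<in> M \<rightarrow>\<^sub>M M"
    and law: "\<And>a B. B \<in> sets M \<Longrightarrow> emeasure M {x\<in>space M. \<gamma> x = a \<and> f x \<in> B} = ennreal (pmf p a) * emeasure M B"
  shows "distr M M f = M"
proof (rule measure_eqI)
  fix B assume "B \<in> sets (distr M M f)"
  then have B: "B \<in> sets M" by simp
  have "emeasure (distr M M f) B = emeasure M {x\<in>space M. \<gamma> x \<in> UNIV \<and> f x \<in> B}"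
    using B by (subst emeasure_distr[OF f]) (auto intro!: arg_cong[where f="emeasure M"])
  also have "\<dots> = emeasure M B"
    by (subst letter_set_law[OF \<gamma> f law B]) (auto simp: measure_pmf.emeasure_space_1[simplified])
  finally show "emeasure (distr M M f) B = emeasure M B" .
qed simp

lemma AE_orbit:
  assumes f: "f \<in> M \<rightarrow>\<^sub>M M" and inv: "distr M M f = M" and P: "AE x in M. P x"
  shows "AE x in M. \<forall>i. P ((f ^^ i) x)"
proof -
  have "AE x in M. P ((f ^^ i) x)" for i
  proof (induction i)
    case (Suc i)
    then have "AE x in distr M M f. P ((f ^^ i) x)" by (simp only: inv)
    from AE_distrD[OF f this] show ?case by (simp add: funpow_swap1)
  qed (simp add: P)
  then show ?thesis by (simp add: AE_all_countable)
qed

text \<open>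
  Symmetric windows \<open>{- n..<n}\<close> are enough, because the constraint at a coordinate can be the full alphabet.
\<close>
lemma distr_eq_bernoulliI:
  fixes p :: "nat pmf"
  assumes R: "prob_space R" and \<Phi>: "\<Phi> \<in> R \<rightarrow>\<^sub>M bernoulli_measure p"
    and rect: "\<And>n A. emeasure R {z\<in>space R. \<forall>i\<in>{-int n..<int n}. \<Phi> z i \<in> A i} =
      (\<Prod>i\<in>{-int n..<int n}. emeasure (measure_pmf p) (A i))"
  shows "distr R (bernoulli_measure p) \<Phi> = bernoulli_measure p"
  unfolding bernoulli_measure_def
proof (rule measure_eqI_PiM_infinite)
  interpret R: prob_space R by fact
  interpret product_prob_space "\<lambda>_. measure_pmf p" "UNIV :: int set"
    by unfold_locales
  have \<Phi>': "\<Phi> \<in> R \<rightarrow>\<^sub>M Pi\<^sub>M UNIV (\<lambda>i. measure_pmf p)" using \<Phi> by (simp add: bernoulli_measure_def)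
  show "finite_measure (distr R (Pi\<^sub>M UNIV (\<lambda>i. measure_pmf p)) \<Phi>)"
    by (rule R.finite_measure_distr[OF \<Phi>'])
  fix A :: "int \<Rightarrow> nat set" and J :: "int set" assume J: "finite J"
  define n where "n = nat (Max (insert 0 (abs ` J))) + 1"
  have n: "J \<subseteq> {-int n..<int n}"
  proof
    fix j assume "j \<in> J"
    then have "\<bar>j\<bar> \<le> Max (insert 0 (abs ` J))" using J by (intro Max_ge) auto
    then show "j \<in> {-int n..<int n}" by (auto simp: n_def)
  qed
  let ?A = "\<lambda>i. if i \<in> J then A i else UNIV"
  have sp: "space R \<inter> \<Phi> -` prod_emb UNIV (\<lambda>_. measure_pmf p) J (Pi\<^sub>E J A) =
      {z\<in>space R. \<forall>i\<in>{-int n..<int n}. \<Phi> z i \<in> ?A i}"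
    using n by (fastforce simp: prod_emb_def PiE_iff extensional_def)
  have "emeasure (distr R (Pi\<^sub>M UNIV (\<lambda>i. measure_pmf p)) \<Phi>) (prod_emb UNIV (\<lambda>_. measure_pmf p) J (Pi\<^sub>E J A)) =
      emeasure R (space R \<inter> \<Phi> -` prod_emb UNIV (\<lambda>_. measure_pmf p) J (Pi\<^sub>E J A))"
    using J by (subst emeasure_distr[OF \<Phi>']) (auto intro!: sets_PiM_I simp: Int_commute)
  also have "\<dots> = (\<Prod>i\<in>{-int n..<int n}. emeasure (measure_pmf p) (?A i))"
    unfolding sp by (rule rect)
  also have "\<dots> = (\<Prod>i\<in>J. emeasure (measure_pmf p) (A i))"
    using n by (intro prod.mono_neutral_cong_right) (auto simp: measure_pmf.emeasure_space_1[simplified])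
  also have "\<dots> = emeasure (Pi\<^sub>M UNIV (\<lambda>i. measure_pmf p)) (prod_emb UNIV (\<lambda>_. measure_pmf p) J (Pi\<^sub>E J A))"
    using J by (subst emeasure_PiM_emb) auto
  finally show "emeasure (distr R (Pi\<^sub>M UNIV (\<lambda>i. measure_pmf p)) \<Phi>) (prod_emb UNIV (\<lambda>_. measure_pmf p) J (Pi\<^sub>E J A)) =
      emeasure (Pi\<^sub>M UNIV (\<lambda>i. measure_pmf p)) (prod_emb UNIV (\<lambda>_. measure_pmf p) J (Pi\<^sub>E J A))" .
qed auto

section \<open>Affine tilings of an interval\<close>

text \<open>
  Countably many disjoint intervals in \<open>[0, \<rho>)\<close> whose relative lengths are the weights of a probability
  vector; they cover \<open>[0, \<rho>)\<close> up to a null set.  The expanding map that stretches each of them affinely onto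
  \<open>[0, \<rho>)\<close> produces independent letters, and it is inverted on each tile by \<open>tile_map\<close>.
\<close>
locale affine_tiling =
  fixes p :: "nat pmf" and b :: "nat \<Rightarrow> real" and \<rho> :: real
  assumes \<rho>_pos: "\<rho> > 0"
    and b_nonneg: "\<And>a. a \<in> set_pmf p \<Longrightarrow> 0 \<le> b a"
    and b_le: "\<And>a. a \<in> set_pmf p \<Longrightarrow> b a + pmf p a * \<rho> \<le> \<rho>"
    and disjoint: "\<And>a a' y. a \<in> set_pmf p \<Longrightarrow> a' \<in> set_pmf p \<Longrightarrow>
      y \<in> {b a..<b a + pmf p a * \<rho>} \<Longrightarrow> y \<in> {b a'..<b a' + pmf p a' * \<rho>} \<Longrightarrow> a = a'"
begin

definition tile :: "nat \<Rightarrow> real set" where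
  "tile a = (if a \<in> set_pmf p then {b a..<b a + pmf p a * \<rho>} else {})"

definition tile_map :: "nat \<Rightarrow> real \<Rightarrow> real" where
  "tile_map a y = b a + pmf p a * y"

definition tile_index :: "real \<Rightarrow> nat" where
  "tile_index y = (if \<exists>a. y \<in> tile a then THE a. y \<in> tile a else 0)"

definition expand :: "real \<Rightarrow> real" where
  "expand y = (y - b (tile_index y)) / pmf p (tile_index y)"

text \<open>
  The points at which all iterates of \<open>expand\<close> are determined by the tiling; at a point outside all tiles
  the values of \<open>tile_index\<close> and \<open>expand\<close> are arbitrary.
\<close>
definition coded :: "real set" where
  "coded = {y\<in>{0..<\<rho>}. \<forall>i. \<exists>a. (expand ^^ i) y \<in> tile a}"

lemma tile_sets [measurable]: "tile a \<in> sets borel"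
  by (simp add: tile_def)

lemma tile_subset: "tile a \<subseteq> {0..<\<rho>}"
  using b_nonneg[of a] b_le[of a] by (auto simp: tile_def)

lemma tile_index_eq: "y \<in> tile a \<Longrightarrow> tile_index y = a"
proof -
  assume y: "y \<in> tile a"
  have "(THE a. y \<in> tile a) = a"
  proof (rule the_equality)
    show "y \<in> tile a" by (rule y)
    fix a' assume "y \<in> tile a'"
    then show "a' = a" using y disjoint[of a' a y] by (auto simp: tile_def split: if_splits)
  qed
  then show ?thesis using y by (auto simp: tile_index_def)
qed

lemma tile_map_in_tile: "a \<in> set_pmf p \<Longrightarrow> y \<in> {0..<\<rho>} \<Longrightarrow> tile_map a y \<in> tile a"
  using pmf_positive[of a p] by (auto simp: tile_def tile_map_def)

lemma expand_in: "y \<in> tile a \<Longrightarrow> expand y \<in> {0..<\<rho>}"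
  using pmf_positive[of a p]
  by (auto simp: expand_def tile_index_eq, auto simp: tile_def field_simps split: if_splits)

lemma tile_map_expand: "y \<in> tile a \<Longrightarrow> tile_map a (expand y) = y"
  using pmf_positive[of a p]
  by (simp add: tile_map_def expand_def tile_index_eq) (auto simp: tile_def split: if_splits)

lemma expand_tile_map: "a \<in> set_pmf p \<Longrightarrow> y \<in> {0..<\<rho>} \<Longrightarrow> expand (tile_map a y) = y"
  using tile_index_eq[OF tile_map_in_tile] pmf_positive[of a p] by (simp add: expand_def tile_map_def)

lemma tile_index_measurable [measurable]: "tile_index \<in> borel \<rightarrow>\<^sub>M count_space UNIV"
proof (subst measurable_count_space_eq2_countable, safe)
  fix a
  have "tile_index -` {a} \<inter> space borel = tile a \<union> (if a = 0 then UNIV - (\<Union>a. tile a) else {})"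
    (is "?l = ?r")
  proof (intro set_eqI)
    fix y show "y \<in> ?l \<longleftrightarrow> y \<in> ?r"
    proof (cases "\<exists>a'. y \<in> tile a'")
      case True
      then obtain a' where "y \<in> tile a'" by auto
      then show ?thesis using tile_index_eq[of y] by auto
    qed (auto simp: tile_index_def)
  qed
  also have "\<dots> \<in> sets borel" by (intro sets.Un tile_sets) (auto intro!: sets.Diff sets.countable_UN)
  finally show "tile_index -` {a} \<inter> space borel \<in> sets borel" .
qed auto

lemma expand_measurable [measurable]: "expand \<in> borel \<rightarrow>\<^sub>M borel"
proof -
  have "(\<lambda>y. (\<lambda>a y. (y - b a) / pmf p a) (tile_index y) y) \<in> borel \<rightarrow>\<^sub>M borel"
    by (rule measurable_compose_countable) measurable
  then show ?thesis by (simp add: expand_def[abs_def])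
qed

lemma emeasure_tile: "emeasure lborel (tile a) = ennreal (pmf p a) * ennreal \<rho>"
  using \<rho>_pos by (auto simp: tile_def ennreal_mult' set_pmf_iff)

lemma emeasure_tiles: "emeasure lborel (\<Union>a. tile a) = ennreal \<rho>"
proof -
  have "emeasure lborel (\<Union>a. tile a) = (\<integral>\<^sup>+a. emeasure lborel (tile a) \<partial>count_space UNIV)"
    using tile_index_eq by (intro emeasure_UN_countable) (auto simp: disjoint_family_on_def)
  also have "\<dots> = (\<integral>\<^sup>+a. ennreal (pmf p a) \<partial>count_space UNIV) * ennreal \<rho>"
    by (simp add: emeasure_tile nn_integral_multc)
  also have "\<dots> = ennreal \<rho>" by (simp add: nn_integral_pmf measure_pmf.emeasure_space_1[simplified])
  finally show ?thesis .
qed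

lemma untiled_null: "emeasure lborel ({0..<\<rho>} - (\<Union>a. tile a)) = 0"
  using tile_subset \<rho>_pos by (subst emeasure_Diff) (auto simp: emeasure_tiles)

text \<open>
  On the tile \<open>a\<close> the map \<open>expand\<close> is the inverse of the affine map \<open>tile_map a\<close>, which has slope \<open>pmf p a\<close>.
\<close>
lemma expand_law:
  assumes [measurable]: "B \<in> sets borel" and B: "B \<subseteq> {0..<\<rho>}"
  shows "emeasure lborel {y\<in>{0..<\<rho>}. tile_index y = a \<and> expand y \<in> B} = ennreal (pmf p a) * emeasure lborel B"
proof (cases "a \<in> set_pmf p")
  case True
  then have pos: "pmf p a > 0" by (rule pmf_positive)
  have *: "tile_map a ` B \<in> sets borel"
  proof -
    have "tile_map a ` B = (\<lambda>y. (y - b a) / pmf p a) -` B \<inter> space borel"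
    proof (intro set_eqI iffI)
      fix y assume "y \<in> (\<lambda>y. (y - b a) / pmf p a) -` B \<inter> space borel"
      then show "y \<in> tile_map a ` B"
        using pos by (intro image_eqI[of _ _ "(y - b a) / pmf p a"]) (auto simp: tile_map_def)
    qed (use pos in \<open>auto simp: tile_map_def\<close>)
    also have "\<dots> \<in> sets borel" by (rule measurable_sets[where A=borel]) measurable
    finally show ?thesis .
  qed
  have "emeasure lborel {y\<in>{0..<\<rho>}. tile_index y = a \<and> expand y \<in> B} = emeasure lborel (tile_map a ` B)"
  proof (rule emeasure_eq_AE)
    have "AE y in lborel. y \<notin> {0..<\<rho>} - (\<Union>a. tile a)"
      by (rule AE_not_in) (auto simp: null_sets_def untiled_null)
    then show "AE y in lborel. y \<in> {y\<in>{0..<\<rho>}. tile_index y = a \<and> expand y \<in> B} \<longleftrightarrow> y \<in> tile_map a ` B"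
    proof eventually_elim
      fix y assume y: "y \<notin> {0..<\<rho>} - (\<Union>a. tile a)"
      show "y \<in> {y\<in>{0..<\<rho>}. tile_index y = a \<and> expand y \<in> B} \<longleftrightarrow> y \<in> tile_map a ` B" (is "?l \<longleftrightarrow> ?r")
      proof
        assume ?l
        then obtain a' where "y \<in> tile a'" using y by auto
        with \<open>?l\<close> have "y \<in> tile a" using tile_index_eq by auto
        then have "y = tile_map a (expand y)" using tile_map_expand by simp
        then show ?r using \<open>?l\<close> by auto
      next
        assume ?r
        then obtain y' where y': "y' \<in> B" "y = tile_map a y'" by auto
        with B have "y' \<in> {0..<\<rho>}" by auto
        from tile_map_in_tile[OF True this] expand_tile_map[OF True this] y' tile_subset[of a] show ?l
          using tile_index_eq[of y a] by auto
      qed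
    qed
  qed (use * in measurable)
  also have "\<dots> = ennreal (pmf p a) * emeasure lborel B"
  proof -
    have "tile_map a -` tile_map a ` B = B" using pos by (auto simp: tile_map_def)
    moreover have "(\<lambda>y. b a + pmf p a * y) = tile_map a" by (simp add: tile_map_def[abs_def])
    moreover have "tile_map a \<in> borel_measurable lborel" by (simp add: tile_map_def[abs_def])
    ultimately show ?thesis
      using pos * by (subst lborel_real_affine[of "pmf p a" "b a"])
        (simp_all add: emeasure_density_const emeasure_distr)
  qed
  finally show ?thesis .
next
  case False
  have "{y\<in>{0..<\<rho>}. tile_index y = a \<and> expand y \<in> B} \<subseteq> {0..<\<rho>} - (\<Union>a. tile a)"
  proof safe
    fix y a' assume "y \<in> tile a'" "a = tile_index y"
    then have "y \<in> tile a" using tile_index_eq[of y a'] by simp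
    then show False using False by (simp add: tile_def)
  qed
  then have "emeasure lborel {y\<in>{0..<\<rho>}. tile_index y = a \<and> expand y \<in> B} \<le> 0"
    unfolding untiled_null[symmetric] by (intro emeasure_mono) auto
  then show ?thesis using False by (simp add: set_pmf_iff)
qed

abbreviation fibre_measure :: "real measure" where
  "fibre_measure \<equiv> uniform_measure lborel {0..<\<rho>}"

lemma prob_space_fibre: "prob_space fibre_measure"
  using \<rho>_pos by (intro prob_space_uniform_measure) auto

lemma AE_tiled: "AE y in fibre_measure. y \<in> {0..<\<rho>} \<and> (\<exists>a. y \<in> tile a)"
proof -
  have "AE y in lborel. y \<notin> {0..<\<rho>} - (\<Union>a. tile a)"
    by (rule AE_not_in) (auto simp: null_sets_def untiled_null)
  then have "AE y in lborel. y \<in> {0..<\<rho>} \<longrightarrow> y \<in> {0..<\<rho>} \<and> (\<exists>a. y \<in> tile a)"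
    by eventually_elim auto
  then show ?thesis by (rule AE_uniform_measureI[rotated]) simp
qed

lemma fibre_law:
  assumes [measurable]: "B \<in> sets fibre_measure"
  shows "emeasure fibre_measure {y\<in>space fibre_measure. tile_index y = a \<and> expand y \<in> B} =
    ennreal (pmf p a) * emeasure fibre_measure B"
proof -
  have B[measurable]: "B \<in> sets borel" using assms by simp
  have "emeasure fibre_measure {y\<in>space fibre_measure. tile_index y = a \<and> expand y \<in> B} =
      emeasure fibre_measure {y\<in>{0..<\<rho>}. tile_index y = a \<and> expand y \<in> B \<inter> {0..<\<rho>}}"
  proof (rule emeasure_eq_AE)
    show "AE y in fibre_measure. y \<in> {y\<in>space fibre_measure. tile_index y = a \<and> expand y \<in> B} \<longleftrightarrow>
        y \<in> {y\<in>{0..<\<rho>}. tile_index y = a \<and> expand y \<in> B \<inter> {0..<\<rho>}}"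
      using AE_tiled by eventually_elim (use expand_in in auto)
  qed measurable
  also have "\<dots> = emeasure lborel {y\<in>{0..<\<rho>}. tile_index y = a \<and> expand y \<in> B \<inter> {0..<\<rho>}} / emeasure lborel {0..<\<rho>}"
    by (subst emeasure_uniform_measure) (auto intro!: arg_cong2[where f="(/)"] arg_cong[where f="emeasure lborel"])
  also have "\<dots> = ennreal (pmf p a) * emeasure lborel ({0..<\<rho>} \<inter> B) / emeasure lborel {0..<\<rho>}"
    by (subst expand_law) (auto simp: Int_commute)
  also have "\<dots> = ennreal (pmf p a) * emeasure fibre_measure B"
    by (subst emeasure_uniform_measure) (auto simp: ennreal_times_divide)
  finally show ?thesis .
qed

lemma expand_fibre_measurable: "expand \<in> fibre_measure \<rightarrow>\<^sub>M fibre_measure"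
  "tile_index \<in> fibre_measure \<rightarrow>\<^sub>M count_space UNIV"
  by (simp_all cong: measurable_cong_sets)

lemma AE_coded: "AE y in fibre_measure. y \<in> coded"
proof -
  have "AE y in fibre_measure. \<forall>i. (expand ^^ i) y \<in> {0..<\<rho>} \<and> (\<exists>a. (expand ^^ i) y \<in> tile a)"
    by (rule AE_orbit[OF expand_fibre_measurable(1) law_invariant[OF expand_fibre_measurable(2,1) fibre_law] AE_tiled])
  then show ?thesis by eventually_elim (auto simp: coded_def dest: spec[of _ 0])
qed

abbreviation fibre_code :: "real \<Rightarrow> nat \<Rightarrow> nat" where
  "fibre_code y i \<equiv> tile_index ((expand ^^ i) y)"

text \<open>
  The left end of the nested tile with the given first \<open>m\<close> letters.
\<close>
primrec decode :: "nat \<Rightarrow> (nat \<Rightarrow> nat) \<Rightarrow> real" where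
  "decode 0 \<omega> = 0"
| "decode (Suc m) \<omega> = tile_map (\<omega> 0) (decode m (\<lambda>i. \<omega> (Suc i)))"

definition fibre_point :: "(nat \<Rightarrow> nat) \<Rightarrow> real" where
  "fibre_point \<omega> = lim (\<lambda>m. decode m \<omega>)"

lemma decode_measurable:
  assumes "\<And>i. (\<lambda>x. h x i) \<in> M \<rightarrow>\<^sub>M count_space UNIV"
  shows "(\<lambda>x. decode m (h x)) \<in> borel_measurable M"
  using assms
proof (induction m arbitrary: h)
  case (Suc m)
  have [measurable]: "(\<lambda>x. h x 0) \<in> M \<rightarrow>\<^sub>M count_space UNIV" "(\<lambda>x. decode m (\<lambda>i. h x (Suc i))) \<in> borel_measurable M"
    by (rule Suc)+
  show ?case unfolding decode.simps tile_map_def by measurable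
qed simp

lemma fibre_point_measurable:
  assumes "\<And>i. (\<lambda>x. h x i) \<in> M \<rightarrow>\<^sub>M count_space UNIV"
  shows "(\<lambda>x. fibre_point (h x)) \<in> borel_measurable M"
  unfolding fibre_point_def by (intro borel_measurable_lim_metric decode_measurable assms)

lemma coded_expand: "y \<in> coded \<Longrightarrow> expand y \<in> coded"
proof -
  assume y: "y \<in> coded"
  have "\<exists>a. (expand ^^ i) (expand y) \<in> tile a" for i
    using y spec[of "\<lambda>i. \<exists>a. (expand ^^ i) y \<in> tile a" "Suc i"] by (simp add: coded_def funpow_swap1)
  moreover from y obtain a where "y \<in> tile a" by (auto simp: coded_def dest: spec[of _ 0])
  ultimately show ?thesis using expand_in[of y a] by (auto simp: coded_def)
qed

lemma coded_range: "y \<in> coded \<Longrightarrow> y \<in> {0..<\<rho>}"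
  by (auto simp: coded_def)

lemma coded_tile_map:
  assumes "y \<in> coded" "a \<in> set_pmf p"
  shows "tile_map a y \<in> coded" "tile_index (tile_map a y) = a" "expand (tile_map a y) = y"
proof -
  note y = coded_range[OF assms(1)]
  note t = tile_map_in_tile[OF assms(2) y]
  show 1: "tile_index (tile_map a y) = a" "expand (tile_map a y) = y"
    using tile_index_eq[OF t] expand_tile_map[OF assms(2) y] by auto
  have "\<exists>a'. (expand ^^ i) (tile_map a y) \<in> tile a'" for i
    using t assms(1) by (cases i) (auto simp: coded_def funpow_swap1 1)
  then show "tile_map a y \<in> coded" using t tile_subset[of a] by (auto simp: coded_def)
qed

text \<open>
  A point and the left end of the nested tile of depth \<open>m\<close> that contains it differ by at most the length of that
  tile, and each further letter shortens the tile by a factor of at most \<open>r\<close>.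
\<close>
lemma decode_error:
  assumes "y \<in> coded" and r: "\<And>a. pmf p a \<le> r"
  shows "\<bar>y - decode m (fibre_code y)\<bar> \<le> \<rho> * r ^ m"
  using assms(1)
proof (induction m arbitrary: y)
  case 0
  then show ?case by (auto simp: coded_def)
next
  case (Suc m)
  from Suc.prems obtain a where a: "y \<in> tile a" by (auto simp: coded_def dest: spec[of _ 0])
  have "y - decode (Suc m) (fibre_code y) = pmf p a * (expand y - decode m (fibre_code (expand y)))"
    using tile_map_expand[OF a]
    by (simp add: tile_index_eq[OF a] tile_map_def right_diff_distrib funpow_swap1)
  also have "\<bar>\<dots>\<bar> \<le> r * (\<rho> * r ^ m)"
    unfolding abs_mult using r[of a] Suc.IH[OF coded_expand[OF Suc.prems]] order_trans[OF pmf_nonneg r]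
    by (intro mult_mono) auto
  finally show ?case by (simp add: mult.left_commute)
qed

lemma decode_fibre_code_LIMSEQ:
  assumes "y \<in> coded" and nontriv: "\<And>a. pmf p a < 1"
  shows "(\<lambda>m. decode m (fibre_code y)) \<longlonglongrightarrow> y"
proof -
  \<comment> \<open>The weights are bounded away from 1: if one of them is positive, then the others are at most its
    complement.\<close>
  obtain r where r: "r < 1" "\<And>a. pmf p a \<le> r"
  proof -
    obtain a0 where a0: "pmf p a0 > 0" using set_pmf_not_empty[of p] pmf_positive[of _ p] by auto
    have "pmf p a \<le> max (pmf p a0) (1 - pmf p a0)" for a
    proof (cases "a = a0")
      case False
      then have "pmf p a + pmf p a0 = measure (measure_pmf p) {a, a0}"
        by (subst measure_measure_pmf_finite) auto
      then show ?thesis using measure_pmf.prob_le_1[of p "{a, a0}"] by linarith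
    qed auto
    with that[of "max (pmf p a0) (1 - pmf p a0)"] a0 nontriv[of a0] show ?thesis by auto
  qed
  have "0 \<le> r" using order_trans[OF pmf_nonneg r(2)] .
  then have lim: "(\<lambda>m. \<rho> * r ^ m) \<longlonglongrightarrow> 0" using r(1) by (intro tendsto_mult_right_zero LIMSEQ_realpow_zero)
  have "\<forall>m. norm (decode m (fibre_code y) - y) \<le> \<rho> * r ^ m"
    using decode_error[OF assms(1) r(2)] by (simp add: abs_minus_commute)
  then have "(\<lambda>m. decode m (fibre_code y) - y) \<longlonglongrightarrow> 0"
    by (rule Lim_null_comparison[OF always_eventually lim])
  then show ?thesis by (rule LIM_zero_cancel)
qed

lemma fibre_point_code:
  assumes "y \<in> coded" and nontriv: "\<And>a. pmf p a < 1"
  shows "fibre_point (fibre_code y) = y"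
  unfolding fibre_point_def by (rule limI decode_fibre_code_LIMSEQ assms)+

end

section \<open>Levels of the Hofbauer tower\<close>

text \<open>
  By the stretching condition \<open>T\<close> is essentially injective on each \<open>Z j\<close>: for disjoint \<open>A, B \<subseteq> Z j\<close> it forces
  \<open>T ` A\<close> and \<open>T ` B\<close> to overlap in a null set only.
\<close>
locale tower_system =
  fixes X :: "(real ^ 'n) set" and M :: "(real ^ 'n) measure" and T :: "real ^ 'n \<Rightarrow> real ^ 'n"
    and N :: nat and Z :: "nat \<Rightarrow> (real ^ 'n) set" and s :: "nat \<Rightarrow> real"
    and \<alpha> :: "nat set" and D :: "nat \<Rightarrow> (real ^ 'n) set"
  assumes compact_X: "compact X" and lebesgue: "lebesgue_prob_on X M"
    and partition: "partition_mod_null M N Z"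
    and T_into: "T \<in> X \<rightarrow> X"
    and image_sets: "\<And>A. A \<in> sets M \<Longrightarrow> T ` A \<in> sets M"
    and vimage_sets: "\<And>A. A \<in> sets M \<Longrightarrow> T -` A \<inter> X \<in> sets M"
    and vimage_null: "\<And>A. A \<in> sets M \<Longrightarrow> emeasure M A = 0 \<Longrightarrow> emeasure M (T -` A \<inter> X) = 0"
    and s_ge_1: "\<And>j. j \<in> {1..N} \<Longrightarrow> s j \<ge> 1"
    and emeasure_image: "\<And>j A. j \<in> {1..N} \<Longrightarrow> A \<in> sets M \<Longrightarrow> A \<subseteq> Z j \<Longrightarrow>
      emeasure M (T ` A) = ennreal (s j) * emeasure M A"
    and tower: "tower_enumeration M N Z T \<alpha> D"
begin

lemma space_M: "space M = X" and prob_space_M: "prob_space M"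
  using lebesgue by (auto simp: lebesgue_prob_on_def)

sublocale prob_space M by (rule prob_space_M)

lemma borel_subset_in_sets: "A \<in> sets borel \<Longrightarrow> A \<subseteq> X \<Longrightarrow> A \<in> sets M"
proof -
  assume A: "A \<in> sets borel" "A \<subseteq> X"
  have "X \<inter> A \<in> sets (restrict_space borel X)" unfolding sets_restrict_space by (rule imageI[OF A(1)])
  moreover have "X \<inter> A = A" using A by blast
  moreover have "sets (restrict_space borel X) \<subseteq> sets M" using lebesgue unfolding lebesgue_prob_on_def by blast
  ultimately show "A \<in> sets M" by (simp only: subset_iff)
qed

lemma Z_closed: "j \<in> {1..N} \<Longrightarrow> closed (Z j)" and Z_subset: "j \<in> {1..N} \<Longrightarrow> Z j \<subseteq> X"
  using partition by (auto simp: partition_mod_null_def space_M)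

lemma Z_sets: "j \<in> {1..N} \<Longrightarrow> Z j \<in> sets M"
  using Z_closed Z_subset by (intro borel_subset_in_sets) auto

lemma Z_overlap_null: "i \<in> {1..N} \<Longrightarrow> j \<in> {1..N} \<Longrightarrow> i \<noteq> j \<Longrightarrow> Z i \<inter> Z j \<in> null_sets M"
  using partition unfolding partition_mod_null_def by (intro null_setsI sets.Int Z_sets) blast+

lemma T_measurable [measurable]: "T \<in> M \<rightarrow>\<^sub>M M"
  using T_into vimage_sets by (intro measurableI) (auto simp: space_M)

lemma T_pow_measurable: "(T ^^ n) \<in> M \<rightarrow>\<^sub>M M"
  by (rule measurable_compose_n[OF T_measurable])

lemma AE_T: "AE x in M. P x \<Longrightarrow> AE x in M. P (T x)"
proof -
  assume "AE x in M. P x"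
  then obtain E where E: "E \<in> null_sets M" "\<And>x. x \<in> space M - E \<Longrightarrow> P x" by (auto elim!: AE_E3)
  have "T -` E \<inter> X \<in> null_sets M"
    by (rule null_setsI[OF vimage_null[OF null_setsD2[OF E(1)] null_setsD1[OF E(1)]] vimage_sets[OF null_setsD2[OF E(1)]]])
  then have "AE x in M. x \<notin> T -` E \<inter> X" by (rule AE_not_in)
  with AE_space show "AE x in M. P (T x)"
  proof eventually_elim
    case (elim x)
    then have "T x \<in> space M - E" using T_into by (auto simp: space_M)
    then show ?case by (rule E(2))
  qed
qed

lemma AE_T_pow: "AE x in M. P x \<Longrightarrow> AE x in M. \<forall>n. P ((T ^^ n) x)"
proof -
  assume P: "AE x in M. P x"
  have "AE x in M. P ((T ^^ n) x)" for n
  proof (induction n)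
    case (Suc n)
    then show ?case using AE_T[of "\<lambda>x. P ((T ^^ n) x)"] by (simp add: funpow_swap1)
  qed (simp add: P)
  then show ?thesis by (simp add: AE_all_countable)
qed

lemma cylinder_sets: "set js \<subseteq> {1..N} \<Longrightarrow> cylinder M T Z js \<in> sets M"
proof -
  assume js: "set js \<subseteq> {1..N}"
  have "(T ^^ i) -` Z (js ! i) \<inter> space M \<in> sets M" if "i < length js" for i
    by (rule measurable_sets[OF T_pow_measurable Z_sets[OF subsetD[OF js nth_mem[OF that]]]])
  moreover have "(T ^^ i) -` Z (js ! i) \<inter> space M = {x\<in>space M. (T ^^ i) x \<in> Z (js ! i)}" for i by auto
  ultimately have "{x\<in>space M. \<forall>i\<in>{..<length js}. (T ^^ i) x \<in> Z (js ! i)} \<in> sets M"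
    by (intro sets.sets_Collect_finite_All) simp_all
  moreover have "cylinder M T Z js = {x\<in>space M. \<forall>i\<in>{..<length js}. (T ^^ i) x \<in> Z (js ! i)}"
    unfolding cylinder_def by auto
  ultimately show ?thesis by simp
qed

lemma image_pow_sets: "A \<in> sets M \<Longrightarrow> (T ^^ n) ` A \<in> sets M"
proof (induction n)
  case (Suc n)
  then show ?case using image_sets[of "(T ^^ n) ` A"] by (simp add: image_comp)
qed simp

text \<open>
  As the slopes are at least 1, forward images do not lose measure.  This is why all levels have positive
  measure.
\<close>
lemma emeasure_image_cylinder:
  assumes "js \<in> cylinder_words M N Z T n" "i \<le> n"
  shows "emeasure M ((T ^^ i) ` cylinder M T Z js) > 0"
  using assms(2)
proof (induction i)
  case 0
  then show ?case using assms by (simp add: cylinder_words_def)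
next
  case (Suc i)
  let ?A = "(T ^^ i) ` cylinder M T Z js"
  have js: "length js = Suc n" "set js \<subseteq> {1..N}" using assms by (auto simp: cylinder_words_def)
  have j: "js ! i \<in> {1..N}" using Suc.prems by (intro subsetD[OF js(2)] nth_mem) (simp add: js)
  have "?A \<subseteq> Z (js ! i)" using js Suc.prems by (auto simp: cylinder_def)
  then have "emeasure M (T ` ?A) = ennreal (s (js ! i)) * emeasure M ?A"
    by (intro emeasure_image[OF j] image_pow_sets cylinder_sets js(2))
  also have "\<dots> > 0" using Suc s_ge_1[OF j] by (auto simp: ennreal_zero_less_mult_iff)
  finally show ?case by (simp add: image_comp)
qed

lemma level_props:
  assumes "u \<in> \<alpha>"
  shows "closed (D u)" "\<exists>k\<in>{1..N}. D u \<subseteq> Z k" "emeasure M (D u) > 0"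
proof -
  from assms tower obtain n js where js: "js \<in> cylinder_words M N Z T n"
    and D: "D u = closure ((T ^^ n) ` cylinder M T Z js)"
    by (auto simp: tower_enumeration_def tower_levels_def)
  have l: "length js = Suc n" "set js \<subseteq> {1..N}" using js by (auto simp: cylinder_words_def)
  have j: "js ! n \<in> {1..N}" by (intro subsetD[OF l(2)] nth_mem) (simp add: l)
  show cl: "closed (D u)" by (simp add: D)
  have "D u \<subseteq> Z (js ! n)"
    unfolding D using l by (intro closure_minimal Z_closed j) (auto simp: cylinder_def)
  then show "\<exists>k\<in>{1..N}. D u \<subseteq> Z k" using j by auto
  have "D u \<in> sets M" using cl \<open>D u \<subseteq> Z (js ! n)\<close> Z_subset[OF j] by (intro borel_subset_in_sets) auto
  have "0 < emeasure M ((T ^^ n) ` cylinder M T Z js)"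
    by (rule emeasure_image_cylinder[OF js]) simp
  also have "\<dots> \<le> emeasure M (D u)"
    unfolding D using \<open>D u \<in> sets M\<close> by (intro emeasure_mono closure_subset) (simp add: D)
  finally show "emeasure M (D u) > 0" .
qed

text \<open>
  The index of the only set \<open>Z k\<close> that contains the level.
\<close>
definition level_cell :: "nat \<Rightarrow> nat" where
  "level_cell u = (SOME k. k \<in> {1..N} \<and> D u \<subseteq> Z k)"

abbreviation slope :: "nat \<Rightarrow> real" where
  "slope u \<equiv> s (level_cell u)"

lemma level_cell: assumes "u \<in> \<alpha>" shows "level_cell u \<in> {1..N}" "D u \<subseteq> Z (level_cell u)"
proof -
  obtain k where "k \<in> {1..N} \<and> D u \<subseteq> Z k" using level_props(2)[OF assms] by blast
  then have "level_cell u \<in> {1..N} \<and> D u \<subseteq> Z (level_cell u)" unfolding level_cell_def by (rule someI)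
  then show "level_cell u \<in> {1..N}" "D u \<subseteq> Z (level_cell u)" by (rule conjunct1, rule conjunct2)
qed

lemma level_cell_unique:
  assumes "u \<in> \<alpha>" "k \<in> {1..N}" "D u \<subseteq> Z k" shows "k = level_cell u"
proof (rule ccontr)
  assume "k \<noteq> level_cell u"
  then have "emeasure M (Z k \<inter> Z (level_cell u)) = 0"
    by (rule null_setsD1[OF Z_overlap_null[OF assms(2) level_cell(1)[OF assms(1)]]])
  moreover have "emeasure M (D u) \<le> emeasure M (Z k \<inter> Z (level_cell u))"
    by (intro emeasure_mono sets.Int Z_sets Int_greatest assms level_cell)
  ultimately show False using level_props(3)[OF assms(1)] by simp
qed

lemma slope_ge_1: "u \<in> \<alpha> \<Longrightarrow> slope u \<ge> 1"
  by (intro s_ge_1 level_cell)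

lemma D_subset: "u \<in> \<alpha> \<Longrightarrow> D u \<subseteq> X"
  by (rule order_trans[OF level_cell(2) Z_subset[OF level_cell(1)]])

lemma D_closed: "u \<in> \<alpha> \<Longrightarrow> closed (D u)" by (rule level_props)

lemma D_sets: "u \<in> \<alpha> \<Longrightarrow> D u \<in> sets M"
  using D_closed D_subset by (intro borel_subset_in_sets) auto

lemma D_pos: "u \<in> \<alpha> \<Longrightarrow> measure M (D u) > 0"
  using level_props(3)[of u] by (simp add: emeasure_eq_measure)

lemma N_in_\<alpha>: "{1..N} \<subseteq> \<alpha>" "u \<in> {1..N} \<Longrightarrow> D u = Z u"
  by (rule tower[unfolded tower_enumeration_def, THEN conjunct1],
      rule tower[unfolded tower_enumeration_def, THEN conjunct2, THEN conjunct1, THEN bspec])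

abbreviation step :: "nat \<Rightarrow> nat \<Rightarrow> nat \<Rightarrow> bool" where
  "step j u v \<equiv> level_step M Z T D j u v"

abbreviation arrow :: "nat \<Rightarrow> nat \<Rightarrow> bool" where
  "arrow u v \<equiv> level_arrow M N Z T D u v"

lemma step_null: "step j u v \<Longrightarrow> sym_diff (Z j \<inter> T ` D u) (D v) \<in> null_sets M"
  unfolding level_step_def eq_mod_null_def by (rule conjunct2)

text \<open>
  The levels are pairwise inequivalent, so an image piece represents at most one of them; hence the definite
  description in the tower map is meaningful.
\<close>
lemma step_unique:
  assumes "v \<in> \<alpha>" "v' \<in> \<alpha>" "step j u v" "step j u v'" shows "v = v'"
proof -
  have Dv: "D v \<in> sets M" "D v' \<in> sets M" by (intro D_sets assms)+
  have 1: "sym_diff (Z j \<inter> T ` D u) (D v) \<in> null_sets M" "sym_diff (Z j \<inter> T ` D u) (D v') \<in> null_sets M"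
    by (rule step_null, fact assms)+
  have "sym_diff (D v) (D v') \<in> null_sets M"
  proof (rule null_sets_subset[OF null_sets.Un[OF 1]])
    show "sym_diff (D v) (D v') \<in> sets M" using Dv by (intro sets.Un sets.Diff)
    show "sym_diff (D v) (D v') \<subseteq> sym_diff (Z j \<inter> T ` D u) (D v) \<union> sym_diff (Z j \<inter> T ` D u) (D v')"
      by fast
  qed
  then have "eq_mod_null M (D v) (D v')" "eq_mod_null M (D v) (D v)" by (simp_all add: eq_mod_null_def)
  moreover have "\<exists>!u. u \<in> \<alpha> \<and> eq_mod_null M (D v) (D u)"
  proof -
    note tw = tower[unfolded tower_enumeration_def]
    have "D v \<in> tower_levels M N Z T" by (rule subsetD[OF tw[THEN conjunct2, THEN conjunct2, THEN conjunct1] imageI[OF assms(1)]])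
    then show ?thesis by (rule bspec[OF tw[THEN conjunct2, THEN conjunct2, THEN conjunct2, THEN conjunct1]])
  qed
  ultimately show ?thesis using assms(1,2) by (metis (no_types))
qed

lemma step_exists: "u \<in> \<alpha> \<Longrightarrow> j \<in> {1..N} \<Longrightarrow> emeasure M (Z j \<inter> T ` D u) > 0 \<Longrightarrow> \<exists>v\<in>\<alpha>. step j u v"
  by (rule tower[unfolded tower_enumeration_def, THEN conjunct2, THEN conjunct2, THEN conjunct2, THEN conjunct2,
    THEN bspec, THEN bspec, THEN mp])

section \<open>Itineraries in the tower\<close>

definition next_level :: "nat \<Rightarrow> real ^ 'n \<Rightarrow> nat" where
  "next_level u x = (THE v. v \<in> \<alpha> \<and> step (cell_index N Z (T x)) u v)"

abbreviation tmap :: "(real ^ 'n) \<times> nat \<Rightarrow> (real ^ 'n) \<times> nat" where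
  "tmap \<equiv> tower_map M N Z T \<alpha> D"

lemma tmap_eq: "tmap (x, u) = (T x, next_level u x)"
  by (simp add: tower_map_def next_level_def)

definition level_at :: "nat \<Rightarrow> nat \<Rightarrow> real ^ 'n \<Rightarrow> nat" where
  "level_at n u x = snd ((tmap ^^ n) (x, u))"

lemma tmap_pow: "(tmap ^^ n) (x, u) = ((T ^^ n) x, level_at n u x)"
proof -
  have "fst (tmap z) = T (fst z)" for z by (cases z) (simp add: tmap_eq)
  then have "fst ((tmap ^^ n) (x, u)) = (T ^^ n) x" by (induction n) simp_all
  then show ?thesis by (simp add: level_at_def prod_eq_iff)
qed

lemma level_at_0 [simp]: "level_at 0 u x = u"
  by (simp add: level_at_def)

lemma level_at_add: "level_at (m + n) u x = level_at n (level_at m u x) ((T ^^ m) x)"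
proof -
  have "(tmap ^^ (m + n)) (x, u) = (tmap ^^ n) ((tmap ^^ m) (x, u))"
    by (subst add.commute) (simp add: funpow_add)
  then show ?thesis by (simp add: tmap_pow)
qed

lemma level_at_1: "level_at (Suc 0) u x = next_level u x"
  by (simp add: level_at_def tmap_eq)

lemma level_at_Suc: "level_at (Suc n) u x = next_level (level_at n u x) ((T ^^ n) x)"
  using level_at_add[of n "Suc 0" u x] by (simp add: level_at_1)

lemma level_at_Suc2: "level_at (Suc n) u x = level_at n (next_level u x) (T x)"
  using level_at_add[of "Suc 0" n u x] by (simp add: level_at_1)

lemma cell_index_measurable [measurable]: "cell_index N Z \<in> M \<rightarrow>\<^sub>M count_space UNIV"
proof -
  have "Measurable.pred M (\<lambda>x. j \<in> {1..N} \<and> x \<in> Z j)" for j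
  proof (cases "j \<in> {1..N}")
    case True
    have "{x\<in>space M. j \<in> {1..N} \<and> x \<in> Z j} = Z j \<inter> space M" using True by blast
    also have "\<dots> \<in> sets M" by (intro sets.Int sets.top Z_sets True)
    finally show ?thesis unfolding pred_def .
  next
    case False
    then have "{x\<in>space M. j \<in> {1..N} \<and> x \<in> Z j} = {}" by blast
    then show ?thesis unfolding pred_def by (simp only: sets.empty_sets)
  qed
  then show ?thesis unfolding cell_index_def[abs_def] by (rule measurable_Least)
qed

lemma next_level_measurable [measurable]: "next_level u \<in> M \<rightarrow>\<^sub>M count_space UNIV"
proof -
  have "(\<lambda>x. (\<lambda>j. THE v. v \<in> \<alpha> \<and> step j u v) (cell_index N Z (T x))) \<in> M \<rightarrow>\<^sub>M count_space UNIV"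
    by (rule measurable_compose[OF measurable_compose[OF T_measurable cell_index_measurable]]) simp
  then show ?thesis unfolding next_level_def[abs_def] .
qed

lemma level_at_measurable [measurable]: "level_at n u \<in> M \<rightarrow>\<^sub>M count_space UNIV"
proof (induction n)
  case (Suc n)
  have "(\<lambda>x. next_level (level_at n u x) ((T ^^ n) x)) \<in> M \<rightarrow>\<^sub>M count_space UNIV"
    by (rule measurable_compose_countable[OF measurable_compose[OF T_pow_measurable next_level_measurable] Suc])
  then show ?case unfolding level_at_Suc[abs_def] .
qed (simp add: level_at_def)

text \<open>
  The points at which the tower map is well defined on every level that contains them.  Since preimages of null
  sets are null, almost all points satisfy this along their whole orbit; such points are called regular.
\<close>
definition step_ok :: "real ^ 'n \<Rightarrow> bool" where
  "step_ok x \<longleftrightarrow> x \<in> X \<and> (\<exists>!j. j \<in> {1..N} \<and> x \<in> Z j) \<and>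
    (\<forall>u\<in>\<alpha>. x \<in> D u \<longrightarrow> next_level u x \<in> \<alpha> \<and> arrow u (next_level u x) \<and> T x \<in> D (next_level u x))"

definition regular :: "real ^ 'n \<Rightarrow> bool" where
  "regular x \<longleftrightarrow> (\<forall>n. step_ok ((T ^^ n) x))"

lemma AE_unique_cell: "AE x in M. \<exists>!j. j \<in> {1..N} \<and> x \<in> Z j"
proof -
  have "AE x in M. \<forall>i\<in>{1..N}. \<forall>j\<in>{1..N}. i \<noteq> j \<longrightarrow> x \<notin> Z i \<inter> Z j"
  proof (intro AE_ball_countable[THEN iffD2] ballI countable_finite)
    fix i j assume ij: "i \<in> {1..N}" "j \<in> {1..N}"
    show "AE x in M. i \<noteq> j \<longrightarrow> x \<notin> Z i \<inter> Z j"
    proof (cases "i = j")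
      case False
      have "AE x in M. x \<notin> Z i \<inter> Z j" by (rule AE_not_in[OF Z_overlap_null[OF ij False]])
      then show ?thesis by eventually_elim simp
    qed simp
  qed simp_all
  moreover have "AE x in M. x \<in> (\<Union>j\<in>{1..N}. Z j)"
    by (rule AE_prob_1) (use partition in \<open>simp add: partition_mod_null_def measure_def\<close>)
  ultimately show ?thesis by eventually_elim blast
qed

lemma cell_indexI:
  assumes "\<exists>!j. j \<in> {1..N} \<and> x \<in> Z j" "j \<in> {1..N}" "x \<in> Z j"
  shows "cell_index N Z x = j"
proof -
  have "cell_index N Z x \<in> {1..N} \<and> x \<in> Z (cell_index N Z x)"
    unfolding cell_index_def by (rule LeastI_ex) (use assms in blast)
  then show ?thesis using assms by blast
qed

lemma next_levelI: "v \<in> \<alpha> \<Longrightarrow> step (cell_index N Z (T x)) u v \<Longrightarrow> next_level u x = v"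
  unfolding next_level_def using step_unique by (intro the_equality) auto

text \<open>
  There are only countably many triples of a level, a set \<open>Z j\<close> and a further level.  For each of them the
  exceptional image points form a null set, and preimages of null sets are null.
\<close>
lemma AE_step_ok: "AE x in M. step_ok x"
proof -
  have null: "AE x in M. \<forall>u\<in>\<alpha>. \<forall>j\<in>{1..N}. emeasure M (Z j \<inter> T ` D u) = 0 \<longrightarrow> x \<notin> Z j \<inter> T ` D u"
  proof (intro AE_ball_countable[THEN iffD2] ballI)
    fix u j assume "u \<in> \<alpha>" "j \<in> {1..N}"
    then have *: "Z j \<inter> T ` D u \<in> sets M" by (intro sets.Int Z_sets image_sets D_sets)
    show "AE x in M. emeasure M (Z j \<inter> T ` D u) = 0 \<longrightarrow> x \<notin> Z j \<inter> T ` D u"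
    proof (cases "emeasure M (Z j \<inter> T ` D u) = 0")
      case True
      then have "AE x in M. x \<notin> Z j \<inter> T ` D u" using * by (intro AE_not_in null_setsI)
      then show ?thesis by eventually_elim simp
    qed simp
  qed simp_all
  have eq: "AE x in M. \<forall>u\<in>\<alpha>. \<forall>j\<in>{1..N}. \<forall>v\<in>\<alpha>. step j u v \<longrightarrow> (x \<in> Z j \<inter> T ` D u \<longleftrightarrow> x \<in> D v)"
  proof (intro AE_ball_countable[THEN iffD2] ballI)
    fix u j v
    show "AE x in M. step j u v \<longrightarrow> (x \<in> Z j \<inter> T ` D u \<longleftrightarrow> x \<in> D v)"
    proof (cases "step j u v")
      case True
      then have "AE x in M. x \<notin> sym_diff (Z j \<inter> T ` D u) (D v)"
        by (intro AE_not_in step_null)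
      then show ?thesis by eventually_elim auto
    qed simp
  qed auto
  show ?thesis
    using AE_space AE_unique_cell AE_T[OF AE_unique_cell] AE_T[OF null] AE_T[OF eq]
  proof eventually_elim
    case (elim x)
    have "next_level u x \<in> \<alpha> \<and> arrow u (next_level u x) \<and> T x \<in> D (next_level u x)" if u: "u \<in> \<alpha>" "x \<in> D u" for u
    proof -
      from elim obtain j where j: "j \<in> {1..N}" "T x \<in> Z j" by auto
      have c: "cell_index N Z (T x) = j" using elim j by (intro cell_indexI) auto
      have Tx: "T x \<in> Z j \<inter> T ` D u" using j u by auto
      have "emeasure M (Z j \<inter> T ` D u) \<noteq> 0"
      proof
        assume "emeasure M (Z j \<inter> T ` D u) = 0"
        with elim(4) u(1) j(1) have "T x \<notin> Z j \<inter> T ` D u" by blast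
        then show False using Tx by contradiction
      qed
      then obtain v where v: "v \<in> \<alpha>" "step j u v" using step_exists[OF u(1) j(1)] by (auto simp: zero_less_iff_neq_zero)
      then have "next_level u x = v" using c by (intro next_levelI) auto
      moreover have "T x \<in> D v" using elim u j v Tx by blast
      ultimately show ?thesis using v j by (auto simp: level_arrow_def)
    qed
    then show ?case using elim by (simp add: step_ok_def space_M)
  qed
qed

lemma AE_regular: "AE x in M. regular x"
  unfolding regular_def by (rule AE_T_pow[OF AE_step_ok])

lemma regular_T: "regular x \<Longrightarrow> regular ((T ^^ m) x)"
  unfolding regular_def by (metis comp_apply funpow_add)

lemma regular_level_at:
  assumes "regular x" "u \<in> \<alpha>" "x \<in> D u"
  shows "level_at n u x \<in> \<alpha> \<and> (T ^^ n) x \<in> D (level_at n u x)"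
proof (induction n)
  case (Suc n)
  then show ?case using assms(1) unfolding regular_def step_ok_def by (auto simp: level_at_Suc)
qed (use assms in auto)

lemma regular_arrow:
  assumes "regular x" "u \<in> \<alpha>" "x \<in> D u"
  shows "arrow (level_at n u x) (level_at (Suc n) u x)"
  using regular_level_at[OF assms, of n] assms(1) unfolding regular_def step_ok_def by (auto simp: level_at_Suc)

lemma regular_cell_index:
  assumes "regular x" "u \<in> \<alpha>" "x \<in> D u"
  shows "cell_index N Z x = level_cell u"
  using assms(1) level_cell[OF assms(2)] assms(3)
  by (intro cell_indexI) (auto simp: regular_def step_ok_def dest: spec[of _ 0])

section \<open>The Markov property of the tower map\<close>

definition entry :: "nat \<Rightarrow> nat \<Rightarrow> (real ^ 'n) set \<Rightarrow> (real ^ 'n) set" where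
  "entry u v B = {x\<in>D u. next_level u x = v \<and> T x \<in> B}"

lemma entry_sets: "u \<in> \<alpha> \<Longrightarrow> B \<in> sets M \<Longrightarrow> entry u v B \<in> sets M"
proof -
  assume [measurable]: "u \<in> \<alpha>" "B \<in> sets M"
  have "entry u v B = D u \<inter> ((next_level u -` {v} \<inter> space M) \<inter> (T -` B \<inter> space M))"
    using D_subset[of u] \<open>u \<in> \<alpha>\<close> unfolding entry_def space_M by blast
  also have "\<dots> \<in> sets M"
    using \<open>u \<in> \<alpha>\<close> \<open>B \<in> sets M\<close>
    by (intro sets.Int D_sets measurable_sets[OF next_level_measurable] measurable_sets[OF T_measurable]) simp_all
  finally show ?thesis .
qed

text \<open>
  The Markov property.  If there is an arrow from \<open>u\<close> to \<open>v\<close>, then \<open>T\<close> maps \<open>entry u v B\<close> onto \<open>B\<close> up to a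
  null set, and it multiplies the measure of subsets of \<open>D u\<close> by the slope; without an arrow almost no point
  makes this step.
\<close>
lemma entry_law:
  assumes u: "u \<in> \<alpha>" and v: "v \<in> \<alpha>" and B: "B \<in> sets M" "B \<subseteq> D v"
  shows "emeasure M (entry u v B) = (if arrow u v then ennreal (1 / slope u) else 0) * emeasure M B"
proof (cases "arrow u v")
  case True
  then obtain j where j: "j \<in> {1..N}" "step j u v" by (auto simp: level_arrow_def)
  have "AE y in M. y \<notin> sym_diff (Z j \<inter> T ` D u) (D v)"
    using j by (intro AE_not_in step_null)
  then have "AE y in M. y \<in> T ` entry u v B \<longleftrightarrow> y \<in> B"
    using AE_unique_cell
  proof eventually_elim
    case (elim y)
    show ?case
    proof
      assume y: "y \<in> B"
      then have "y \<in> Z j \<inter> T ` D u" using elim B by auto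
      then obtain x where x: "x \<in> D u" "y = T x" "y \<in> Z j" by auto
      have "cell_index N Z (T x) = j" using elim j x by (intro cell_indexI) auto
      then have "next_level u x = v" using v j by (intro next_levelI) auto
      then show "y \<in> T ` entry u v B" using x y by (auto simp: entry_def)
    qed (auto simp: entry_def)
  qed
  then have "emeasure M B = emeasure M (T ` entry u v B)"
    using B u by (intro emeasure_eq_AE image_sets entry_sets) auto
  also have "\<dots> = ennreal (slope u) * emeasure M (entry u v B)"
    using level_cell[OF u] B u by (intro emeasure_image entry_sets) (auto simp: entry_def)
  finally have "ennreal (1 / slope u) * emeasure M B = (ennreal (1 / slope u) * ennreal (slope u)) * emeasure M (entry u v B)"
    by (simp add: mult.assoc)
  also have "ennreal (1 / slope u) * ennreal (slope u) = 1"
    using slope_ge_1[OF u] by (subst ennreal_mult[symmetric]) auto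
  finally show ?thesis using True by simp
next
  case False
  have "AE x in M. x \<notin> entry u v B"
    using AE_step_ok by eventually_elim (use False u in \<open>auto simp: entry_def step_ok_def\<close>)
  then have "emeasure M (entry u v B) = 0"
    using AE_iff_null_sets[OF entry_sets[OF u B(1)]] by (auto dest: null_setsD1)
  then show ?thesis using False by simp
qed

lemma visit_sets:
  assumes u: "u \<in> \<alpha>" and B: "B \<in> sets M"
  shows "{x\<in>D u. level_at k u x = t \<and> (T ^^ k) x \<in> B} \<in> sets M"
proof -
  have "{x\<in>D u. level_at k u x = t \<and> (T ^^ k) x \<in> B} =
      D u \<inter> ((level_at k u -` {t} \<inter> space M) \<inter> ((T ^^ k) -` B \<inter> space M))"
    using D_subset[OF u] unfolding space_M by blast
  also have "\<dots> \<in> sets M"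
    using u B by (intro sets.Int D_sets measurable_sets[OF level_at_measurable] measurable_sets[OF T_pow_measurable]) simp_all
  finally show ?thesis .
qed

text \<open>
  The image of the measure on one level under an iterate of the tower map has constant density on each level: by the
  Markov property each step takes constant densities to constant densities.
\<close>
lemma level_at_law:
  assumes u: "u \<in> \<alpha>" and v: "v \<in> \<alpha>"
  shows "\<exists>c. \<forall>B\<in>sets M. B \<subseteq> D v \<longrightarrow>
    emeasure M {x\<in>D u. level_at k u x = v \<and> (T ^^ k) x \<in> B} = c * emeasure M B"
  using v
proof (induction k arbitrary: v)
  case 0
  have "{x\<in>D u. u = v \<and> x \<in> B} = (if u = v then B else {})" if "B \<subseteq> D v" for B
    using that by auto
  then show ?case by (intro exI[of _ "if u = v then 1 else 0"]) auto
next
  case (Suc k)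
  from Suc.IH have "\<exists>c. \<forall>t\<in>\<alpha>. \<forall>B\<in>sets M. B \<subseteq> D t \<longrightarrow>
    emeasure M {x\<in>D u. level_at k u x = t \<and> (T ^^ k) x \<in> B} = c t * emeasure M B" by (intro bchoice) auto
  then obtain c where c: "\<And>t B. t \<in> \<alpha> \<Longrightarrow> B \<in> sets M \<Longrightarrow> B \<subseteq> D t \<Longrightarrow>
    emeasure M {x\<in>D u. level_at k u x = t \<and> (T ^^ k) x \<in> B} = c t * emeasure M B" by blast
  note meas = visit_sets[OF u]
  show ?case
  proof (intro exI ballI impI)
    fix B assume B[measurable]: "B \<in> sets M" and BD: "B \<subseteq> D v"
    let ?A = "\<lambda>t. {x\<in>D u. level_at k u x = t \<and> (T ^^ k) x \<in> entry t v B}"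
    have "emeasure M {x\<in>D u. level_at (Suc k) u x = v \<and> (T ^^ Suc k) x \<in> B} = emeasure M (\<Union>t\<in>\<alpha>. ?A t)"
    proof (rule emeasure_eq_AE)
      show "AE x in M. x \<in> {x\<in>D u. level_at (Suc k) u x = v \<and> (T ^^ Suc k) x \<in> B} \<longleftrightarrow> x \<in> (\<Union>t\<in>\<alpha>. ?A t)"
        using AE_regular by eventually_elim (use u regular_level_at in \<open>auto simp: entry_def level_at_Suc\<close>)
      show "(\<Union>t\<in>\<alpha>. ?A t) \<in> sets M"
        using B by (intro sets.countable_UN' meas entry_sets countableI_type image_subsetI)
    qed (rule meas[OF B])
    also have "\<dots> = (\<integral>\<^sup>+t. emeasure M (?A t) \<partial>count_space \<alpha>)"
      by (intro emeasure_UN_countable) (auto intro!: meas entry_sets simp: disjoint_family_on_def)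
    also have "\<dots> = (\<integral>\<^sup>+t. c t * (if arrow t v then ennreal (1 / slope t) else 0) * emeasure M B \<partial>count_space \<alpha>)"
    proof (rule nn_integral_cong)
      fix t assume "t \<in> space (count_space \<alpha>)"
      then have t: "t \<in> \<alpha>" by simp
      have "emeasure M (?A t) = c t * emeasure M (entry t v B)"
        by (rule c[OF t entry_sets[OF t B]]) (simp add: entry_def)
      then show "emeasure M (?A t) = c t * (if arrow t v then ennreal (1 / slope t) else 0) * emeasure M B"
        by (simp only: entry_law[OF t Suc.prems B BD] mult.assoc)
    qed
    also have "\<dots> = (\<integral>\<^sup>+t. c t * (if arrow t v then ennreal (1 / slope t) else 0) \<partial>count_space \<alpha>) * emeasure M B"
      by (intro nn_integral_multc) auto
    finally show "emeasure M {x\<in>D u. level_at (Suc k) u x = v \<and> (T ^^ Suc k) x \<in> B} =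
      (\<integral>\<^sup>+t. c t * (if arrow t v then ennreal (1 / slope t) else 0) \<partial>count_space \<alpha>) * emeasure M B" .
  qed
qed

section \<open>Masses of the levels under the lifted averages\<close>

abbreviation TM :: "((real ^ 'n) \<times> nat) measure" where
  "TM \<equiv> tower_measure M \<alpha> D"

abbreviation TX :: "((real ^ 'n) \<times> nat) set" where
  "TX \<equiv> tower_space \<alpha> D"

text \<open>
  A set in the tower is described by its intersections with the levels, moved back to \<open>X\<close>.
\<close>
definition slice :: "((real ^ 'n) \<times> nat) set \<Rightarrow> nat \<Rightarrow> (real ^ 'n) set" where
  "slice A u = {x\<in>D u. (x, u) \<in> A}"

lemma slice_eq: "fst ` (A \<inter> tower_level D u) = slice A u"
  by (force simp: slice_def tower_level_def)

lemma generators_subset: "tower_generators M \<alpha> D \<subseteq> Pow TX"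
  by (auto simp: tower_generators_def tower_space_def)

lemma space_TM [simp]: "space TM = TX"
  unfolding tower_measure_def by (rule space_measure_of[OF generators_subset])

lemma sets_TM_sigma: "sets TM = sigma_sets TX (tower_generators M \<alpha> D)"
  unfolding tower_measure_def by (rule sets_measure_of[OF generators_subset])

lemma slice_sets:
  assumes "A \<in> sets TM" "u \<in> \<alpha>" shows "slice A u \<in> sets M"
  using assms(1) unfolding sets_TM_sigma
proof induction
  case (Basic a)
  then consider v where "a = tower_level D v" | B where "B \<in> sets M" "a = fst -` B \<inter> TX"
    by (auto simp: tower_generators_def)
  then show ?case
  proof cases
    case 1
    then have "slice a u = (if u = v then D u else {})" by (auto simp: slice_def tower_level_def)
    then show ?thesis using D_sets[OF assms(2)] by (cases "u = v") simp_all
  next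
    case 2
    then have "slice a u = D u \<inter> B"
      using assms(2) by (auto simp: slice_def tower_space_def tower_level_def)
    then show ?thesis using D_sets[OF assms(2)] 2 by simp
  qed
next
  case Empty
  then show ?case by (simp add: slice_def)
next
  case (Compl a)
  have "slice (TX - a) u = D u - slice a u"
    using assms(2) by (auto simp: slice_def tower_space_def tower_level_def)
  then show ?case using D_sets[OF assms(2)] Compl by simp
next
  case (Union a)
  have "slice (\<Union>i. a i) u = (\<Union>i. slice (a i) u)" by (auto simp: slice_def)
  then show ?case using Union by auto
qed

lemma sets_TM_I:
  assumes "A \<subseteq> TX" "\<And>u. u \<in> \<alpha> \<Longrightarrow> slice A u \<in> sets M"
  shows "A \<in> sets TM"
proof -
  have "A = (\<Union>u\<in>\<alpha>. tower_level D u \<inter> (fst -` slice A u \<inter> TX))"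
    using assms(1) by (fastforce simp: slice_def tower_space_def tower_level_def)
  also have "\<dots> \<in> sets TM"
  proof (intro sets.countable_UN' image_subsetI)
    fix u assume "u \<in> \<alpha>"
    then have "tower_level D u \<in> sets TM" "fst -` slice A u \<inter> TX \<in> sets TM"
      unfolding sets_TM_sigma using assms(2)
      by (auto simp: tower_generators_def intro!: sigma_sets.Basic)
    then show "tower_level D u \<inter> (fst -` slice A u \<inter> TX) \<in> sets TM" by (rule sets.Int)
  qed simp
  finally show ?thesis .
qed

text \<open>
  The tower measure is given by its values on generators and their \<open>\<sigma>\<close>-algebra; only countable additivity
  ensures that it takes these values.
\<close>
lemma sum_slices_measure_space:
  "measure_space TX (sets TM) (\<lambda>A. \<integral>\<^sup>+u. emeasure M (slice A u) \<partial>count_space \<alpha>)"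
  unfolding measure_space_def
proof (intro conjI)
  show "sigma_algebra TX (sets TM)" using sets.sigma_algebra_axioms[of TM] by simp
  show "positive (sets TM) (\<lambda>A. \<integral>\<^sup>+u. emeasure M (slice A u) \<partial>count_space \<alpha>)"
    by (simp add: positive_def slice_def)
  show "countably_additive (sets TM) (\<lambda>A. \<integral>\<^sup>+u. emeasure M (slice A u) \<partial>count_space \<alpha>)"
  proof (rule countably_additiveI)
    fix A :: "nat \<Rightarrow> _" assume A: "range A \<subseteq> sets TM" "disjoint_family A"
    have "(\<Sum>i. \<integral>\<^sup>+u. emeasure M (slice (A i) u) \<partial>count_space \<alpha>) =
        (\<integral>\<^sup>+u. (\<Sum>i. emeasure M (slice (A i) u)) \<partial>count_space \<alpha>)"
      by (rule nn_integral_suminf[symmetric]) simp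
    also have "\<dots> = (\<integral>\<^sup>+u. emeasure M (slice (\<Union>i. A i) u) \<partial>count_space \<alpha>)"
    proof (rule nn_integral_cong)
      fix u assume "u \<in> space (count_space \<alpha>)"
      then have "range (\<lambda>i. slice (A i) u) \<subseteq> sets M" using A slice_sets by auto
      moreover have "disjoint_family (\<lambda>i. slice (A i) u)"
        using A(2) by (auto simp: disjoint_family_on_def slice_def)
      moreover have "(\<Union>i. slice (A i) u) = slice (\<Union>i. A i) u" by (auto simp: slice_def)
      ultimately show "(\<Sum>i. emeasure M (slice (A i) u)) = emeasure M (slice (\<Union>i. A i) u)"
        by (simp add: suminf_emeasure)
    qed
    finally show "(\<Sum>i. \<integral>\<^sup>+u. emeasure M (slice (A i) u) \<partial>count_space \<alpha>) =
      (\<integral>\<^sup>+u. emeasure M (slice (\<Union>i. A i) u) \<partial>count_space \<alpha>)" .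
  qed
qed

lemma emeasure_TM:
  assumes "A \<in> sets TM"
  shows "emeasure TM A = (\<integral>\<^sup>+u. emeasure M (slice A u) \<partial>count_space \<alpha>)"
proof -
  note ms = sum_slices_measure_space[unfolded measure_space_def]
  have "tower_measure M \<alpha> D = measure_of TX (tower_generators M \<alpha> D) (\<lambda>A. \<integral>\<^sup>+u. emeasure M (slice A u) \<partial>count_space \<alpha>)"
    by (simp add: tower_measure_def slice_eq)
  from emeasure_measure_of[OF this generators_subset _ _ assms] ms show ?thesis by simp
qed

lemma level_in_sets_TM: "u \<in> \<alpha> \<Longrightarrow> tower_level D u \<in> sets TM"
  unfolding sets_TM_sigma by (intro sigma_sets.Basic) (simp add: tower_generators_def)

lemma emeasure_TM_level:
  assumes "u \<in> \<alpha>" "A \<in> sets TM" "A \<subseteq> tower_level D u"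
  shows "emeasure TM A = emeasure M (slice A u)"
proof -
  have "emeasure TM A = (\<integral>\<^sup>+v. emeasure M (slice A u) * indicator {u} v \<partial>count_space \<alpha>)"
    unfolding emeasure_TM[OF assms(2)]
  proof (rule nn_integral_cong)
    fix v
    have "slice A v = {}" if "v \<noteq> u" using that assms(3) by (auto simp: slice_def tower_level_def)
    then show "emeasure M (slice A v) = emeasure M (slice A u) * indicator {u} v"
      by (cases "v = u") (simp_all add: indicator_def)
  qed
  also have "\<dots> = emeasure M (slice A u)"
    using assms(1) by (simp add: nn_integral_cmult_indicator)
  finally show ?thesis .
qed

lemma slice_level [simp]: "slice (tower_level D u) u = D u"
  by (auto simp: slice_def tower_level_def)

lemma measure_TM_level: "u \<in> \<alpha> \<Longrightarrow> measure TM (tower_level D u) = measure M (D u)"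
  using emeasure_TM_level[OF _ level_in_sets_TM, of u u] by (simp add: measure_def)

abbreviation orbit_preimage :: "nat \<Rightarrow> ((real ^ 'n) \<times> nat) set \<Rightarrow> ((real ^ 'n) \<times> nat) set" where
  "orbit_preimage k A \<equiv> (tmap ^^ k) -` A \<inter> tower_base N D"

lemma slice_orbit_preimage:
  assumes "A \<subseteq> TX"
  shows "slice (orbit_preimage k A) u =
    (if u \<in> {1..N} then \<Union>v\<in>\<alpha>. {x\<in>D u. level_at k u x = v \<and> (T ^^ k) x \<in> slice A v} else {})"
  using assms by (auto simp: slice_def tower_base_def tower_level_def tmap_pow tower_space_def)

lemma orbit_preimage_sets:
  assumes "A \<in> sets TM" shows "orbit_preimage k A \<in> sets TM"
proof (rule sets_TM_I)
  have A: "A \<subseteq> TX" using sets.sets_into_space[OF assms] by simp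
  show "orbit_preimage k A \<subseteq> TX"
    using N_in_\<alpha>(1) by (force simp: tower_base_def tower_space_def)
  fix u assume "u \<in> \<alpha>"
  then show "slice (orbit_preimage k A) u \<in> sets M"
    unfolding slice_orbit_preimage[OF A] using assms
    by (auto intro!: sets.countable_UN' visit_sets slice_sets)
qed

text \<open>
  As for the tower measure, the defining formula is countably additive, since preimages under the iterates of the
  tower map are measurable.
\<close>
lemma emeasure_lift_average:
  assumes "A \<in> sets TM"
  shows "emeasure (lift_average M N Z T \<alpha> D n) A = (\<Sum>k<n. emeasure TM (orbit_preimage k A)) / of_nat n"
proof (rule emeasure_measure_of[OF lift_average_def generators_subset])
  let ?f = "\<lambda>A. (\<Sum>k<n. emeasure TM (orbit_preimage k A)) / of_nat n"
  have sets: "sets (lift_average M N Z T \<alpha> D n) = sets TM"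
    unfolding lift_average_def sets_TM_sigma by (rule sets_measure_of[OF generators_subset])
  show "A \<in> sets (lift_average M N Z T \<alpha> D n)" using assms by (simp add: sets)
  show "positive (sets (lift_average M N Z T \<alpha> D n)) ?f" by (simp add: positive_def)
  show "countably_additive (sets (lift_average M N Z T \<alpha> D n)) ?f"
  proof (rule countably_additiveI)
    fix A :: "nat \<Rightarrow> _" assume A: "range A \<subseteq> sets (lift_average M N Z T \<alpha> D n)" "disjoint_family A"
    have "(\<Sum>i. emeasure TM (orbit_preimage k (A i))) = emeasure TM (orbit_preimage k (\<Union>i. A i))" for k
    proof -
      have "range (\<lambda>i. orbit_preimage k (A i)) \<subseteq> sets TM" using A(1) orbit_preimage_sets by (auto simp: sets)
      moreover have "disjoint_family (\<lambda>i. orbit_preimage k (A i))"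
        using A(2) by (fastforce simp: disjoint_family_on_def)
      moreover have "(\<Union>i. orbit_preimage k (A i)) = orbit_preimage k (\<Union>i. A i)" by auto
      ultimately show ?thesis by (simp add: suminf_emeasure)
    qed
    then show "(\<Sum>i. ?f (A i)) = ?f (\<Union>i. A i)"
      by (simp add: divide_ennreal_def ennreal_suminf_multc suminf_sum)
  qed
qed

text \<open>
  The mass that the \<open>k\<close>-th image of the measure on the base puts on level \<open>v\<close>.
\<close>
definition visit_mass :: "nat \<Rightarrow> nat \<Rightarrow> real" where
  "visit_mass k v = (\<Sum>j\<in>{1..N}. measure M {x\<in>D j. level_at k j x = v \<and> (T ^^ k) x \<in> D v})"

lemma emeasure_orbit_preimage_level:
  assumes v: "v \<in> \<alpha>"
  shows "emeasure TM (orbit_preimage k (tower_level D v)) = ennreal (visit_mass k v)"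
proof -
  let ?E = "\<lambda>u. {x\<in>D u. level_at k u x = v \<and> (T ^^ k) x \<in> D v}"
  have lv: "tower_level D v \<subseteq> TX" using v by (auto simp: tower_space_def)
  have sl: "slice (tower_level D v) t = (if t = v then D v else {})" for t
    by (auto simp: slice_def tower_level_def)
  have "slice (orbit_preimage k (tower_level D v)) u = (if u \<in> {1..N} then ?E u else {})" for u
    unfolding slice_orbit_preimage[OF lv] sl using v by (auto split: if_splits)
  then have "emeasure TM (orbit_preimage k (tower_level D v)) =
      (\<integral>\<^sup>+u. emeasure M (if u \<in> {1..N} then ?E u else {}) \<partial>count_space \<alpha>)"
    by (simp only: emeasure_TM[OF orbit_preimage_sets[OF level_in_sets_TM[OF v]]])
  also have "\<dots> = (\<Sum>u\<in>{1..N}. emeasure M (if u \<in> {1..N} then ?E u else {}))"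
    using N_in_\<alpha>(1) by (intro nn_integral_count_space') auto
  also have "\<dots> = (\<Sum>u\<in>{1..N}. ennreal (measure M (?E u)))"
    by (intro sum.cong refl) (simp add: emeasure_eq_measure)
  also have "\<dots> = ennreal (visit_mass k v)"
    by (simp add: visit_mass_def sum_ennreal)
  finally show ?thesis .
qed

lemma measure_lift_average_level:
  assumes v: "v \<in> \<alpha>"
  shows "measure (lift_average M N Z T \<alpha> D n) (tower_level D v) = (\<Sum>k<n. visit_mass k v) / real n"
proof -
  have nn: "0 \<le> visit_mass k v" for k by (simp add: visit_mass_def sum_nonneg)
  have "emeasure (lift_average M N Z T \<alpha> D n) (tower_level D v) = ennreal (\<Sum>k<n. visit_mass k v) / of_nat n"
    using nn by (simp add: emeasure_lift_average[OF level_in_sets_TM[OF v]] emeasure_orbit_preimage_level[OF v] sum_ennreal)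
  then show ?thesis
    using nn by (cases "n = 0") (simp_all add: measure_def ennreal_of_nat_eq_real_of_nat divide_ennreal sum_nonneg)
qed

definition transition :: "nat \<Rightarrow> nat \<Rightarrow> real" where
  "transition t v = (if arrow t v then measure M (D v) / (slope t * measure M (D t)) else 0)"

lemma visit_mass_nonneg: "0 \<le> visit_mass k v"
  by (simp add: visit_mass_def sum_nonneg)

lemma visit_mass_sum_le:
  assumes "finite F" "F \<subseteq> \<alpha>" shows "(\<Sum>t\<in>F. visit_mass k t) \<le> real N"
proof -
  have "(\<Sum>t\<in>F. visit_mass k t) = (\<Sum>j\<in>{1..N}. \<Sum>t\<in>F. measure M {x\<in>D j. level_at k j x = t \<and> (T ^^ k) x \<in> D t})"
    unfolding visit_mass_def by (rule sum.swap)
  also have "\<dots> \<le> (\<Sum>j\<in>{1..N}. 1)"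
  proof (rule sum_mono)
    fix j assume "j \<in> {1..N}"
    then have j: "j \<in> \<alpha>" using N_in_\<alpha>(1) by auto
    have "(\<Sum>t\<in>F. measure M {x\<in>D j. level_at k j x = t \<and> (T ^^ k) x \<in> D t}) =
        measure M (\<Union>t\<in>F. {x\<in>D j. level_at k j x = t \<and> (T ^^ k) x \<in> D t})"
      using assms by (intro finite_measure_finite_Union[symmetric])
        (auto intro!: visit_sets j D_sets simp: disjoint_family_on_def)
    then show "(\<Sum>t\<in>F. measure M {x\<in>D j. level_at k j x = t \<and> (T ^^ k) x \<in> D t}) \<le> 1" by simp
  qed
  finally show ?thesis by simp
qed

text \<open>
  Because the \<open>k\<close>-th image has constant densities, its masses on the levels evolve by the transition
  probabilities of the Markov chain.  Restricting to finitely many predecessors leaves an inequality, which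
  survives the passage to the limit.
\<close>
lemma visit_mass_step:
  assumes F: "finite F" "F \<subseteq> \<alpha>" and v: "v \<in> \<alpha>"
  shows "(\<Sum>t\<in>F. visit_mass k t * transition t v) \<le> visit_mass (Suc k) v"
proof -
  let ?E = "\<lambda>j t. {x\<in>D j. level_at k j x = t \<and> (T ^^ k) x \<in> D t}"
  let ?G = "\<lambda>j t. {x\<in>D j. level_at k j x = t \<and> (T ^^ k) x \<in> entry t v (D v)}"
  have G: "measure M (?E j t) * transition t v = measure M (?G j t)" if j: "j \<in> \<alpha>" and t: "t \<in> \<alpha>" for j t
  proof -
    from level_at_law[OF j t, of k] obtain c where c: "\<And>B. B \<in> sets M \<Longrightarrow> B \<subseteq> D t \<Longrightarrow>
        emeasure M {x\<in>D j. level_at k j x = t \<and> (T ^^ k) x \<in> B} = c * emeasure M B" by blast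
    have E: "ennreal (measure M (?E j t)) = c * ennreal (measure M (D t))"
      using c[OF D_sets[OF t]] by (simp add: emeasure_eq_measure)
    have "c \<noteq> \<top>"
      using E D_pos[OF t] by (auto simp: ennreal_top_mult ennreal_mult_eq_top_iff)
    then obtain r where r: "c = ennreal r" "r \<ge> 0" by (cases c) auto
    have E': "measure M (?E j t) = r * measure M (D t)"
      using E r by (simp add: ennreal_mult'[symmetric])
    have "emeasure M (entry t v (D v)) = ennreal (if arrow t v then measure M (D v) / slope t else 0)"
      unfolding entry_law[OF t v D_sets[OF v] order_refl]
      using slope_ge_1[OF t] by (simp add: emeasure_eq_measure ennreal_mult'[symmetric])
    then have entry: "measure M (entry t v (D v)) = (if arrow t v then measure M (D v) / slope t else 0)"
      by (rule measure_eq_emeasure_eq_ennreal[rotated]) (use slope_ge_1[OF t] in simp)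
    have "emeasure M (?G j t) = c * emeasure M (entry t v (D v))"
      by (rule c[OF entry_sets[OF t D_sets[OF v]]]) (auto simp: entry_def)
    also have "\<dots> = ennreal (r * measure M (entry t v (D v)))"
      using r by (simp add: emeasure_eq_measure ennreal_mult'[symmetric])
    finally have "measure M (?G j t) = r * (if arrow t v then measure M (D v) / slope t else 0)"
      unfolding entry[symmetric] using r by (intro measure_eq_emeasure_eq_ennreal) simp_all
    then show ?thesis using E' D_pos[OF t] by (simp add: transition_def)
  qed
  have "(\<Sum>t\<in>F. visit_mass k t * transition t v) = (\<Sum>t\<in>F. \<Sum>j\<in>{1..N}. measure M (?G j t))"
    unfolding visit_mass_def sum_distrib_right using G F N_in_\<alpha>(1) by (intro sum.cong refl) (auto simp: subset_iff)
  also have "\<dots> = (\<Sum>j\<in>{1..N}. \<Sum>t\<in>F. measure M (?G j t))" by (rule sum.swap)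
  also have "\<dots> \<le> visit_mass (Suc k) v"
    unfolding visit_mass_def
  proof (rule sum_mono)
    fix j assume "j \<in> {1..N}"
    then have j: "j \<in> \<alpha>" using N_in_\<alpha>(1) by auto
    have "(\<Sum>t\<in>F. measure M (?G j t)) = measure M (\<Union>t\<in>F. ?G j t)"
      using F v by (intro finite_measure_finite_Union[symmetric])
        (auto intro!: visit_sets j entry_sets D_sets simp: disjoint_family_on_def)
    also have "\<dots> \<le> measure M {x\<in>D j. level_at (Suc k) j x = v \<and> (T ^^ Suc k) x \<in> D v}"
      using v by (intro finite_measure_mono visit_sets j D_sets) (auto simp: entry_def level_at_Suc)
    finally show "(\<Sum>t\<in>F. measure M (?G j t)) \<le> measure M {x\<in>D j. level_at (Suc k) j x = v \<and> (T ^^ Suc k) x \<in> D v}" .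
  qed
  finally show ?thesis .
qed

end

section \<open>Densities of the limit measure\<close>

locale lifted_tower = tower_system X M T N Z s \<alpha> D
  for X :: "(real ^ 'n) set" and M T N Z s \<alpha> D +
  fixes \<mu>h :: "((real ^ 'n) \<times> nat) measure"
  assumes lifts: "lifts_to M N Z T \<alpha> D \<mu>h"
begin

lemma space_\<mu>h: "space \<mu>h = TX"
proof -
  have "sets \<mu>h = sets TM" using lifts by (simp add: lifts_to_def)
  from sets_eq_imp_space_eq[OF this] show "space \<mu>h = TX" by simp
qed

abbreviation charged :: "nat set" where
  "charged \<equiv> charged_levels \<alpha> D \<mu>h"

abbreviation \<rho> :: "nat \<Rightarrow> real" where
  "\<rho> \<equiv> level_density M \<alpha> D \<mu>h"

lemma compact_level: "u \<in> \<alpha> \<Longrightarrow> compact (tower_level D u)"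
proof -
  assume u: "u \<in> \<alpha>"
  have "X \<inter> D u = D u" using D_subset[OF u] by blast
  then have "compact (D u)" using compact_Int_closed[OF compact_X D_closed[OF u]] by simp
  then show ?thesis unfolding tower_level_def using compact_Times[of "D u" "{u}"] finite_imp_compact[of "{u}"] by simp
qed

text \<open>
  A level is compact and open in the tower, so its indicator is an admissible test function.
\<close>
lemma level_mass_limit:
  assumes v: "v \<in> \<alpha>"
  shows "emeasure \<mu>h (tower_level D v) < \<infinity>"
    "(\<lambda>n. (\<Sum>k<n. visit_mass k v) / real n) \<longlonglongrightarrow> measure \<mu>h (tower_level D v)"
proof -
  have lv: "tower_level D v \<subseteq> TX" using v by (auto simp: tower_space_def)
  have vl: "vague_limit (lift_average M N Z T \<alpha> D) \<mu>h" using lifts by (simp add: lifts_to_def)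
  then show "emeasure \<mu>h (tower_level D v) < \<infinity>"
    using compact_level[OF v] lv by (auto simp: vague_limit_def space_\<mu>h)
  let ?f = "\<lambda>z :: (real ^ 'n) \<times> nat. if snd z = v then 1 else 0 :: real"
  have "continuous_on TX ?f"
    using continuous_on_compose2[OF Topological_Spaces.continuous_on_discrete[of UNIV "\<lambda>u. if u = v then 1 else 0 :: real"]
      continuous_on_snd[OF continuous_on_id], of TX] by simp
  moreover have "?f z = 0" if "z \<in> TX - tower_level D v" for z
    using that v by (auto simp: tower_space_def tower_level_def)
  ultimately have lim: "(\<lambda>n. \<integral>z. ?f z \<partial>lift_average M N Z T \<alpha> D n) \<longlonglongrightarrow> (\<integral>z. ?f z \<partial>\<mu>h)"
    using vl compact_level[OF v] lv unfolding vague_limit_def space_\<mu>h by blast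
  have int: "(\<integral>z. ?f z \<partial>Q) = measure Q (tower_level D v)" if Q: "space Q = TX" for Q
  proof -
    have "(\<integral>z. ?f z \<partial>Q) = (\<integral>z. indicator (tower_level D v) z \<partial>Q)"
      using Q v by (intro Bochner_Integration.integral_cong refl) (auto simp: tower_space_def tower_level_def indicator_def)
    also have "\<dots> = measure Q (tower_level D v \<inter> space Q)" by (rule Bochner_Integration.integral_indicator)
    also have "tower_level D v \<inter> space Q = tower_level D v" using lv Q by auto
    finally show ?thesis .
  qed
  have "space (lift_average M N Z T \<alpha> D n) = TX" for n
    unfolding lift_average_def by (rule space_measure_of[OF generators_subset])
  then show "(\<lambda>n. (\<Sum>k<n. visit_mass k v) / real n) \<longlonglongrightarrow> measure \<mu>h (tower_level D v)"
    using lim by (simp add: int space_\<mu>h measure_lift_average_level[OF v])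
qed

lemma density_eq: "u \<in> \<alpha> \<Longrightarrow> measure \<mu>h (tower_level D u) = \<rho> u * measure M (D u)"
  using D_pos[of u] by (simp add: level_density_def measure_TM_level)

lemma density_nonneg: "0 \<le> \<rho> u"
  by (simp add: level_density_def)

lemma charged_subset: "charged \<subseteq> \<alpha>"
  by (auto simp: charged_levels_def)

lemma charged_iff: "u \<in> \<alpha> \<Longrightarrow> u \<in> charged \<longleftrightarrow> \<rho> u > 0"
  using level_mass_limit(1)[of u] density_eq[of u] D_pos[of u] density_nonneg[of u]
  by (auto simp: charged_levels_def emeasure_eq_ennreal_measure less_top zero_less_mult_iff)

text \<open>
  The averages of the masses satisfy the recursion of the chain up to an error of order \<open>1 / n\<close>.  Dividing the limit
  by the measures of the levels turns the transition probabilities into reciprocal slopes.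
\<close>
lemma density_subinvariant:
  assumes F: "finite F" "F \<subseteq> \<alpha>" and v: "v \<in> \<alpha>"
  shows "(\<Sum>t\<in>F. if arrow t v then \<rho> t / slope t else 0) \<le> \<rho> v"
proof -
  let ?A = "\<lambda>t n. (\<Sum>k<n. visit_mass k t) / real n"
  have V: "visit_mass k v \<le> real N" for k using visit_mass_sum_le[of "{v}" k] v by simp
  \<comment> \<open>Shifting the time by one changes the average by the two boundary terms only; they are bounded by the
    total mass of the base, which is at most \<open>N\<close>.\<close>
  have le: "(\<Sum>t\<in>F. ?A t n * transition t v) \<le> ?A v n + real N / real n" for n
  proof -
    have "(\<Sum>t\<in>F. ?A t n * transition t v) = (\<Sum>k<n. \<Sum>t\<in>F. visit_mass k t * transition t v) / real n"
      by (subst sum.swap) (simp add: sum_divide_distrib sum_distrib_right)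
    also have "\<dots> \<le> (\<Sum>k<n. visit_mass (Suc k) v) / real n"
      using F v by (intro divide_right_mono sum_mono visit_mass_step) auto
    also have "(\<Sum>k<n. visit_mass (Suc k) v) = (\<Sum>k<Suc n. visit_mass k v) - visit_mass 0 v"
      by (subst sum.lessThan_Suc_shift) simp
    also have "\<dots> / real n \<le> ((\<Sum>k<n. visit_mass k v) + real N) / real n"
      using V[of n] visit_mass_nonneg[of 0 v] by (intro divide_right_mono) auto
    finally show ?thesis by (simp add: add_divide_distrib)
  qed
  have lim1: "(\<lambda>n. \<Sum>t\<in>F. ?A t n * transition t v) \<longlonglongrightarrow> (\<Sum>t\<in>F. measure \<mu>h (tower_level D t) * transition t v)"
    using F by (intro tendsto_sum tendsto_mult_right level_mass_limit(2)) auto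
  have "(\<lambda>n. real N * inverse (real n)) \<longlonglongrightarrow> 0"
    by (rule tendsto_mult_right_zero[OF LIMSEQ_inverse_real_of_nat[THEN LIMSEQ_imp_Suc]])
  then have lim2: "(\<lambda>n. ?A v n + real N / real n) \<longlonglongrightarrow> measure \<mu>h (tower_level D v) + 0"
    by (intro tendsto_add level_mass_limit(2) v) (simp add: divide_inverse)
  have "(\<Sum>t\<in>F. measure \<mu>h (tower_level D t) * transition t v) \<le> measure \<mu>h (tower_level D v)"
    using LIMSEQ_le[OF lim1 lim2] le by simp
  also have "(\<Sum>t\<in>F. measure \<mu>h (tower_level D t) * transition t v) =
      (\<Sum>t\<in>F. if arrow t v then \<rho> t / slope t else 0) * measure M (D v)"
    unfolding sum_distrib_right
  proof (rule sum.cong)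
    fix t assume "t \<in> F"
    then have "t \<in> \<alpha>" using F by auto
    then show "measure \<mu>h (tower_level D t) * transition t v = (if arrow t v then \<rho> t / slope t else 0) * measure M (D v)"
      using D_pos[of t] by (simp add: density_eq transition_def)
  qed simp
  finally show ?thesis using D_pos[OF v] by (simp add: density_eq[OF v])
qed

lemma density_mass_le:
  assumes F: "finite F" "F \<subseteq> \<alpha>"
  shows "(\<Sum>t\<in>F. \<rho> t * measure M (D t)) \<le> real N"
proof -
  have "(\<lambda>n. \<Sum>t\<in>F. (\<Sum>k<n. visit_mass k t) / real n) \<longlonglongrightarrow> (\<Sum>t\<in>F. measure \<mu>h (tower_level D t))"
    using F by (intro tendsto_sum level_mass_limit(2)) auto
  moreover have "(\<Sum>t\<in>F. (\<Sum>k<n. visit_mass k t) / real n) \<le> real N" for n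
  proof -
    have "(\<Sum>t\<in>F. (\<Sum>k<n. visit_mass k t) / real n) = (\<Sum>k<n. \<Sum>t\<in>F. visit_mass k t) / real n"
      by (subst sum.swap) (simp add: sum_divide_distrib)
    also have "\<dots> \<le> (\<Sum>k<n. real N) / real n"
      using F by (intro divide_right_mono sum_mono visit_mass_sum_le) auto
    also have "\<dots> \<le> real N" by (cases "n = 0") auto
    finally show ?thesis .
  qed
  ultimately have "(\<Sum>t\<in>F. measure \<mu>h (tower_level D t)) \<le> real N" by (intro LIMSEQ_le_const2) auto
  also have "(\<Sum>t\<in>F. measure \<mu>h (tower_level D t)) = (\<Sum>t\<in>F. \<rho> t * measure M (D t))"
    using F density_eq by (intro sum.cong) auto
  finally show ?thesis .
qed

lemma charged_arrow:
  assumes "u \<in> charged" "v \<in> \<alpha>" "arrow u v" shows "v \<in> charged"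
proof -
  have u: "u \<in> \<alpha>" using assms charged_subset by auto
  have "0 < \<rho> u / slope u" using charged_iff[OF u] assms slope_ge_1[OF u] by simp
  also have "\<dots> \<le> \<rho> v" using density_subinvariant[of "{u}" v] assms u by simp
  finally show ?thesis using charged_iff assms by simp
qed

section \<open>Recurrence of charged levels\<close>

lemma nn_integral_\<alpha>: "(\<integral>\<^sup>+t. f t \<partial>count_space \<alpha>) = (\<Sum>t. f t * indicator \<alpha> t)"
  by (subst nn_integral_count_space_indicator) (simp_all add: nn_integral_count_space_nat)

text \<open>
  A finite measure \<open>m\<close> on the tower which the tower map does not increase is recurrent.  Here \<open>m\<close> has density
  \<open>\<rho>\<close>.  Let \<open>H\<close> be the set of points that never visit level \<open>u\<close> from time 0 on and \<open>H'\<close> the set of those that do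
  not visit it from time 1 on.  Then \<open>H'\<close> is the preimage of \<open>H\<close>, so \<open>m H' \<le> m H < \<infinity>\<close>, while \<open>H \<subseteq> H'\<close>.
  Therefore \<open>H' - H\<close> is a null set, and it consists of the points of level \<open>u\<close> that do not return.
\<close>
lemma AE_return:
  assumes u: "u \<in> charged"
  shows "AE x in M. x \<in> D u \<longrightarrow> (\<exists>n. level_at (Suc n) u x = u)"
proof -
  have u\<alpha>: "u \<in> \<alpha>" using u charged_subset by auto
  \<comment> \<open>\<open>H v\<close> and \<open>H' v\<close> are the parts of the two sets on level \<open>v\<close>.\<close>
  define H where "H v = {x\<in>D v. \<forall>n. level_at n v x \<noteq> u}" for v
  define H' where "H' v = {x\<in>D v. \<forall>n. level_at (Suc n) v x \<noteq> u}" for v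
  have event: "{x\<in>D v. \<forall>n. level_at (g n) v x \<noteq> u} \<in> sets M" if "v \<in> \<alpha>" for v and g :: "nat \<Rightarrow> nat"
  proof -
    have "{x\<in>D v. \<forall>n. level_at (g n) v x \<noteq> u} = D v \<inter> (\<Inter>n. level_at (g n) v -` (- {u}) \<inter> space M)"
      using D_subset[OF that] by (auto simp: space_M)
    also have "\<dots> \<in> sets M"
      using that by (intro sets.Int D_sets sets.countable_INT image_subsetI measurable_sets[OF level_at_measurable]) simp_all
    finally show ?thesis .
  qed
  have H: "H v \<in> sets M" if "v \<in> \<alpha>" for v unfolding H_def by (rule event[OF that])
  have H': "H' v \<in> sets M" if "v \<in> \<alpha>" for v unfolding H'_def by (rule event[OF that])
  define q :: "nat \<Rightarrow> nat \<Rightarrow> ennreal" where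
    "q v t = (if v \<in> \<alpha> \<and> t \<in> \<alpha> \<and> arrow v t then ennreal (1 / slope v) else 0)" for v t
  define h where "h v = emeasure M (H v) * indicator \<alpha> v" for v
  define h' where "h' v = emeasure M (H' v) * indicator \<alpha> v" for v
  define r where "r v = ennreal (\<rho> v) * indicator \<alpha> v" for v
  \<comment> \<open>A point avoids level \<open>u\<close> from time 1 on iff its image avoids it from time 0 on.\<close>
  have h'_eq: "h' v = (\<Sum>t. q v t * h t)" for v
  proof (cases "v \<in> \<alpha>")
    case v: True
    have "emeasure M (H' v) = emeasure M (\<Union>t\<in>\<alpha>. entry v t (H t))"
    proof (rule emeasure_eq_AE)
      show "AE x in M. x \<in> H' v \<longleftrightarrow> x \<in> (\<Union>t\<in>\<alpha>. entry v t (H t))"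
        using AE_regular
      proof eventually_elim
        case (elim x)
        show ?case
          using regular_level_at[OF elim v, of "Suc 0"]
          by (auto simp: H_def H'_def entry_def level_at_Suc2 level_at_1)
      qed
      show "(\<Union>t\<in>\<alpha>. entry v t (H t)) \<in> sets M"
        by (intro sets.countable_UN' image_subsetI entry_sets v H countableI_type)
    qed (rule H'[OF v])
    also have "\<dots> = (\<integral>\<^sup>+t. emeasure M (entry v t (H t)) \<partial>count_space \<alpha>)"
      by (intro emeasure_UN_countable entry_sets v H countableI_type) (auto simp: disjoint_family_on_def entry_def)
    also have "\<dots> = (\<integral>\<^sup>+t. q v t * h t \<partial>count_space \<alpha>)"
    proof (rule nn_integral_cong)
      fix t assume "t \<in> space (count_space \<alpha>)"
      then have t: "t \<in> \<alpha>" by simp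
      show "emeasure M (entry v t (H t)) = q v t * h t"
        using v t by (subst entry_law[OF v t H[OF t]]) (auto simp: H_def q_def h_def)
    qed
    also have "\<dots> = (\<Sum>t. q v t * h t)"
      unfolding nn_integral_\<alpha> by (intro suminf_cong) (simp add: h_def indicator_def)
    finally show ?thesis using v by (simp add: h'_def)
  next
    case False
    then show ?thesis by (simp add: h'_def q_def)
  qed
  have "(\<Sum>v. r v * h' v) = (\<Sum>v. \<Sum>t. r v * (q v t * h t))"
    by (simp add: h'_eq)
  also have "\<dots> = (\<integral>\<^sup>+v. (\<Sum>t. r v * (q v t * h t)) \<partial>count_space UNIV)"
    by (simp add: nn_integral_count_space_nat)
  also have "\<dots> = (\<Sum>t. \<integral>\<^sup>+v. r v * (q v t * h t) \<partial>count_space UNIV)"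
    by (rule nn_integral_suminf) simp
  also have "\<dots> = (\<Sum>t. (\<Sum>v. r v * q v t) * h t)"
    by (simp add: nn_integral_count_space_nat mult.assoc[symmetric])
  also have "\<dots> \<le> (\<Sum>t. r t * h t)"
  proof (rule suminf_le)
    fix t show "(\<Sum>v. r v * q v t) * h t \<le> r t * h t"
    proof (cases "t \<in> \<alpha>")
      case True
      have "(\<Sum>v. r v * q v t) \<le> r t"
      proof (rule suminf_le_const)
        fix n
        have "(\<Sum>v<n. r v * q v t) = (\<Sum>v\<in>{..<n} \<inter> \<alpha>. ennreal (if arrow v t then \<rho> v / slope v else 0))"
        proof (rule sum.mono_neutral_cong_right)
          show "\<forall>i\<in>{..<n} - {..<n} \<inter> \<alpha>. r i * q i t = 0" by (auto simp: r_def)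
          fix v assume "v \<in> {..<n} \<inter> \<alpha>"
          then show "r v * q v t = ennreal (if arrow v t then \<rho> v / slope v else 0)"
            using True density_nonneg[of v] slope_ge_1[of v] by (simp add: r_def q_def ennreal_mult'[symmetric])
        qed auto
        also have "\<dots> = ennreal (\<Sum>v\<in>{..<n} \<inter> \<alpha>. if arrow v t then \<rho> v / slope v else 0)"
        proof (rule sum_ennreal)
          fix v assume "v \<in> {..<n} \<inter> \<alpha>"
          then show "0 \<le> (if arrow v t then \<rho> v / slope v else 0)"
            using slope_ge_1[of v] density_nonneg[of v] by simp
        qed
        also have "\<dots> \<le> r t"
          using density_subinvariant[of "{..<n} \<inter> \<alpha>" t] True by (auto simp: r_def intro!: ennreal_leI)
        finally show "(\<Sum>v<n. r v * q v t) \<le> r t" .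
      qed simp
      then show ?thesis by (rule mult_right_mono) simp
    qed (simp add: h_def)
  qed simp_all
  finally have le: "(\<Sum>v. r v * h' v) \<le> (\<Sum>v. r v * h v)" .
  have fin: "(\<Sum>v. r v * h v) \<le> ennreal (real N)"
  proof (rule suminf_le_const)
    fix n
    have "(\<Sum>v<n. r v * h v) \<le> (\<Sum>v\<in>{..<n} \<inter> \<alpha>. ennreal (\<rho> v * measure M (D v)))"
    proof -
      have "(\<Sum>v<n. r v * h v) = (\<Sum>v\<in>{..<n} \<inter> \<alpha>. r v * h v)"
        by (rule sum.mono_neutral_right) (auto simp: r_def)
      also have "\<dots> \<le> (\<Sum>v\<in>{..<n} \<inter> \<alpha>. ennreal (\<rho> v * measure M (D v)))"
      proof (rule sum_mono)
        fix v assume v: "v \<in> {..<n} \<inter> \<alpha>"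
        have "emeasure M (H v) \<le> emeasure M (D v)"
          using v by (intro emeasure_mono D_sets) (auto simp: H_def)
        then show "r v * h v \<le> ennreal (\<rho> v * measure M (D v))"
          using v density_nonneg[of v] by (simp add: r_def h_def ennreal_mult emeasure_eq_measure mult_left_mono)
      qed
      finally show ?thesis .
    qed
    also have "\<dots> = ennreal (\<Sum>v\<in>{..<n} \<inter> \<alpha>. \<rho> v * measure M (D v))"
      by (intro sum_ennreal) (simp add: density_nonneg)
    also have "\<dots> \<le> ennreal (real N)" by (intro ennreal_leI density_mass_le) auto
    finally show "(\<Sum>v<n. r v * h v) \<le> ennreal (real N)" .
  qed simp
  \<comment> \<open>\<open>\<epsilon>\<close> is the mass of the points of level \<open>u\<close> without return.  On that level \<open>H\<close> is empty, so \<open>\<epsilon>\<close> can be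
    added to the total mass of \<open>H\<close> without exceeding that of \<open>H'\<close>.\<close>
  define \<epsilon> where "\<epsilon> = r u * h' u"
  have "H u = {}" by (auto simp: H_def intro: exI[of _ 0])
  then have "h u = 0" by (simp add: h_def)
  have "(\<Sum>v. r v * h v) + \<epsilon> = (\<Sum>v. r v * h v + (if v = u then \<epsilon> else 0))"
    using sums_unique[OF sums_single[of u "\<lambda>_. \<epsilon>"]] by (subst suminf_add[symmetric]) auto
  also have "\<dots> \<le> (\<Sum>v. r v * h' v)"
  proof (rule suminf_le)
    fix v
    have "h v \<le> h' v"
    proof (cases "v \<in> \<alpha>")
      case True
      have "H v \<subseteq> H' v" by (auto simp: H_def H'_def)
      then show ?thesis using emeasure_mono[OF _ H'[OF True]] True by (simp add: h_def h'_def)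
    qed (simp add: h_def)
    then show "r v * h v + (if v = u then \<epsilon> else 0) \<le> r v * h' v"
      using \<open>h u = 0\<close> by (auto simp: \<epsilon>_def mult_left_mono)
  qed simp_all
  finally have "(\<Sum>v. r v * h v) + \<epsilon> \<le> (\<Sum>v. r v * h v) + 0"
    using le by (simp only: add_0_right order_trans)
  moreover have "(\<Sum>v. r v * h v) \<noteq> \<top>" using fin by (auto simp: top_unique)
  ultimately have "\<epsilon> = 0" by (subst (asm) ennreal_add_left_cancel_le) auto
  then have "emeasure M (H' u) = 0"
    using u\<alpha> u charged_iff[OF u\<alpha>] by (simp add: \<epsilon>_def r_def h'_def ennreal_eq_0_iff)
  then have "AE x in M. x \<notin> H' u" using H'[OF u\<alpha>] by (intro AE_not_in null_setsI)
  then show ?thesis by eventually_elim (auto simp: H'_def)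
qed

end

context lifted_tower
begin

section \<open>Paths of levels\<close>

text \<open>
  The reciprocal of the Jacobian of the tower map along the path that starts at \<open>t\<close> and then visits the levels
  in the list; it is 0 if an arrow is missing.
\<close>
primrec path_weight :: "nat \<Rightarrow> nat list \<Rightarrow> real" where
  "path_weight t [] = 1"
| "path_weight t (v # w) = (if arrow t v then 1 / slope t else 0) * path_weight v w"

text \<open>
  The points of level \<open>t\<close> that follow the path and arrive in \<open>B\<close>.
\<close>
primrec path_set :: "nat \<Rightarrow> nat list \<Rightarrow> (real ^ 'n) set \<Rightarrow> (real ^ 'n) set" where
  "path_set t [] B = B"
| "path_set t (v # w) B = entry t v (path_set v w B)"

text \<open>
  The initial level is omitted, in agreement with the lists in \<open>path_weight\<close> and \<open>path_set\<close>.
\<close>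
definition itinerary :: "nat \<Rightarrow> real ^ 'n \<Rightarrow> nat \<Rightarrow> nat list" where
  "itinerary t x n = map (\<lambda>i. level_at (Suc i) t x) [0..<n]"

lemma itinerary_Suc: "itinerary t x (Suc n) = next_level t x # itinerary (next_level t x) (T x) n"
  by (simp add: itinerary_def upt_conv_Cons map_Suc_upt[symmetric] level_at_1 level_at_Suc2[of "Suc _"]
      del: upt_Suc map_Suc_upt)

lemma itinerary_snoc: "itinerary t x (Suc n) = itinerary t x n @ [level_at (Suc n) t x]"
  by (simp add: itinerary_def)

lemma length_itinerary [simp]: "length (itinerary t x n) = n"
  by (simp add: itinerary_def)

lemma last_itinerary: "last (t # itinerary t x n) = level_at n t x"
  by (cases n) (simp_all add: itinerary_snoc, simp add: itinerary_def)

lemma path_weight_nonneg: "set w \<subseteq> \<alpha> \<Longrightarrow> t \<in> \<alpha> \<Longrightarrow> 0 \<le> path_weight t w"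
proof (induction w arbitrary: t)
  case (Cons v w)
  then show ?case using slope_ge_1[of t] by simp
qed simp

text \<open>
  Concatenation of the Markov steps: along a path the tower map has a constant Jacobian and reaches all of the last
  level.
\<close>
lemma path_law:
  assumes "t \<in> \<alpha>" "set w \<subseteq> \<alpha>" "B \<in> sets M" "B \<subseteq> D (last (t # w))"
  shows "path_set t w B \<in> sets M \<and> path_set t w B \<subseteq> D t \<and>
    emeasure M (path_set t w B) = ennreal (path_weight t w) * emeasure M B"
  using assms
proof (induction w arbitrary: t)
  case (Cons v w)
  then have IH: "path_set v w B \<in> sets M" "path_set v w B \<subseteq> D v"
    "emeasure M (path_set v w B) = ennreal (path_weight v w) * emeasure M B" by (auto split: if_splits)
  have v: "v \<in> \<alpha>" using Cons by simp
  have "emeasure M (path_set t (v # w) B) = (if arrow t v then ennreal (1 / slope t) else 0) * (ennreal (path_weight v w) * emeasure M B)"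
    using entry_law[OF Cons.prems(1) v IH(1,2)] IH(3) by simp
  also have "\<dots> = ennreal (path_weight t (v # w)) * emeasure M B"
    using slope_ge_1[OF Cons.prems(1)] path_weight_nonneg[of w v] Cons.prems v
    by (simp add: ennreal_mult' mult.assoc[symmetric])
  finally show ?case
    using entry_sets[OF Cons.prems(1) IH(1)] by (auto simp: entry_def)
qed simp

lemma path_set_iff:
  assumes "regular x" "t \<in> \<alpha>" "x \<in> D t"
  shows "x \<in> path_set t w B \<longleftrightarrow> itinerary t x (length w) = w \<and> (T ^^ length w) x \<in> B"
  using assms
proof (induction w arbitrary: t x)
  case Nil
  then show ?case by (simp add: itinerary_def)
next
  case (Cons v w)
  have "regular (T x)" using regular_T[OF Cons.prems(1), of 1] by simp
  moreover have "next_level t x \<in> \<alpha> \<and> T x \<in> D (next_level t x)"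
    using regular_level_at[OF Cons.prems, of 1] by (simp add: level_at_1)
  ultimately show ?case
    using Cons.IH[of "T x" v] Cons.prems by (auto simp: entry_def itinerary_Suc funpow_swap1)
qed

section \<open>Stacking the rugs along paths\<close>

text \<open>
  The height in the rug over \<open>v\<close> at which the image of the rug over \<open>t\<close> is placed: the images of the rugs with
  smaller indices lie below it.
\<close>
definition offset :: "nat \<Rightarrow> nat \<Rightarrow> real" where
  "offset t v = (\<Sum>t' | t' \<in> charged \<and> t' < t \<and> arrow t' v. \<rho> t' / slope t')"

definition step_map :: "nat \<Rightarrow> nat \<Rightarrow> real \<Rightarrow> real" where
  "step_map t v y = y / slope t + offset t v"

primrec path_map :: "nat \<Rightarrow> nat list \<Rightarrow> real \<Rightarrow> real" where
  "path_map t [] y = y"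
| "path_map t (v # w) y = path_map v w (step_map t v y)"

primrec path_ok :: "nat \<Rightarrow> nat list \<Rightarrow> bool" where
  "path_ok t [] \<longleftrightarrow> True"
| "path_ok t (v # w) \<longleftrightarrow> v \<in> charged \<and> arrow t v \<and> path_ok v w"

lemma path_map_snoc: "path_map t (w @ [v]) y = step_map (last (t # w)) v (path_map t w y)"
  by (induction w arbitrary: t y) auto

lemma path_ok_snoc: "path_ok t (w @ [v]) \<longleftrightarrow> path_ok t w \<and> v \<in> charged \<and> arrow (last (t # w)) v"
  by (induction w arbitrary: t) auto

lemma path_ok_subset: "path_ok t w \<Longrightarrow> set w \<subseteq> charged"
  by (induction w arbitrary: t) auto

lemma path_ok_last: "t \<in> charged \<Longrightarrow> path_ok t w \<Longrightarrow> last (t # w) \<in> charged"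
  using path_ok_subset[of t w] last_in_set[of w] by auto

lemma path_weight_pos: "t \<in> charged \<Longrightarrow> path_ok t w \<Longrightarrow> path_weight t w > 0"
proof (induction w arbitrary: t)
  case (Cons v w)
  then have "0 < slope t" using slope_ge_1[of t] charged_subset by force
  then show ?case using Cons by simp
qed simp

lemma path_ok_of_weight: "t \<in> charged \<Longrightarrow> set w \<subseteq> \<alpha> \<Longrightarrow> path_weight t w \<noteq> 0 \<Longrightarrow> path_ok t w"
proof (induction w arbitrary: t)
  case (Cons v w)
  then have "arrow t v" by (auto split: if_splits)
  then show ?case using Cons charged_arrow[of t v] by auto
qed simp

lemma path_map_affine: "path_ok t w \<Longrightarrow> path_map t w y = path_map t w 0 + path_weight t w * y"
proof (induction w arbitrary: t y)
  case (Cons v w)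
  show ?case
    using Cons.IH[of v "step_map t v y"] Cons.IH[of v "step_map t v 0"] Cons.prems
    by (simp add: step_map_def algebra_simps)
qed simp

lemma offset_mono:
  assumes "t \<in> charged" "t < t'" "arrow t v"
  shows "\<rho> t / slope t + offset t v \<le> offset t' v"
proof -
  let ?S = "\<lambda>t. {t'. t' \<in> charged \<and> t' < t \<and> arrow t' v}"
  have nn: "0 \<le> \<rho> i / slope i" if "i \<in> charged" for i
    using that slope_ge_1[of i] charged_subset density_nonneg[of i] by (intro divide_nonneg_nonneg) force+
  have "\<rho> t / slope t + offset t v = (\<Sum>i\<in>insert t (?S t). \<rho> i / slope i)"
    unfolding offset_def by (subst sum.insert) auto
  also have "\<dots> \<le> offset t' v"
    unfolding offset_def using assms nn by (intro sum_mono2) auto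
  finally show ?thesis .
qed

lemma offset_nonneg: "0 \<le> offset t v"
  unfolding offset_def
proof (rule sum_nonneg)
  fix i assume "i \<in> {t'. t' \<in> charged \<and> t' < t \<and> arrow t' v}"
  then have "1 \<le> slope i" using charged_subset by (intro slope_ge_1) auto
  then show "0 \<le> \<rho> i / slope i" using density_nonneg[of i] by simp
qed

text \<open>
  The images of all rugs, stacked on top of each other, do not exceed the height of the rug over \<open>v\<close>; this is
  subinvariance of the densities.
\<close>
lemma offset_le:
  assumes "t \<in> charged" "v \<in> \<alpha>" "arrow t v"
  shows "\<rho> t / slope t + offset t v \<le> \<rho> v"
proof -
  let ?S = "insert t {t'. t' \<in> charged \<and> t' < t \<and> arrow t' v}"
  have "\<rho> t / slope t + offset t v = (\<Sum>i\<in>?S. \<rho> i / slope i)"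
    unfolding offset_def by (subst sum.insert) auto
  also have "\<dots> = (\<Sum>i\<in>?S. if arrow i v then \<rho> i / slope i else 0)"
    using assms by (intro sum.cong) auto
  also have "\<dots> \<le> \<rho> v" using assms charged_subset by (intro density_subinvariant) auto
  finally show ?thesis .
qed

lemma step_map_range:
  assumes "t \<in> charged" "v \<in> \<alpha>" "arrow t v"
  shows "y \<in> {0..<\<rho> t} \<Longrightarrow> step_map t v y \<in> {0..<\<rho> v}"
    and "y \<in> {0..\<rho> t} \<Longrightarrow> step_map t v y \<in> {0..\<rho> v}"
proof -
  have sl: "0 < slope t" using slope_ge_1[of t] charged_subset assms by force
  have "step_map t v y < \<rho> v" if "y < \<rho> t"
    using offset_le[OF assms] divide_strict_right_mono[OF that sl] by (simp add: step_map_def)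
  moreover have "step_map t v y \<le> \<rho> v" if "y \<le> \<rho> t"
    using offset_le[OF assms] divide_right_mono[OF that less_imp_le[OF sl]] by (simp add: step_map_def)
  moreover have "0 \<le> step_map t v y" if "0 \<le> y"
    using that sl offset_nonneg[of t v] by (simp add: step_map_def)
  ultimately show "y \<in> {0..<\<rho> t} \<Longrightarrow> step_map t v y \<in> {0..<\<rho> v}" "y \<in> {0..\<rho> t} \<Longrightarrow> step_map t v y \<in> {0..\<rho> v}"
    by auto
qed

text \<open>
  The images of different rugs in the rug over \<open>v\<close> are disjoint, so height and level determine the previous height
  and level.  Half-open intervals are used because neighbouring images share an end point.
\<close>
lemma step_map_inj:
  assumes "t \<in> charged" "t' \<in> charged" "arrow t v" "arrow t' v"
    and "y \<in> {0..<\<rho> t}" "y' \<in> {0..<\<rho> t'}" and eq: "step_map t v y = step_map t' v y'"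
  shows "t = t' \<and> y = y'"
proof -
  have sl: "0 < slope t" "0 < slope t'" using slope_ge_1[of t] slope_ge_1[of t'] charged_subset assms by force+
  have lt: "y / slope t < \<rho> t / slope t" "y' / slope t' < \<rho> t' / slope t'" "0 \<le> y / slope t" "0 \<le> y' / slope t'"
    using assms sl by (auto intro: divide_strict_right_mono)
  have "t = t'"
  proof (rule ccontr)
    assume "t \<noteq> t'"
    then consider "t < t'" | "t' < t" by linarith
    then show False
    proof cases
      case 1
      then show ?thesis using offset_mono[of t t' v] assms lt by (simp add: step_map_def)
    next
      case 2
      then show ?thesis using offset_mono[of t' t v] assms lt by (simp add: step_map_def)
    qed
  qed
  then show ?thesis using eq sl by (simp add: step_map_def)
qed

lemma path_map_range:
  assumes "t \<in> charged" "path_ok t w"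
  shows "y \<in> {0..<\<rho> t} \<Longrightarrow> path_map t w y \<in> {0..<\<rho> (last (t # w))}"
    and "y \<in> {0..\<rho> t} \<Longrightarrow> path_map t w y \<in> {0..\<rho> (last (t # w))}"
  using assms
proof (induction w arbitrary: t y)
  case (Cons v w)
  {
    case 1
    then have "step_map t v y \<in> {0..<\<rho> v}" using charged_subset by (intro step_map_range) auto
    then show ?case using Cons(1)[of "step_map t v y" v] 1 by simp
  next
    case 2
    then have "step_map t v y \<in> {0..\<rho> v}" using charged_subset by (intro step_map_range) auto
    then show ?case using Cons(2)[of "step_map t v y" v] 2 by simp
  }
qed simp_all

text \<open>
  Going back from the common end point, the two paths agree step by step by injectivity of the steps.  As \<open>u\<close> does
  not occur in between, both paths reach their starting level \<open>u\<close> at the same moment.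
\<close>
lemma path_map_disjoint:
  assumes "u \<in> charged" "path_ok u w" "path_ok u w'" "y \<in> {0..<\<rho> u}" "y' \<in> {0..<\<rho> u}"
    and "path_map u w y = path_map u w' y'" "last (u # w) = last (u # w')" "w = [] \<longleftrightarrow> w' = []"
    and "u \<notin> set (butlast w)" "u \<notin> set (butlast w')"
  shows "w = w'"
  using assms(2-)
proof (induction w arbitrary: w' rule: rev_induct)
  case (snoc v w)
  then obtain w1 where w': "w' = w1 @ [v]" by (cases w' rule: rev_cases) auto
  let ?t = "last (u # w)" and ?t' = "last (u # w1)"
  have ok: "path_ok u w" "path_ok u w1" "arrow ?t v" "arrow ?t' v"
    using snoc.prems by (auto simp: w' path_ok_snoc)
  have "step_map ?t v (path_map u w y) = step_map ?t' v (path_map u w1 y')"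
    using snoc.prems by (simp add: w' path_map_snoc)
  with path_ok_last[OF assms(1) ok(1)] path_ok_last[OF assms(1) ok(2)] ok(3,4)
    path_map_range(1)[OF assms(1) ok(1) snoc.prems(3)] path_map_range(1)[OF assms(1) ok(2) snoc.prems(4)]
  have "?t = ?t' \<and> path_map u w y = path_map u w1 y'" by (rule step_map_inj)
  moreover have "w = [] \<longleftrightarrow> w1 = []"
    using calculation snoc.prems last_in_set[of w] last_in_set[of w1] by (auto simp: w' split: if_splits)
  ultimately have "w = w1"
    using snoc.prems ok by (intro snoc.IH) (auto simp: w' dest: in_set_butlastD)
  then show ?case by (simp add: w')
qed simp

end

section \<open>First return to a charged level\<close>

locale charged_level = lifted_tower X M T N Z s \<alpha> D \<mu>h
  for X :: "(real ^ 'n) set" and M T N Z s \<alpha> D \<mu>h +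
  fixes u :: nat
  assumes u_charged: "u \<in> charged"
begin

lemma u_\<alpha>: "u \<in> \<alpha>"
  using u_charged charged_subset by auto

lemma \<rho>_u_pos: "\<rho> u > 0"
  using charged_iff[OF u_\<alpha>] u_charged by simp

text \<open>
  The words of levels that describe a first return to \<open>u\<close>.
\<close>
definition loop :: "nat list \<Rightarrow> bool" where
  "loop w \<longleftrightarrow> w \<noteq> [] \<and> last w = u \<and> u \<notin> set (butlast w) \<and> set w \<subseteq> \<alpha>"

text \<open>
  The first return takes place at time \<open>Suc (return_index x)\<close>.
\<close>
definition return_index :: "real ^ 'n \<Rightarrow> nat" where
  "return_index x = (LEAST n. level_at (Suc n) u x = u)"

definition return_word :: "real ^ 'n \<Rightarrow> nat list" where
  "return_word x = itinerary u x (Suc (return_index x))"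

definition return_map :: "real ^ 'n \<Rightarrow> real ^ 'n" where
  "return_map x = (T ^^ Suc (return_index x)) x"

definition returns :: "real ^ 'n \<Rightarrow> bool" where
  "returns x \<longleftrightarrow> regular x \<and> x \<in> D u \<and> (\<exists>n. level_at (Suc n) u x = u)"

lemma AE_returns: "AE x in M. x \<in> D u \<longrightarrow> returns x"
  using AE_regular AE_return[OF u_charged] by eventually_elim (auto simp: returns_def)

lemma return_index:
  assumes "returns x"
  shows "level_at (Suc (return_index x)) u x = u"
    and "\<And>i. i < return_index x \<Longrightarrow> level_at (Suc i) u x \<noteq> u"
proof -
  from assms obtain n where n: "level_at (Suc n) u x = u" by (auto simp: returns_def)
  show "level_at (Suc (return_index x)) u x = u"
    unfolding return_index_def by (rule LeastI[of _ n]) (rule n)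
  show "\<And>i. i < return_index x \<Longrightarrow> level_at (Suc i) u x \<noteq> u"
    unfolding return_index_def by (rule not_less_Least)
qed

lemma return_word_loop:
  assumes "returns x" shows "loop (return_word x)"
proof -
  have "regular x" "x \<in> D u" using assms by (auto simp: returns_def)
  then have "level_at i u x \<in> \<alpha>" for i using regular_level_at u_\<alpha> by blast
  then have "set (return_word x) \<subseteq> \<alpha>" by (auto simp: return_word_def itinerary_def simp del: upt_Suc)
  moreover have "u \<notin> set (butlast (return_word x))"
  proof
    assume "u \<in> set (butlast (return_word x))"
    then obtain i where "i < return_index x" "u = level_at (Suc i) u x"
      by (auto simp: return_word_def itinerary_snoc) (auto simp: itinerary_def)
    then show False using return_index(2)[OF assms, of i] by simp
  qed
  ultimately show ?thesis
    using return_index(1)[OF assms] by (simp add: loop_def return_word_def itinerary_snoc)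
qed

lemma return_word_eq_iff:
  assumes x: "returns x" and w: "loop w"
  shows "return_word x = w \<longleftrightarrow> itinerary u x (length w) = w"
proof
  assume "return_word x = w"
  then have "length w = Suc (return_index x)" by (auto simp: return_word_def)
  then show "itinerary u x (length w) = w" using \<open>return_word x = w\<close> by (simp add: return_word_def)
next
  assume it: "itinerary u x (length w) = w"
  obtain n where n: "length w = Suc n" using w by (cases w) (auto simp: loop_def)
  have eq: "w = itinerary u x n @ [level_at (Suc n) u x]" using it by (simp add: n itinerary_snoc)
  have "return_index x = n"
    unfolding return_index_def
  proof (rule Least_equality)
    have "last w = level_at (Suc n) u x" by (subst eq) simp
    then show "level_at (Suc n) u x = u" using w by (simp add: loop_def)
    fix m assume m: "level_at (Suc m) u x = u"
    show "n \<le> m"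
    proof (rule ccontr)
      assume "\<not> n \<le> m"
      then have "u \<in> set (itinerary u x n)" using m by (auto simp: itinerary_def image_iff intro!: bexI[of _ m])
      moreover have "butlast w = itinerary u x n" by (subst eq) simp
      ultimately show False using w by (simp add: loop_def)
    qed
  qed
  then show "return_word x = w" using it by (simp add: return_word_def n)
qed

lemma return_map_in: "returns x \<Longrightarrow> return_map x \<in> D u"
  using regular_level_at[of x u "Suc (return_index x)"] return_index(1)[of x] u_\<alpha>
  by (simp add: returns_def return_map_def)

lemma return_index_measurable: "return_index \<in> M \<rightarrow>\<^sub>M count_space UNIV"
  unfolding return_index_def[abs_def]
proof (rule measurable_Least)
  fix n
  have "{x\<in>space M. level_at (Suc n) u x = u} = level_at (Suc n) u -` {u} \<inter> space M" by auto
  then show "Measurable.pred M (\<lambda>x. level_at (Suc n) u x = u)"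
    unfolding pred_def using measurable_sets[OF level_at_measurable] by simp
qed

lemma return_word_measurable: "return_word \<in> M \<rightarrow>\<^sub>M count_space UNIV"
proof (subst measurable_count_space_eq2_countable, safe)
  fix w :: "nat list"
  let ?R = "return_index -` {n. Suc n = length w} \<inter> space M"
  let ?L = "{x\<in>space M. \<forall>i\<in>{..<length w}. level_at (Suc i) u x = w ! i}"
  have eq: "return_word x = w \<longleftrightarrow> Suc (return_index x) = length w \<and> (\<forall>i\<in>{..<length w}. level_at (Suc i) u x = w ! i)" for x
    unfolding return_word_def itinerary_def list_eq_iff_nth_eq by (auto simp del: upt_Suc)
  have "?R \<in> sets M"
    by (rule measurable_sets[OF return_index_measurable]) simp
  moreover have "?L \<in> sets M"
  proof (rule sets.sets_Collect_finite_All)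
    fix i
    have "level_at (Suc i) u -` {w ! i} \<inter> space M \<in> sets M"
      by (rule measurable_sets[OF level_at_measurable]) simp
    moreover have "level_at (Suc i) u -` {w ! i} \<inter> space M = {x \<in> space M. level_at (Suc i) u x = w ! i}" by auto
    ultimately show "{x \<in> space M. level_at (Suc i) u x = w ! i} \<in> sets M" by simp
  qed simp
  ultimately have "?R \<inter> ?L \<in> sets M" by (rule sets.Int)
  also have "?R \<inter> ?L = return_word -` {w} \<inter> space M" using eq by auto
  finally show "return_word -` {w} \<inter> space M \<in> sets M" .
qed auto

lemma return_map_measurable: "return_map \<in> M \<rightarrow>\<^sub>M M"
proof -
  have "(\<lambda>x. (T ^^ Suc (return_index x)) x) \<in> M \<rightarrow>\<^sub>M M"
    by (rule measurable_compose_countable[where f="\<lambda>n. T ^^ Suc n", OF T_pow_measurable return_index_measurable])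
  then show ?thesis by (simp only: return_map_def[abs_def])
qed

section \<open>The law of the first return\<close>

definition loop_weight :: "nat list \<Rightarrow> real" where
  "loop_weight w = (if loop w then path_weight u w else 0)"

lemma loop_weight_nonneg: "0 \<le> loop_weight w"
  using path_weight_nonneg[of w u] u_\<alpha> by (simp add: loop_weight_def loop_def)

lemma return_event_sets: "B \<in> sets M \<Longrightarrow> {x\<in>D u. return_word x = w \<and> return_map x \<in> B} \<in> sets M"
proof -
  assume B: "B \<in> sets M"
  have "{x\<in>D u. return_word x = w \<and> return_map x \<in> B} =
      D u \<inter> ((return_word -` {w} \<inter> space M) \<inter> (return_map -` B \<inter> space M))"
    using D_subset[OF u_\<alpha>] by (auto simp: space_M)
  also have "\<dots> \<in> sets M"
    by (intro sets.Int D_sets u_\<alpha> measurable_sets[OF return_word_measurable] measurable_sets[OF return_map_measurable] B) simp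
  finally show ?thesis .
qed

text \<open>
  The points whose first return follows the loop \<open>w\<close> are those that follow the path \<open>w\<close>, so this is an instance
  of the Markov property along paths.
\<close>
lemma return_law:
  assumes B: "B \<in> sets M" "B \<subseteq> D u"
  shows "emeasure M {x\<in>D u. return_word x = w \<and> return_map x \<in> B} = ennreal (loop_weight w) * emeasure M B"
proof (cases "loop w")
  case True
  have pl: "path_set u w B \<in> sets M \<and> path_set u w B \<subseteq> D u \<and>
    emeasure M (path_set u w B) = ennreal (path_weight u w) * emeasure M B"
    using True B by (intro path_law u_\<alpha>) (auto simp: loop_def)
  have "emeasure M {x\<in>D u. return_word x = w \<and> return_map x \<in> B} = emeasure M (path_set u w B)"
  proof (rule emeasure_eq_AE)
    show "AE x in M. x \<in> {x\<in>D u. return_word x = w \<and> return_map x \<in> B} \<longleftrightarrow> x \<in> path_set u w B"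
      using AE_returns
    proof eventually_elim
      case (elim x)
      show ?case
      proof (cases "x \<in> D u")
        case xD: True
        then have r: "returns x" using elim by simp
        have "length w = Suc (return_index x)" if "return_word x = w" using that by (auto simp: return_word_def)
        then show ?thesis
          using r xD True path_set_iff[of x u w B] u_\<alpha> return_word_eq_iff[OF r True]
          by (auto simp: return_map_def returns_def)
      qed (use pl in auto)
    qed
  qed (use pl return_event_sets[OF B(1)] in simp_all)
  then show ?thesis using pl True by (simp add: loop_weight_def)
next
  case False
  have "AE x in M. x \<notin> {x\<in>D u. return_word x = w \<and> return_map x \<in> B}"
    using AE_returns by eventually_elim (use False return_word_loop in auto)
  then have "emeasure M {x\<in>D u. return_word x = w \<and> return_map x \<in> B} = 0"
    using AE_iff_null_sets[OF return_event_sets[OF B(1)], of w] by (auto dest: null_setsD1)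
  then show ?thesis using False by (simp add: loop_weight_def)
qed

text \<open>
  Almost every point of \<open>D u\<close> returns, along exactly one loop.
\<close>
lemma loop_weights_sum: "(\<integral>\<^sup>+a. ennreal (loop_weight (list_decode a)) \<partial>count_space UNIV) = 1"
proof -
  let ?E = "\<lambda>a. {x\<in>D u. return_word x = list_decode a \<and> return_map x \<in> D u}"
  have "(\<integral>\<^sup>+a. ennreal (loop_weight (list_decode a)) \<partial>count_space UNIV) * emeasure M (D u) =
      (\<integral>\<^sup>+a. emeasure M (?E a) \<partial>count_space UNIV)"
    by (simp add: return_law[OF D_sets[OF u_\<alpha>]] nn_integral_multc)
  also have "\<dots> = emeasure M (\<Union>a. ?E a)"
    by (intro emeasure_UN_countable[symmetric] return_event_sets D_sets u_\<alpha>)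
      (auto simp: disjoint_family_on_def dest: injD[OF inj_list_decode])
  also have "\<dots> = emeasure M (D u)"
  proof (rule emeasure_eq_AE)
    show "AE x in M. x \<in> (\<Union>a. ?E a) \<longleftrightarrow> x \<in> D u"
      using AE_returns
      by eventually_elim (auto simp: return_map_in intro!: exI[of _ "list_encode (return_word _)"])
    show "(\<Union>a. ?E a) \<in> sets M"
      by (intro sets.countable_UN' image_subsetI return_event_sets D_sets u_\<alpha> countableI_type)
  qed (rule D_sets[OF u_\<alpha>])
  finally have "(\<integral>\<^sup>+a. ennreal (loop_weight (list_decode a)) \<partial>count_space UNIV) * emeasure M (D u) = 1 * emeasure M (D u)"
    by simp
  moreover have "emeasure M (D u) \<noteq> 0" "emeasure M (D u) \<noteq> \<top>"
    using level_props(3)[OF u_\<alpha>] by (auto simp: emeasure_eq_measure)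
  ultimately show ?thesis by (metis ennreal_mult_divide_eq)
qed

definition loop_pmf :: "nat pmf" where
  "loop_pmf = embed_pmf (\<lambda>a. loop_weight (list_decode a))"

lemma pmf_loop_pmf: "pmf loop_pmf a = loop_weight (list_decode a)"
  unfolding loop_pmf_def by (rule pmf_embed_pmf[OF loop_weight_nonneg loop_weights_sum])

lemma set_loop_pmf: "a \<in> set_pmf loop_pmf \<Longrightarrow> loop (list_decode a) \<and> path_ok u (list_decode a)"
  using path_ok_of_weight[OF u_charged, of "list_decode a"]
  by (auto simp: set_pmf_iff pmf_loop_pmf loop_weight_def loop_def split: if_splits)

text \<open>
  Loops are numbered by a bijection between lists and natural numbers, as the alphabet of the shift consists
  of natural numbers.
\<close>
definition letter :: "real ^ 'n \<Rightarrow> nat" where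
  "letter x = list_encode (return_word x)"

lemma list_decode_letter [simp]: "list_decode (letter x) = return_word x"
  by (simp add: letter_def)

abbreviation base_measure :: "(real ^ 'n) measure" where
  "base_measure \<equiv> uniform_measure M (D u)"

lemma prob_space_base: "prob_space base_measure"
  using level_props(3)[OF u_\<alpha>] by (intro prob_space_uniform_measure) (auto simp: emeasure_eq_measure)

lemma AE_base: "(AE x in base_measure. P x) \<longleftrightarrow> (AE x in M. x \<in> D u \<longrightarrow> P x)"
  using level_props(3)[OF u_\<alpha>] by (intro AE_uniform_measure) (auto simp: emeasure_eq_measure)

lemma letter_measurable: "letter \<in> base_measure \<rightarrow>\<^sub>M count_space UNIV"
  using measurable_compose[OF return_word_measurable, of list_encode "count_space UNIV"]
  by (simp add: letter_def[abs_def] cong: measurable_cong_sets)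

lemma return_map_base_measurable: "return_map \<in> base_measure \<rightarrow>\<^sub>M base_measure"
  using return_map_measurable by simp

text \<open>
  For a uniformly distributed point of \<open>D u\<close> the loop of its first return is independent of the position on arrival,
  which is uniformly distributed again.
\<close>
lemma base_law:
  assumes "B \<in> sets base_measure"
  shows "emeasure base_measure {x\<in>space base_measure. letter x = a \<and> return_map x \<in> B} =
    ennreal (pmf loop_pmf a) * emeasure base_measure B"
proof -
  have B: "B \<in> sets M" using assms by simp
  let ?E = "{x\<in>space base_measure. letter x = a \<and> return_map x \<in> B}"
  have E: "?E \<in> sets M"
  proof -
    have "?E = (letter -` {a} \<inter> space base_measure) \<inter> (return_map -` B \<inter> space base_measure)" by auto
    also have "\<dots> \<in> sets base_measure"
      by (intro sets.Int measurable_sets[OF letter_measurable] measurable_sets[OF return_map_base_measurable] assms) simp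
    finally show ?thesis by simp
  qed
  have "emeasure M (D u \<inter> ?E) = emeasure M {x\<in>D u. return_word x = list_decode a \<and> return_map x \<in> B \<inter> D u}"
  proof (rule emeasure_eq_AE)
    show "AE x in M. x \<in> D u \<inter> ?E \<longleftrightarrow> x \<in> {x\<in>D u. return_word x = list_decode a \<and> return_map x \<in> B \<inter> D u}"
      using AE_returns AE_space
    proof eventually_elim
      case (elim x)
      have "letter x = a \<longleftrightarrow> return_word x = list_decode a" by (auto simp: letter_def)
      then show ?case using elim return_map_in[of x] by auto
    qed
    show "{x\<in>D u. return_word x = list_decode a \<and> return_map x \<in> B \<inter> D u} \<in> sets M"
      by (intro return_event_sets sets.Int B D_sets u_\<alpha>)
  qed (intro sets.Int D_sets u_\<alpha> E)
  also have "\<dots> = ennreal (loop_weight (list_decode a)) * emeasure M (B \<inter> D u)"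
    by (rule return_law) (auto intro: B D_sets u_\<alpha>)
  finally show ?thesis
    using B E D_sets[OF u_\<alpha>] by (simp add: emeasure_uniform_measure pmf_loop_pmf ennreal_times_divide Int_commute)
qed

text \<open>
  Each loop contracts the fibre \<open>[0, \<rho> u)\<close> onto an interval whose relative length is the weight of the loop.
\<close>
sublocale tiling: affine_tiling loop_pmf "\<lambda>a. path_map u (list_decode a) 0" "\<rho> u"
proof
  show "0 < \<rho> u" by (rule \<rho>_u_pos)
  fix a assume a: "a \<in> set_pmf loop_pmf"
  let ?w = "list_decode a"
  have l: "loop ?w" "path_ok u ?w" "last (u # ?w) = u" using set_loop_pmf[OF a] by (auto simp: loop_def)
  show "0 \<le> path_map u ?w 0" using path_map_range(2)[OF u_charged l(2), of 0] \<rho>_u_pos by simp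
  show "path_map u ?w 0 + pmf loop_pmf a * \<rho> u \<le> \<rho> u"
    using path_map_range(2)[OF u_charged l(2), of "\<rho> u"] \<rho>_u_pos l path_map_affine[OF l(2), of "\<rho> u"]
    by (simp add: pmf_loop_pmf loop_weight_def)
next
  fix a a' y assume a: "a \<in> set_pmf loop_pmf" "a' \<in> set_pmf loop_pmf"
    and y: "y \<in> {path_map u (list_decode a) 0..<path_map u (list_decode a) 0 + pmf loop_pmf a * \<rho> u}"
      "y \<in> {path_map u (list_decode a') 0..<path_map u (list_decode a') 0 + pmf loop_pmf a' * \<rho> u}"
  have pre: "\<exists>y0\<in>{0..<\<rho> u}. path_map u (list_decode a) y0 = y"
    if a: "a \<in> set_pmf loop_pmf" and y: "y \<in> {path_map u (list_decode a) 0..<path_map u (list_decode a) 0 + pmf loop_pmf a * \<rho> u}" for a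
  proof -
    let ?w = "list_decode a"
    have l: "loop ?w" "path_ok u ?w" using set_loop_pmf[OF a] by auto
    then have p: "pmf loop_pmf a = path_weight u ?w" "path_weight u ?w > 0"
      using path_weight_pos[OF u_charged] by (auto simp: pmf_loop_pmf loop_weight_def)
    show ?thesis
      using y p path_map_affine[OF l(2), of "(y - path_map u ?w 0) / path_weight u ?w"]
      by (intro bexI[of _ "(y - path_map u ?w 0) / path_weight u ?w"]) (auto simp: field_simps)
  qed
  from pre[OF a(1) y(1)] pre[OF a(2) y(2)] obtain y0 y0' where y0: "y0 \<in> {0..<\<rho> u}" "y0' \<in> {0..<\<rho> u}"
    "path_map u (list_decode a) y0 = path_map u (list_decode a') y0'" by metis
  have "list_decode a = list_decode a'"
    using set_loop_pmf[OF a(1)] set_loop_pmf[OF a(2)] y0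
    by (intro path_map_disjoint[OF u_charged]) (auto simp: loop_def)
  then show "a = a'" by (rule injD[OF inj_list_decode])
qed

lemma tile_map_letter: "a \<in> set_pmf loop_pmf \<Longrightarrow> tiling.tile_map a y = path_map u (list_decode a) y"
  using set_loop_pmf[of a] path_map_affine[of u "list_decode a" y]
  by (simp add: tiling.tile_map_def pmf_loop_pmf loop_weight_def)

end

section \<open>Iterates of the rug map\<close>

context lifted_tower
begin

abbreviation F :: "((real ^ 'n) \<times> nat) \<times> real \<Rightarrow> ((real ^ 'n) \<times> nat) \<times> real" where
  "F \<equiv> rug_map M N Z T s \<alpha> D \<mu>h"

text \<open>
  The double sum in the rug map runs over pairs of a set \<open>Z k\<close> and a level inside it.  As every level lies in
  exactly one \<open>Z k\<close>, it is a sum over levels.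
\<close>
lemma F_step:
  assumes x: "regular x" and t: "t \<in> \<alpha>" "x \<in> D t"
  shows "F ((x, t), y) = ((T x, next_level t x), step_map t (next_level t x) y)"
proof -
  let ?v = "next_level t x"
  let ?S = "{t'. t' \<in> charged \<and> t' < t \<and> arrow t' ?v}"
  have fin: "finite ?S" by (rule finite_subset[of _ "{..<t}"]) auto
  have "(\<Sum>k=1..N. \<Sum>t' | t' \<in> charged \<and> t' < t \<and> D t' \<subseteq> Z k \<and> arrow t' ?v. \<rho> t' / s k) =
      (\<Sum>k=1..N. \<Sum>t'\<in>?S. if D t' \<subseteq> Z k then \<rho> t' / s k else 0)"
  proof (rule sum.cong)
    fix k
    have "{t'. t' \<in> charged \<and> t' < t \<and> D t' \<subseteq> Z k \<and> arrow t' ?v} = ?S \<inter> {t'. D t' \<subseteq> Z k}" by auto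
    then show "(\<Sum>t' | t' \<in> charged \<and> t' < t \<and> D t' \<subseteq> Z k \<and> arrow t' ?v. \<rho> t' / s k) =
        (\<Sum>t'\<in>?S. if D t' \<subseteq> Z k then \<rho> t' / s k else 0)"
      by (simp only: sum.inter_restrict[OF fin] mem_Collect_eq)
  qed simp
  also have "\<dots> = (\<Sum>t'\<in>?S. \<Sum>k=1..N. if D t' \<subseteq> Z k then \<rho> t' / s k else 0)" by (rule sum.swap)
  also have "\<dots> = offset t ?v"
    unfolding offset_def
  proof (rule sum.cong)
    fix t' assume "t' \<in> ?S"
    then have t': "t' \<in> \<alpha>" using charged_subset by auto
    have "(\<Sum>k=1..N. if D t' \<subseteq> Z k then \<rho> t' / s k else 0) =
        (\<Sum>k=1..N. if k = level_cell t' then \<rho> t' / s k else 0)"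
    proof (rule sum.cong)
      fix k assume "k \<in> {1..N}"
      then have "D t' \<subseteq> Z k \<longleftrightarrow> k = level_cell t'" using level_cell[OF t'] level_cell_unique[OF t'] by blast
      then show "(if D t' \<subseteq> Z k then \<rho> t' / s k else 0) = (if k = level_cell t' then \<rho> t' / s k else 0)" by simp
    qed simp
    also have "\<dots> = \<rho> t' / slope t'" using level_cell(1)[OF t'] by simp
    finally show "(\<Sum>k=1..N. if D t' \<subseteq> Z k then \<rho> t' / s k else 0) = \<rho> t' / slope t'" .
  qed simp
  finally show ?thesis
    using regular_cell_index[OF x t] by (simp add: rug_map_def tmap_eq step_map_def)
qed

lemma F_iterate:
  assumes x: "regular x" and t: "t \<in> charged" "x \<in> D t"
  shows "(F ^^ n) ((x, t), y) = (((T ^^ n) x, level_at n t x), path_map t (itinerary t x n) y) \<and>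
    path_ok t (itinerary t x n)"
proof (induction n)
  case 0
  then show ?case by (simp add: itinerary_def)
next
  case (Suc n)
  have t\<alpha>: "t \<in> \<alpha>" using t charged_subset by auto
  note lv = regular_level_at[OF x t\<alpha> t(2)]
  have ch: "level_at n t x \<in> charged"
    using path_ok_last[OF t(1)] Suc by (metis last_itinerary)
  have arr: "arrow (level_at n t x) (level_at (Suc n) t x)" by (rule regular_arrow[OF x t\<alpha> t(2)])
  have "F (((T ^^ n) x, level_at n t x), path_map t (itinerary t x n) y) =
      (((T ^^ Suc n) x, level_at (Suc n) t x), path_map t (itinerary t x (Suc n)) y)"
  proof -
    have "path_map t (itinerary t x (Suc n)) y =
        step_map (level_at n t x) (level_at (Suc n) t x) (path_map t (itinerary t x n) y)"
      by (simp only: itinerary_snoc path_map_snoc last_itinerary)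
    then show ?thesis using lv[of n] F_step[OF regular_T[OF x]] by (simp add: level_at_Suc)
  qed
  moreover have "path_ok t (itinerary t x (Suc n))"
    using Suc arr charged_arrow[OF ch _ arr] lv[of "Suc n"] by (simp only: itinerary_snoc path_ok_snoc last_itinerary)
  ultimately show ?case using Suc by simp
qed

end

context charged_level
begin

abbreviation R_u :: "(((real ^ 'n) \<times> nat) \<times> real) set" where
  "R_u \<equiv> rug M \<alpha> D \<mu>h u"

abbreviation \<nu>_u :: "(((real ^ 'n) \<times> nat) \<times> real) measure" where
  "\<nu>_u \<equiv> normalized_restriction (rug_measure M \<alpha> D \<mu>h) R_u"

lemma mem_rug_iff: "((x, t), y) \<in> R_u \<longleftrightarrow> x \<in> D u \<and> t = u \<and> y \<in> {0..\<rho> u}"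
  by (auto simp: rug_def tower_level_def)

text \<open>
  The height never leaves the rug of the current level, so visits to the rug are visits to the level.
\<close>
lemma F_iterate_in_rug:
  assumes "regular x" "x \<in> D u" "y \<in> {0..\<rho> u}"
  shows "(F ^^ n) ((x, u), y) \<in> R_u \<longleftrightarrow> level_at n u x = u"
proof -
  have F: "(F ^^ n) ((x, u), y) = (((T ^^ n) x, level_at n u x), path_map u (itinerary u x n) y)"
    "path_ok u (itinerary u x n)"
    using F_iterate[OF assms(1) u_charged assms(2)] by auto
  have "path_map u (itinerary u x n) y \<in> {0..\<rho> (level_at n u x)}"
    using path_map_range(2)[OF u_charged F(2) assms(3)] by (simp only: last_itinerary)
  moreover have "(T ^^ n) x \<in> D (level_at n u x)" using regular_level_at[OF assms(1) u_\<alpha> assms(2)] by blast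
  ultimately show ?thesis by (auto simp: F(1) mem_rug_iff)
qed

text \<open>
  The induced map acts on the base by the return map and on the fibre by the affine contraction that belongs to the
  loop which is followed.
\<close>
lemma F_induced:
  assumes x: "returns x" and y: "y \<in> {0..\<rho> u}"
  shows "induced_map F R_u ((x, u), y) = ((return_map x, u), path_map u (return_word x) y)"
    and "\<exists>n\<ge>1. (F ^^ n) ((x, u), y) \<in> R_u"
proof -
  have rx: "regular x" "x \<in> D u" using x by (auto simp: returns_def)
  have hit: "(F ^^ n) ((x, u), y) \<in> R_u \<longleftrightarrow> level_at n u x = u" for n
    by (rule F_iterate_in_rug[OF rx y])
  show "\<exists>n\<ge>1. (F ^^ n) ((x, u), y) \<in> R_u"
    using return_index(1)[OF x] by (intro exI[of _ "Suc (return_index x)"]) (simp add: hit del: funpow.simps)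
  have "first_return_time F R_u ((x, u), y) = Suc (return_index x)"
    unfolding first_return_time_def hit
  proof (rule Least_equality)
    fix n assume n: "1 \<le> n \<and> level_at n u x = u"
    then obtain m where m: "n = Suc m" by (cases n) auto
    show "Suc (return_index x) \<le> n"
      using return_index(2)[OF x, of m] n m by (cases "m < return_index x") auto
  qed (use return_index(1)[OF x] in simp)
  then show "induced_map F R_u ((x, u), y) = ((return_map x, u), path_map u (return_word x) y)"
    using F_iterate[OF rx(1) u_charged rx(2), of "Suc (return_index x)" y] return_index(1)[OF x]
    by (simp add: induced_map_def return_map_def return_word_def del: funpow.simps)
qed

section \<open>The measure on a rug\<close>

abbreviation RM :: "(((real ^ 'n) \<times> nat) \<times> real) measure" where
  "RM \<equiv> rug_measure M \<alpha> D \<mu>h"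

abbreviation RS :: "(((real ^ 'n) \<times> nat) \<times> real) set" where
  "RS \<equiv> rug_space M \<alpha> D \<mu>h"

lemma rug_borel: "t \<in> \<alpha> \<Longrightarrow> rug M \<alpha> D \<mu>h t \<in> sets borel"
  unfolding rug_def tower_level_def by (intro borel_closed closed_Times D_closed) simp_all

lemma RS_borel: "RS \<in> sets borel"
  unfolding rug_space_def using charged_subset by (intro sets.countable_UN' image_subsetI rug_borel) auto

lemma R_u_subset: "R_u \<subseteq> RS"
  using u_charged by (auto simp: rug_space_def)

lemma sets_RM: "sets RM = sets (restrict_space borel RS)" and space_RM: "space RM = RS"
proof -
  have sp: "space (restrict_space borel RS) = RS" by (simp add: space_restrict_space)
  have "sets (restrict_space borel RS) \<subseteq> Pow RS" using sets.space_closed[of "restrict_space borel RS"] sp by simp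
  then show "sets RM = sets (restrict_space borel RS)" "space RM = RS"
    unfolding rug_measure_def using sets.sigma_sets_eq[of "restrict_space borel RS"] sp by simp_all
qed

text \<open>
  The \<open>\<sigma>\<close>-algebra of the rugs is the Borel one, whereas the measure is the restriction of a product measure;
  this makes sense because Borel sets of \<open>X\<close> are measurable.
\<close>
lemma borel_in_product:
  assumes B: "B \<in> sets borel" "B \<subseteq> RS"
  shows "B \<in> sets (TM \<Otimes>\<^sub>M lborel)"
proof -
  have "fst \<in> TM \<rightarrow>\<^sub>M borel"
  proof (rule measurableI)
    fix A :: "(real ^ 'n) set" assume A: "A \<in> sets borel"
    show "fst -` A \<inter> space TM \<in> sets TM"
    proof (rule sets_TM_I)
      fix t assume t: "t \<in> \<alpha>"
      have "slice (fst -` A \<inter> space TM) t = D t \<inter> A"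
        using t by (auto simp: slice_def tower_space_def tower_level_def)
      also have "\<dots> \<in> sets M"
        using D_closed[OF t] D_subset[OF t] A by (intro borel_subset_in_sets) auto
      finally show "slice (fst -` A \<inter> space TM) t \<in> sets M" .
    qed simp
  qed simp
  moreover have "snd \<in> TM \<rightarrow>\<^sub>M (borel :: nat measure)"
  proof (rule measurableI)
    fix A :: "nat set"
    show "snd -` A \<inter> space TM \<in> sets TM"
    proof (rule sets_TM_I)
      fix t assume t: "t \<in> \<alpha>"
      have "slice (snd -` A \<inter> space TM) t = (if t \<in> A then D t else {})"
        using t by (auto simp: slice_def tower_space_def tower_level_def)
      then show "slice (snd -` A \<inter> space TM) t \<in> sets M" using D_sets[OF t] by simp
    qed simp
  qed simp
  ultimately have "(\<lambda>z. (fst z, snd z)) \<in> TM \<rightarrow>\<^sub>M borel \<Otimes>\<^sub>M borel" by (rule measurable_Pair)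
  then have id1: "(\<lambda>z. z) \<in> TM \<rightarrow>\<^sub>M borel" by (simp add: borel_prod)
  have "(\<lambda>z. (fst z, snd z)) \<in> TM \<Otimes>\<^sub>M lborel \<rightarrow>\<^sub>M borel \<Otimes>\<^sub>M borel"
    by (intro measurable_Pair measurable_compose[OF measurable_fst id1]) simp
  then have "(\<lambda>z. z) \<in> TM \<Otimes>\<^sub>M lborel \<rightarrow>\<^sub>M borel" by (simp add: borel_prod)
  from measurable_sets[OF this B(1)] have "B \<inter> space (TM \<Otimes>\<^sub>M lborel) \<in> sets (TM \<Otimes>\<^sub>M lborel)" by simp
  moreover have "RS \<subseteq> space (TM \<Otimes>\<^sub>M lborel)"
    using charged_subset by (auto simp: space_pair_measure rug_space_def rug_def tower_space_def)
  ultimately show ?thesis using B(2) by (simp add: Int_absorb2)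
qed

lemma emeasure_RM:
  assumes "B \<in> sets borel" "B \<subseteq> RS"
  shows "emeasure RM B = emeasure (TM \<Otimes>\<^sub>M lborel) B"
proof (rule emeasure_measure_of[OF rug_measure_def])
  have mem: "A \<in> sets RM \<longleftrightarrow> A \<in> sets borel \<and> A \<subseteq> RS" for A
    using RS_borel by (simp add: sets_RM sets_restrict_space_iff conj_commute)
  show "sets (restrict_space borel RS) \<subseteq> Pow RS"
    using sets.space_closed[of "restrict_space borel RS"] by (simp add: space_restrict_space)
  show "B \<in> sets RM" using assms by (simp add: mem)
  show "positive (sets RM) (emeasure (TM \<Otimes>\<^sub>M lborel))" by (simp add: positive_def)
  show "countably_additive (sets RM) (emeasure (TM \<Otimes>\<^sub>M lborel))"
  proof (rule countably_additiveI)
    fix A :: "nat \<Rightarrow> _" assume A: "range A \<subseteq> sets RM" "disjoint_family A"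
    have "range A \<subseteq> sets (TM \<Otimes>\<^sub>M lborel)"
    proof (rule image_subsetI)
      fix i have "A i \<in> sets RM" using A(1) by auto
      then show "A i \<in> sets (TM \<Otimes>\<^sub>M lborel)" unfolding mem by (intro borel_in_product) auto
    qed
    from suminf_emeasure[OF this A(2)]
    show "(\<Sum>i. emeasure (TM \<Otimes>\<^sub>M lborel) (A i)) = emeasure (TM \<Otimes>\<^sub>M lborel) (\<Union>i. A i)" .
  qed
qed

text \<open>
  A rectangle with base \<open>E\<close> and fibre \<open>G\<close>, cut off at the boundary of the rug over \<open>u\<close>.
\<close>
definition block :: "(real ^ 'n) set \<Rightarrow> real set \<Rightarrow> (((real ^ 'n) \<times> nat) \<times> real) set" where
  "block E G = ((E \<inter> D u) \<times> {u}) \<times> (G \<inter> {0..\<rho> u})"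

lemma block_borel: "E \<in> sets borel \<Longrightarrow> G \<in> sets borel \<Longrightarrow> block E G \<in> sets borel"
proof -
  assume EG: "E \<in> sets borel" "G \<in> sets borel"
  have "E \<inter> D u \<in> sets borel" "G \<inter> {0..\<rho> u} \<in> sets borel"
    using EG D_closed[OF u_\<alpha>] by auto
  then have "((E \<inter> D u) \<times> {u}) \<times> (G \<inter> {0..\<rho> u}) \<in> sets ((borel \<Otimes>\<^sub>M borel) \<Otimes>\<^sub>M borel)"
    by (intro pair_measureI) auto
  then show ?thesis by (simp only: block_def borel_prod)
qed

lemma block_subset: "block E G \<subseteq> R_u"
  by (auto simp: block_def mem_rug_iff)

lemma R_u_eq_block: "R_u = block UNIV UNIV"
  by (auto simp: block_def rug_def tower_level_def)

lemma emeasure_RM_block: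
  assumes E: "E \<in> sets borel" and G: "G \<in> sets borel"
  shows "emeasure RM (block E G) = emeasure M (E \<inter> D u) * emeasure lborel (G \<inter> {0..\<rho> u})"
proof -
  have ED: "E \<inter> D u \<in> sets M"
    using E D_closed[OF u_\<alpha>] D_subset[OF u_\<alpha>] by (intro borel_subset_in_sets) auto
  have sl: "slice ((E \<inter> D u) \<times> {u}) t = (if t = u then E \<inter> D u else {})" for t
    by (auto simp: slice_def)
  have S: "(E \<inter> D u) \<times> {u} \<in> sets TM"
    using u_\<alpha> ED by (intro sets_TM_I) (auto simp: tower_space_def tower_level_def sl)
  have "emeasure RM (block E G) = emeasure (TM \<Otimes>\<^sub>M lborel) (block E G)"
    using block_borel[OF E G] block_subset R_u_subset by (intro emeasure_RM) auto
  also have "\<dots> = emeasure TM ((E \<inter> D u) \<times> {u}) * emeasure lborel (G \<inter> {0..\<rho> u})"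
    unfolding block_def using S G by (intro lborel.emeasure_pair_measure_Times) auto
  also have "emeasure TM ((E \<inter> D u) \<times> {u}) = emeasure M (E \<inter> D u)"
    using S by (subst emeasure_TM_level[OF u_\<alpha>]) (auto simp: sl tower_level_def)
  finally show ?thesis .
qed

lemma R_u_sets: "R_u \<inter> space RM \<in> sets RM"
  using R_u_subset rug_borel[OF u_\<alpha>] RS_borel
  by (simp add: space_RM sets_RM Int_absorb2 sets_restrict_space_iff)

lemma space_\<nu>_u: "space \<nu>_u = R_u"
proof -
  have "space \<nu>_u = space (restrict_space RM R_u)"
    unfolding normalized_restriction_def by (rule sets_eq_imp_space_eq) simp
  then show ?thesis using R_u_subset by (simp add: space_restrict_space space_RM Int_absorb2)
qed

lemma sets_\<nu>_u: "sets \<nu>_u = sets (restrict_space borel R_u)"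
  using R_u_subset
  by (simp add: normalized_restriction_def sets_restrict_restrict_space Int_absorb1 sets_restrict_space_cong[OF sets_RM])

lemma sets_\<nu>_u_iff: "A \<in> sets \<nu>_u \<longleftrightarrow> A \<in> sets borel \<and> A \<subseteq> R_u"
  using rug_borel[OF u_\<alpha>] by (simp add: sets_\<nu>_u sets_restrict_space_iff conj_commute)

text \<open>
  The normalized measure on a rug is the product of the uniform distributions on base and fibre.  The fibre of
  the rug is closed while \<open>fibre_measure\<close> lives on the half-open interval; the end point is a null set.
\<close>
lemma emeasure_\<nu>_u_block:
  assumes E: "E \<in> sets borel" and G: "G \<in> sets borel"
  shows "emeasure \<nu>_u (block E G) = emeasure base_measure (E \<inter> X) * emeasure tiling.fibre_measure G"
proof -
  have X: "X \<in> sets borel" using compact_imp_closed[OF compact_X] by simp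
  have EX: "E \<inter> X \<in> sets M" using E X by (intro borel_subset_in_sets) auto
  have DX: "D u \<inter> (E \<inter> X) = E \<inter> D u" using D_subset[OF u_\<alpha>] by auto
  have fib: "emeasure lborel (G \<inter> {0..\<rho> u}) = emeasure lborel ({0..<\<rho> u} \<inter> G)"
  proof (rule emeasure_eq_AE)
    have "AE y in lborel. y \<noteq> \<rho> u" by (rule AE_lborel_singleton)
    then show "AE y in lborel. y \<in> G \<inter> {0..\<rho> u} \<longleftrightarrow> y \<in> {0..<\<rho> u} \<inter> G" by eventually_elim auto
  qed (use G in auto)
  have tot: "emeasure RM R_u = emeasure M (D u) * ennreal (\<rho> u)"
    unfolding R_u_eq_block by (subst emeasure_RM_block) (use \<rho>_u_pos in auto)
  have "emeasure \<nu>_u (block E G) = 1 / emeasure RM R_u * emeasure RM (block E G)"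
    unfolding normalized_restriction_def using R_u_sets block_subset by (simp add: emeasure_restrict_space)
  also have "\<dots> = (emeasure M (E \<inter> D u) / emeasure M (D u)) * (emeasure lborel ({0..<\<rho> u} \<inter> G) / ennreal (\<rho> u))"
    unfolding tot emeasure_RM_block[OF E G] fib divide_ennreal_def
    by (subst ennreal_inverse_mult) (auto simp: emeasure_eq_measure mult_ac)
  also have "\<dots> = emeasure base_measure (E \<inter> X) * emeasure tiling.fibre_measure G"
    using EX G D_sets[OF u_\<alpha>] \<rho>_u_pos by (simp add: DX)
  finally show ?thesis .
qed

lemma prob_space_\<nu>_u: "prob_space \<nu>_u"
proof
  have "emeasure \<nu>_u (space \<nu>_u) = emeasure \<nu>_u (block UNIV UNIV)"
    by (simp only: space_\<nu>_u R_u_eq_block[symmetric])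
  also have "\<dots> = emeasure base_measure (UNIV \<inter> X) * emeasure tiling.fibre_measure UNIV"
    by (rule emeasure_\<nu>_u_block) auto
  also have "\<dots> = 1"
    using prob_space.emeasure_space_1[OF prob_space_base] prob_space.emeasure_space_1[OF tiling.prob_space_fibre]
    by (simp add: space_M)
  finally show "emeasure \<nu>_u (space \<nu>_u) = 1" .
qed

text \<open>
  The base carries Lebesgue measurable sets, the rug only Borel sets; null sets can be transferred because each of
  them lies in a Borel null set.
\<close>
lemma null_borel_superset:
  assumes "E \<in> null_sets M" obtains C where "C \<in> sets borel" "C \<subseteq> X" "E \<subseteq> C" "emeasure M C = 0"
proof -
  have X: "X \<in> sets borel" using compact_imp_closed[OF compact_X] by simp
  obtain B C where BC: "B \<in> sets (restrict_space borel X)" "C \<in> sets (restrict_space borel X)"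
    "B \<subseteq> E" "E \<subseteq> C" "emeasure M (C - B) = 0"
    using lebesgue null_setsD2[OF assms] unfolding lebesgue_prob_on_def by blast
  have b: "B \<in> sets borel" "C \<in> sets borel" "B \<subseteq> X" "C \<subseteq> X"
    using BC(1,2) X by (auto simp: sets_restrict_space_iff)
  have sM: "B \<in> sets M" "C \<in> sets M" using b by (auto intro: borel_subset_in_sets)
  have "emeasure M B \<le> emeasure M E" using BC assms by (intro emeasure_mono) auto
  then have "emeasure M B = 0" using null_setsD1[OF assms] by simp
  moreover have "emeasure M C \<le> emeasure M B + emeasure M (C - B)"
    using BC sM by (subst emeasure_Un'[symmetric]) (auto simp: Un_absorb1)
  ultimately have "emeasure M C = 0" using BC by simp
  then show ?thesis using that b BC by blast
qed

lemma AE_\<nu>_u: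
  assumes P: "AE x in base_measure. P x" and Q: "AE y in tiling.fibre_measure. Q y"
  shows "AE z in \<nu>_u. P (fst (fst z)) \<and> Q (snd z)"
proof -
  from P have "AE x in M. x \<in> D u \<longrightarrow> P x" by (simp add: AE_base)
  then obtain E where E: "E \<in> null_sets M" "\<And>x. x \<in> space M - E \<Longrightarrow> x \<in> D u \<longrightarrow> P x" by (rule AE_E3) blast
  obtain C where C: "C \<in> sets borel" "C \<subseteq> X" "E \<subseteq> C" "emeasure M C = 0" using null_borel_superset[OF E(1)] .
  from Q obtain G where G: "G \<in> null_sets tiling.fibre_measure" "\<And>y. y \<in> space tiling.fibre_measure - G \<Longrightarrow> Q y"
    by (rule AE_E3) blast
  have Gb: "G \<in> sets borel" using null_setsD2[OF G(1)] by simp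
  have CM: "C \<in> sets M" using C by (intro borel_subset_in_sets)
  have "emeasure M (D u \<inter> C) \<le> emeasure M C" by (intro emeasure_mono CM) auto
  then have "emeasure base_measure (C \<inter> X) = 0" using C CM D_sets[OF u_\<alpha>] by (simp add: Int_absorb2)
  then have "block C UNIV \<in> null_sets \<nu>_u" "block UNIV G \<in> null_sets \<nu>_u"
    using emeasure_\<nu>_u_block[of C UNIV] emeasure_\<nu>_u_block[of UNIV G] C Gb null_setsD1[OF G(1)]
    by (auto intro!: null_setsI simp: sets_\<nu>_u_iff block_borel dest: subsetD[OF block_subset] simp del: emeasure_uniform_measure)
  then have "AE z in \<nu>_u. z \<notin> block C UNIV" "AE z in \<nu>_u. z \<notin> block UNIV G" by (auto intro: AE_not_in)
  then show ?thesis
    using AE_space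
  proof eventually_elim
    case (elim z)
    obtain x t y where z: "z = ((x, t), y)" by (metis surj_pair)
    have "x \<in> D u" "t = u" "y \<in> {0..\<rho> u}" using elim(3) by (auto simp: space_\<nu>_u z mem_rug_iff)
    then have "x \<notin> C" "y \<notin> G" using elim(1,2) by (auto simp: z block_def)
    then show ?case
      using E(2)[of x] G(2)[of y] C(3) \<open>x \<in> D u\<close> D_subset[OF u_\<alpha>] by (auto simp: z space_M)
  qed
qed

end

section \<open>The return code determines the base point\<close>

abbreviation sequences :: "(nat \<Rightarrow> nat) measure" where
  "sequences \<equiv> \<Pi>\<^sub>M i\<in>UNIV. count_space UNIV"

lemma space_sequences [simp]: "space sequences = UNIV"
  by (simp add: space_PiM PiE_UNIV_domain)

lemma measurable_into_sequences:
  assumes "\<And>i. (\<lambda>x. f x i) \<in> M \<rightarrow>\<^sub>M count_space UNIV"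
  shows "f \<in> M \<rightarrow>\<^sub>M sequences"
  by (rule measurable_PiM_single') (use assms in \<open>auto simp: space_PiM PiE_UNIV_domain\<close>)

text \<open>
  Conditions on finitely many letters define measurable sets of sequences.
\<close>
lemma measurable_sequence_prefix:
  "(\<lambda>\<omega>. map \<omega> [0..<m]) \<in> sequences \<rightarrow>\<^sub>M count_space UNIV"
proof (induction m)
  case (Suc m)
  have "(\<lambda>\<omega>. (\<lambda>w \<omega>. w @ [\<omega> m]) (map \<omega> [0..<m]) \<omega>) \<in> sequences \<rightarrow>\<^sub>M count_space UNIV"
  proof (rule measurable_compose_countable[OF _ Suc])
    fix w
    have "(\<lambda>\<omega>. \<omega> m) \<in> sequences \<rightarrow>\<^sub>M count_space UNIV" by (rule measurable_component_singleton) simp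
    from measurable_compose[OF this, of "\<lambda>a. w @ [a]"]
    show "(\<lambda>\<omega>. w @ [\<omega> m]) \<in> sequences \<rightarrow>\<^sub>M count_space UNIV" by simp
  qed
  then show ?case by simp
qed simp

text \<open>
  The code of a point is measurable for the Lebesgue \<open>\<sigma>\<close>-algebra only, but the isomorphism has to be Borel
  measurable on the rug.  The sets on which the letter is constant are replaced by Borel subsets of full measure.
\<close>
lemma (in tower_system) borel_version:
  fixes c :: "real ^ 'n \<Rightarrow> nat"
  assumes c: "c \<in> M \<rightarrow>\<^sub>M count_space UNIV"
  shows "\<exists>h\<in>borel \<rightarrow>\<^sub>M count_space UNIV. AE x in M. h x = c x"
proof -
  have X: "X \<in> sets borel" using compact_imp_closed[OF compact_X] by simp
  have "\<exists>B C. B \<in> sets (restrict_space borel X) \<and> C \<in> sets (restrict_space borel X) \<and>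
      B \<subseteq> c -` {k} \<inter> space M \<and> c -` {k} \<inter> space M \<subseteq> C \<and> emeasure M (C - B) = 0" for k
  proof -
    have "c -` {k} \<inter> space M \<in> sets M" by (rule measurable_sets[OF c]) simp
    from bspec[OF lebesgue[unfolded lebesgue_prob_on_def, THEN conjunct2, THEN conjunct2, THEN conjunct2] this]
    show ?thesis by (simp only: Bex_def) iprover
  qed
  then obtain B C where BC: "\<And>k. B k \<in> sets (restrict_space borel X)" "\<And>k. C k \<in> sets (restrict_space borel X)"
    "\<And>k. B k \<subseteq> c -` {k} \<inter> space M" "\<And>k. c -` {k} \<inter> space M \<subseteq> C k" "\<And>k. emeasure M (C k - B k) = 0"
    by metis
  have b: "B k \<in> sets borel" "C k \<in> sets borel" "B k \<subseteq> X" "C k \<subseteq> X" for k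
    using BC(1,2)[of k] X by (auto simp: sets_restrict_space_iff)
  let ?h = "\<lambda>x. LEAST k. x \<in> B k"
  have "?h \<in> borel \<rightarrow>\<^sub>M count_space UNIV"
    by (rule measurable_Least) (use b in \<open>simp add: pred_def\<close>)
  moreover have "AE x in M. ?h x = c x"
  proof -
    have "C k - B k \<in> null_sets M" for k
      using BC(5)[of k] b[of k] by (intro null_setsI sets.Diff borel_subset_in_sets)
    then have "AE x in M. x \<notin> C k - B k" for k by (rule AE_not_in)
    then have "AE x in M. \<forall>k. x \<notin> C k - B k" by (intro AE_all_countable[THEN iffD2] allI)
    then show ?thesis using AE_space
    proof eventually_elim
      case (elim x)
      have "x \<in> c -` {c x} \<inter> space M" using elim(2) by simp
      then have "x \<in> C (c x)" using BC(4) by (rule subsetD[rotated])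
      then have "x \<in> B (c x)" using elim(1)[rule_format, of "c x"] by simp
      then show ?case
      proof (rule Least_equality)
        fix k assume "x \<in> B k"
        then have "c x = k" using subsetD[OF BC(3)] by simp
        then show "c x \<le> k" by simp
      qed
    qed
  qed
  ultimately show ?thesis by (intro bexI[of _ ?h])
qed

context charged_level
begin

definition base_code :: "real ^ 'n \<Rightarrow> nat \<Rightarrow> nat" where
  "base_code x i = letter ((return_map ^^ i) x)"

lemma base_code_component_measurable: "(\<lambda>x. base_code x i) \<in> base_measure \<rightarrow>\<^sub>M count_space UNIV"
  unfolding base_code_def
  by (rule measurable_compose[OF measurable_compose_n[OF return_map_base_measurable] letter_measurable])

lemma base_code_measurable: "base_code \<in> base_measure \<rightarrow>\<^sub>M sequences"
  by (rule measurable_into_sequences) (rule base_code_component_measurable)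

lemma base_invariant: "distr base_measure base_measure return_map = base_measure"
  by (rule law_invariant[OF letter_measurable return_map_base_measurable base_law])

lemma AE_base_orbit: "AE x in base_measure. P x \<Longrightarrow> AE x in base_measure. \<forall>i. P ((return_map ^^ i) x)"
  by (rule AE_orbit[OF return_map_base_measurable base_invariant])

lemma AE_always_returns: "AE x in base_measure. \<forall>i. returns ((return_map ^^ i) x)"
  by (rule AE_base_orbit) (use AE_returns in \<open>simp only: AE_base\<close>)

text \<open>
  The path that is obtained by following the loops with the given numbers one after the other.
\<close>
definition decoded_path :: "nat list \<Rightarrow> nat list" where
  "decoded_path as = u # concat (map list_decode as)"

text \<open>
  Up to the time of the \<open>m\<close>-th return the levels which an orbit visits can be read off the first \<open>m\<close> loops.
\<close>
lemma level_at_decoded: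
  assumes "\<And>i. returns ((return_map ^^ i) x)"
    and "n \<le> length (concat (map list_decode (map (base_code x) [0..<m])))"
  shows "level_at n u x = decoded_path (map (base_code x) [0..<m]) ! n"
  using assms
proof (induction m arbitrary: x n)
  case 0
  then show ?case by (simp add: decoded_path_def)
next
  case (Suc m)
  let ?y = "return_map x" and ?r = "Suc (return_index x)"
  have x: "returns x" using Suc.prems(1)[of 0] by simp
  have y: "returns ((return_map ^^ i) ?y)" for i using Suc.prems(1)[of "Suc i"] by (simp add: funpow_swap1)
  have code: "base_code x (Suc i) = base_code ?y i" for i by (simp add: base_code_def funpow_swap1)
  have split: "concat (map list_decode (map (base_code x) [0..<Suc m])) =
      return_word x @ concat (map list_decode (map (base_code ?y) [0..<m]))"
  proof -
    have "map (base_code x) [0..<Suc m] = base_code x 0 # map (base_code ?y) [0..<m]"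
      by (simp add: upt_conv_Cons map_Suc_upt[symmetric] code comp_def del: upt_Suc map_Suc_upt)
    then show ?thesis by (simp add: base_code_def)
  qed
  have len: "length (return_word x) = ?r" by (simp add: return_word_def)
  show ?case
  proof (cases "n \<le> ?r")
    case True
    have "(u # return_word x) ! n = level_at n u x"
      using True by (cases n) (auto simp: return_word_def itinerary_def simp del: upt_Suc)
    moreover have "(u # return_word x @ w) ! n = (u # return_word x) ! n" for w
      using True len by (cases n) (auto simp: nth_append)
    ultimately show ?thesis by (simp only: decoded_path_def split)
  next
    case False
    then obtain n' where n': "n = ?r + n'" "n' > 0" by (metis add_diff_inverse_nat less_imp_le not_le zero_less_diff nat_less_le)
    have "level_at n u x = level_at n' (level_at ?r u x) ((T ^^ ?r) x)" unfolding n'(1) by (rule level_at_add)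
    also have "\<dots> = level_at n' u ?y" using return_index(1)[OF x] by (simp only: return_map_def)
    also have "\<dots> = decoded_path (map (base_code ?y) [0..<m]) ! n'"
    proof (rule Suc.IH[OF y])
      show "n' \<le> length (concat (map list_decode (map (base_code ?y) [0..<m])))"
        using Suc.prems(2) unfolding split length_append len n'(1) by simp
    qed
    also have "\<dots> = decoded_path (map (base_code x) [0..<Suc m]) ! n"
      unfolding decoded_path_def split n'(1) using n'(2) len by (cases n') (simp_all add: nth_append)
    finally show ?thesis .
  qed
qed

text \<open>
  Loops are nonempty, so \<open>n\<close> loops determine the levels up to time \<open>n\<close> at least.
\<close>
lemma length_decoded:
  assumes "\<And>i. returns ((return_map ^^ i) x)"
  shows "m \<le> length (concat (map list_decode (map (base_code x) [0..<m])))"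
proof (induction m)
  case (Suc m)
  have "list_decode (base_code x m) \<noteq> []"
    using return_word_loop[OF assms[of m]] by (simp add: base_code_def loop_def)
  then have "1 \<le> length (list_decode (base_code x m))" by (cases "list_decode (base_code x m)") auto
  then show ?case using Suc by simp
qed simp

text \<open>
  Each level lies in a single set \<open>Z k\<close>.  So the code of a point determines its itinerary with respect to the
  partition.
\<close>
lemma cell_itinerary_decoded:
  assumes ret: "\<And>i. returns ((return_map ^^ i) x)" and j: "j \<in> {1..N}"
  shows "(T ^^ n) x \<in> Z j \<longleftrightarrow> j = level_cell (decoded_path (map (base_code x) [0..<n]) ! n)"
proof -
  have x: "regular x" "x \<in> D u" using ret[of 0] by (auto simp: returns_def)
  have lv: "level_at n u x = decoded_path (map (base_code x) [0..<n]) ! n"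
    by (rule level_at_decoded[OF ret length_decoded[OF ret]])
  have D: "level_at n u x \<in> \<alpha>" "(T ^^ n) x \<in> D (level_at n u x)" using regular_level_at[OF x(1) u_\<alpha> x(2)] by auto
  have "\<exists>!j. j \<in> {1..N} \<and> (T ^^ n) x \<in> Z j" using x(1) unfolding regular_def step_ok_def by blast
  then show ?thesis using level_cell[OF D(1)] D(2) j lv by auto
qed

end

locale generated_charged_level = charged_level X M T N Z s \<alpha> D \<mu>h u
  for X :: "(real ^ 'n) set" and M T N Z s \<alpha> D \<mu>h u +
  assumes generating: "generating_mod_null M N Z T"
    and nonatomic: "\<And>x. x \<in> X \<Longrightarrow> emeasure M {x} = 0"
begin

text \<open>
  By \<open>cell_itinerary_decoded\<close> cylinders are preimages of measurable sets under the code, hence so are all sets of the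
  \<open>\<sigma>\<close>-algebra that they generate.  Up to null sets this is the full \<open>\<sigma>\<close>-algebra.
\<close>
lemma code_generates:
  assumes A: "A \<in> sets base_measure"
  shows "\<exists>C\<in>sets sequences. AE x in base_measure. x \<in> A \<longleftrightarrow> base_code x \<in> C"
proof -
  have "A \<in> sets M" using A by simp
  then obtain A' where A': "A' \<in> sigma_sets (space M) (\<Union>n. cylinder M T Z ` cylinder_words M N Z T n)"
    "eq_mod_null M A A'" using generating unfolding generating_mod_null_def by blast
  have "\<exists>C\<in>sets sequences. AE x in base_measure. x \<in> A' \<longleftrightarrow> base_code x \<in> C"
    using A'(1)
  proof induction
    case (Basic a)
    then obtain n js where js: "js \<in> cylinder_words M N Z T n" "a = cylinder M T Z js" by auto
    let ?C = "{\<omega>\<in>space sequences. \<forall>i\<in>{..<length js}. js ! i = level_cell (decoded_path (map \<omega> [0..<i]) ! i)}"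
    have "?C \<in> sets sequences"
    proof (rule sets.sets_Collect_finite_All)
      fix i
      have "(\<lambda>\<omega>. map \<omega> [0..<i]) -` {w. js ! i = level_cell (decoded_path w ! i)} \<inter> space sequences \<in> sets sequences"
        by (rule measurable_sets[OF measurable_sequence_prefix]) simp
      then show "{\<omega>\<in>space sequences. js ! i = level_cell (decoded_path (map \<omega> [0..<i]) ! i)} \<in> sets sequences"
        by (simp add: vimage_def)
    qed simp
    moreover have "AE x in base_measure. x \<in> a \<longleftrightarrow> base_code x \<in> ?C"
      using AE_always_returns AE_space
    proof eventually_elim
      case (elim x)
      have "(T ^^ i) x \<in> Z (js ! i) \<longleftrightarrow> js ! i = level_cell (decoded_path (map (base_code x) [0..<i]) ! i)"
        if "i < length js" for i
      proof (rule cell_itinerary_decoded)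
        show "js ! i \<in> {1..N}" using js(1) nth_mem[OF that] unfolding cylinder_words_def by blast
      qed (use elim in blast)
      then show ?case using elim(2) by (auto simp: js(2) cylinder_def)
    qed
    ultimately show ?case by blast
  next
    case Empty
    show ?case by (intro bexI[of _ "{}"]) simp_all
  next
    case (Compl a)
    then obtain C where C: "C \<in> sets sequences" "AE x in base_measure. x \<in> a \<longleftrightarrow> base_code x \<in> C" by blast
    from C(2) AE_space have "AE x in base_measure. x \<in> space M - a \<longleftrightarrow> base_code x \<in> space sequences - C"
      by eventually_elim simp
    then show ?case using sets.compl_sets[OF C(1)] by blast
  next
    case (Union a)
    then have "\<exists>C. \<forall>i. C i \<in> sets sequences \<and> (AE x in base_measure. x \<in> a i \<longleftrightarrow> base_code x \<in> C i)"
      by (intro choice) blast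
    then obtain C where C: "\<And>i. C i \<in> sets sequences" "\<And>i. AE x in base_measure. x \<in> a i \<longleftrightarrow> base_code x \<in> C i"
      by blast
    have "AE x in base_measure. \<forall>i. x \<in> a i \<longleftrightarrow> base_code x \<in> C i"
      using C(2) by (intro AE_all_countable[THEN iffD2] allI)
    then have "AE x in base_measure. x \<in> (\<Union>i. a i) \<longleftrightarrow> base_code x \<in> (\<Union>i. C i)"
      by eventually_elim simp
    moreover have "(\<Union>i. C i) \<in> sets sequences" using C(1) by (intro sets.countable_UN) blast
    ultimately show ?case by blast
  qed
  then obtain C where C: "C \<in> sets sequences" "AE x in base_measure. x \<in> A' \<longleftrightarrow> base_code x \<in> C" by blast
  have "AE x in M. x \<notin> sym_diff A A'" using A'(2) unfolding eq_mod_null_def by (rule AE_not_in)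
  then have "AE x in base_measure. x \<notin> sym_diff A A'"
    unfolding AE_base by eventually_elim simp
  with C(2) have "AE x in base_measure. x \<in> A \<longleftrightarrow> base_code x \<in> C"
    by eventually_elim blast
  with C(1) show ?thesis by blast
qed

lemma base_decoder:
  obtains g where "g \<in> sequences \<rightarrow>\<^sub>M borel" "AE x in base_measure. g (base_code x) = x"
proof -
  have "(\<lambda>x. x) \<in> base_measure \<rightarrow>\<^sub>M borel"
  proof (rule measurableI)
    fix A :: "(real ^ 'n) set" assume "A \<in> sets borel"
    then have "A \<inter> X \<in> sets M" using compact_imp_closed[OF compact_X] by (intro borel_subset_in_sets) auto
    then show "(\<lambda>x. x) -` A \<inter> space base_measure \<in> sets base_measure" by (simp add: space_M)
  qed simp
  from factor_through_vec[OF base_code_measurable code_generates this]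
  obtain g where g: "g \<in> borel_measurable sequences" "AE x in base_measure. x = g (base_code x)" by blast
  from g(2) have "AE x in base_measure. g (base_code x) = x" by eventually_elim simp
  with g(1) show ?thesis using that by blast
qed

lemma letter_law: "emeasure base_measure {x\<in>space base_measure. letter x \<in> A} = emeasure (measure_pmf loop_pmf) A"
  using word_law[OF prob_space_base letter_measurable return_map_base_measurable base_law, of "Suc 0" "\<lambda>_. A"] by simp

lemma AE_letter:
  assumes "emeasure (measure_pmf loop_pmf) A = 1" shows "AE x in base_measure. letter x \<in> A"
proof -
  have "prob_space.prob base_measure {x\<in>space base_measure. letter x \<in> A} = 1"
    using letter_law[of A] assms by (simp add: measure_def)
  then have "AE x in base_measure. x \<in> {x\<in>space base_measure. letter x \<in> A}"
    by (rule prob_space.AE_prob_1[OF prob_space_base])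
  then show ?thesis by eventually_elim simp
qed

text \<open>
  If there were only one loop, all points of \<open>D u\<close> would have the same code.  As the code determines the
  point, \<open>M\<close> restricted to \<open>D u\<close> would be concentrated in one point.
\<close>
lemma pmf_less_1: "pmf loop_pmf a < 1"
proof (rule ccontr)
  assume "\<not> pmf loop_pmf a < 1"
  then have "pmf loop_pmf a = 1" using pmf_le_1[of loop_pmf a] by simp
  then have "emeasure (measure_pmf loop_pmf) {a} = 1" by (simp add: emeasure_pmf_single)
  from AE_base_orbit[OF AE_letter[OF this]]
  have const: "AE x in base_measure. base_code x = (\<lambda>_. a)"
    by eventually_elim (simp add: base_code_def fun_eq_iff)
  obtain g where g: "AE x in base_measure. g (base_code x) = x" using base_decoder .
  have "AE x in base_measure. x = g (\<lambda>_. a)" using const g by eventually_elim simp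
  then have "AE x in M. x \<in> D u \<longrightarrow> x = g (\<lambda>_. a)" by (simp only: AE_base)
  moreover have "AE x in M. x \<noteq> g (\<lambda>_. a)"
  proof (cases "g (\<lambda>_. a) \<in> X")
    case True
    have "{g (\<lambda>_. a)} \<in> sets M" using True by (intro borel_subset_in_sets) auto
    then have "{g (\<lambda>_. a)} \<in> null_sets M" using nonatomic[OF True] by (intro null_setsI)
    from AE_not_in[OF this] show ?thesis by eventually_elim simp
  next
    case False
    show ?thesis using AE_space by eventually_elim (use False in \<open>auto simp: space_M\<close>)
  qed
  ultimately have "AE x in M. x \<notin> D u" by eventually_elim blast
  then have "emeasure M (D u) = 0"
    using AE_iff_null_sets[OF D_sets[OF u_\<alpha>]] by (auto dest: null_setsD1)
  then show False using level_props(3)[OF u_\<alpha>] by simp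
qed

section \<open>The induced maps are Bernoulli\<close>

lemma AE_return_rug: "AE z in \<nu>_u. \<exists>n\<ge>1. (F ^^ n) z \<in> R_u"
proof -
  have ret: "AE x in base_measure. returns x" using AE_returns by (simp only: AE_base)
  have "AE z in \<nu>_u. returns (fst (fst z)) \<and> True" by (rule AE_\<nu>_u[OF ret]) simp
  then show ?thesis using AE_space
  proof eventually_elim
    case (elim z)
    obtain x t y where z: "z = ((x, t), y)" by (metis surj_pair)
    have "t = u" "y \<in> {0..\<rho> u}" using elim(2) unfolding space_\<nu>_u z mem_rug_iff by auto
    then show ?case using F_induced(2)[of x y] elim(1) by (simp add: z)
  qed
qed

text \<open>
  The letters with nonnegative index are the loops that the base point follows at its future returns.  Those with
  negative index are read off the fibre: the induced map puts the image into the tile of the loop it has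
  just followed, so the letter at \<open>- 1\<close> is the tile that contains the height, and the earlier letters are
  found by expanding.  Thus the letter that leaves the base code enters the fibre code, which is the shift.
\<close>
lemma is_bernoulli_rug: "is_bernoulli \<nu>_u (induced_map F R_u)"
  unfolding is_bernoulli_def
proof (rule exI[of _ loop_pmf])
  let ?B = "bernoulli_measure loop_pmf"
  obtain g where g: "g \<in> sequences \<rightarrow>\<^sub>M borel" "AE x in base_measure. g (base_code x) = x" by (rule base_decoder)
  have "\<exists>h. \<forall>i. h i \<in> borel \<rightarrow>\<^sub>M count_space UNIV \<and> (AE x in base_measure. h i x = base_code x i)"
  proof (rule choice, rule allI)
    fix i
    have "(\<lambda>x. base_code x i) \<in> M \<rightarrow>\<^sub>M count_space UNIV"
      using base_code_component_measurable[of i] by (simp cong: measurable_cong_sets)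
    from borel_version[OF this] obtain h where h: "h \<in> borel \<rightarrow>\<^sub>M count_space UNIV" "AE x in M. h x = base_code x i" by blast
    from h(2) have "AE x in base_measure. h x = base_code x i" unfolding AE_base by eventually_elim simp
    with h(1) show "\<exists>h. h \<in> borel \<rightarrow>\<^sub>M count_space UNIV \<and> (AE x in base_measure. h x = base_code x i)" by blast
  qed
  then obtain c where c: "\<And>i. c i \<in> borel \<rightarrow>\<^sub>M count_space UNIV" "\<And>i. AE x in base_measure. c i x = base_code x i"
    by blast
  have c_all: "AE x in base_measure. \<forall>i. c i x = base_code x i" using c(2) by (intro AE_all_countable[THEN iffD2] allI)
  define \<Phi> :: "((real ^ 'n) \<times> nat) \<times> real \<Rightarrow> int \<Rightarrow> nat" where
    "\<Phi> z i = (if 0 \<le> i then c (nat i) (fst (fst z)) else tiling.fibre_code (snd z) (nat (- 1 - i)))" for z i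
  define \<psi> :: "(int \<Rightarrow> nat) \<Rightarrow> ((real ^ 'n) \<times> nat) \<times> real" where
    "\<psi> \<omega> = ((g (\<lambda>i. \<omega> (int i)), u), tiling.fibre_point (\<lambda>i. \<omega> (- 1 - int i)))" for \<omega>
  \<comment> \<open>Off the image of the code the decoded point may lie outside the rug; there it is replaced by \<open>z0\<close>.\<close>
  obtain z0 where z0: "z0 \<in> R_u"
    using prob_space.not_empty[OF prob_space_\<nu>_u] by (auto simp: space_\<nu>_u)
  define \<Psi> where "\<Psi> \<omega> = (if \<psi> \<omega> \<in> R_u then \<psi> \<omega> else z0)" for \<omega>
  have fst_meas: "(\<lambda>z. fst (fst z)) \<in> \<nu>_u \<rightarrow>\<^sub>M borel" and snd_meas: "snd \<in> \<nu>_u \<rightarrow>\<^sub>M borel"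
  proof -
    have id: "(\<lambda>z. z) \<in> \<nu>_u \<rightarrow>\<^sub>M (borel :: (((real ^ 'n) \<times> nat) \<times> real) measure)"
    proof (rule measurableI)
      fix A :: "(((real ^ 'n) \<times> nat) \<times> real) set" assume "A \<in> sets borel"
      then show "(\<lambda>z. z) -` A \<inter> space \<nu>_u \<in> sets \<nu>_u"
        unfolding sets_\<nu>_u_iff space_\<nu>_u using rug_borel[OF u_\<alpha>] by auto
    qed simp
    have 1: "(fst :: ((real ^ 'n) \<times> nat) \<times> real \<Rightarrow> _) \<in> borel \<rightarrow>\<^sub>M borel"
      "(fst :: (real ^ 'n) \<times> nat \<Rightarrow> _) \<in> borel \<rightarrow>\<^sub>M borel"
      "(snd :: ((real ^ 'n) \<times> nat) \<times> real \<Rightarrow> _) \<in> borel \<rightarrow>\<^sub>M borel"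
      by (intro borel_measurable_continuous_onI continuous_intros)+
    show "(\<lambda>z. fst (fst z)) \<in> \<nu>_u \<rightarrow>\<^sub>M borel" "snd \<in> \<nu>_u \<rightarrow>\<^sub>M borel"
      using measurable_compose[OF measurable_compose[OF id 1(1)] 1(2)] measurable_compose[OF id 1(3)] by simp_all
  qed
  have \<Phi>_meas: "\<Phi> \<in> \<nu>_u \<rightarrow>\<^sub>M ?B"
  proof (rule measurable_into_bernoulli)
    fix i
    show "(\<lambda>z. \<Phi> z i) \<in> \<nu>_u \<rightarrow>\<^sub>M count_space UNIV"
    proof (cases "0 \<le> i")
      case True
      then show ?thesis using measurable_compose[OF fst_meas c(1)[of "nat i"]] by (simp add: \<Phi>_def)
    next
      case False
      have "(\<lambda>y. tiling.fibre_code y (nat (- 1 - i))) \<in> borel \<rightarrow>\<^sub>M count_space UNIV"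
        by (rule measurable_compose[OF measurable_compose_n[OF tiling.expand_measurable] tiling.tile_index_measurable])
      from measurable_compose[OF snd_meas this] show ?thesis using False by (simp add: \<Phi>_def)
    qed
  qed
  have \<psi>_meas: "\<psi> \<in> ?B \<rightarrow>\<^sub>M borel"
  proof -
    have "(\<lambda>\<omega> i. \<omega> (int i)) \<in> ?B \<rightarrow>\<^sub>M sequences"
      by (rule measurable_into_sequences) (rule measurable_bernoulli_component)
    from measurable_compose[OF this g(1)] have 1: "(\<lambda>\<omega>. g (\<lambda>i. \<omega> (int i))) \<in> ?B \<rightarrow>\<^sub>M borel" .
    have 2: "(\<lambda>\<omega>. tiling.fibre_point (\<lambda>i. \<omega> (- 1 - int i))) \<in> ?B \<rightarrow>\<^sub>M borel"
      by (rule tiling.fibre_point_measurable) (rule measurable_bernoulli_component)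
    have "\<psi> \<in> ?B \<rightarrow>\<^sub>M (borel \<Otimes>\<^sub>M borel) \<Otimes>\<^sub>M borel"
      unfolding \<psi>_def[abs_def] by (intro measurable_Pair 1 2 measurable_const) simp
    then show ?thesis by (simp only: borel_prod)
  qed
  have \<Psi>_meas: "\<Psi> \<in> ?B \<rightarrow>\<^sub>M \<nu>_u"
  proof (rule measurableI)
    show "\<Psi> \<omega> \<in> space \<nu>_u" for \<omega> using z0 by (simp add: \<Psi>_def space_\<nu>_u)
    fix A assume "A \<in> sets \<nu>_u"
    then have A: "A \<in> sets borel" "A \<subseteq> R_u" by (simp_all add: sets_\<nu>_u_iff)
    have "\<Psi> -` A \<inter> space ?B = (\<psi> -` A \<inter> space ?B) \<union> (if z0 \<in> A then space ?B - (\<psi> -` R_u \<inter> space ?B) else {})"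
    proof (intro set_eqI)
      fix \<omega>
      show "\<omega> \<in> \<Psi> -` A \<inter> space ?B \<longleftrightarrow>
          \<omega> \<in> (\<psi> -` A \<inter> space ?B) \<union> (if z0 \<in> A then space ?B - (\<psi> -` R_u \<inter> space ?B) else {})"
      proof (cases "\<psi> \<omega> \<in> R_u")
        case False
        then have "\<psi> \<omega> \<notin> A" using A(2) by (rule contra_subsetD[rotated])
        then show ?thesis using False by (simp add: \<Psi>_def)
      qed (simp add: \<Psi>_def)
    qed
    also have "\<dots> \<in> sets ?B"
      using measurable_sets[OF \<psi>_meas A(1)] measurable_sets[OF \<psi>_meas rug_borel[OF u_\<alpha>]]
      by (cases "z0 \<in> A") (simp_all only: if_True if_False Un_empty_right sets.Un sets.compl_sets)
    finally show "\<Psi> -` A \<inter> space ?B \<in> sets ?B" .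
  qed
  have law: "distr \<nu>_u ?B \<Phi> = ?B"
  proof (rule distr_eq_bernoulliI[OF prob_space_\<nu>_u \<Phi>_meas])
    fix n and A :: "int \<Rightarrow> nat set"
    let ?E = "{x\<in>space borel. \<forall>i\<in>{..<n}. c i x \<in> A (int i)}"
    let ?G = "{y\<in>space borel. \<forall>i\<in>{..<n}. tiling.fibre_code y i \<in> A (- 1 - int i)}"
    let ?p = "\<lambda>i. emeasure (measure_pmf loop_pmf) (A i)"
    have E: "?E \<in> sets borel"
    proof (rule sets.sets_Collect_finite_All)
      fix i show "{x\<in>space borel. c i x \<in> A (int i)} \<in> sets borel"
        using measurable_sets[OF c(1)[of i], of "A (int i)"] by (simp add: vimage_def)
    qed simp
    have G: "?G \<in> sets borel"
    proof (rule sets.sets_Collect_finite_All)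
      fix i
      have "(\<lambda>y. tiling.fibre_code y i) \<in> borel \<rightarrow>\<^sub>M count_space UNIV"
        by (rule measurable_compose[OF measurable_compose_n[OF tiling.expand_measurable] tiling.tile_index_measurable])
      from measurable_sets[OF this, of "A (- 1 - int i)"]
      show "{y\<in>space borel. tiling.fibre_code y i \<in> A (- 1 - int i)} \<in> sets borel" by (simp add: vimage_def)
    qed simp
    have ivl: "{- int n..<int n} = (\<lambda>i. int i) ` {..<n} \<union> (\<lambda>i. - 1 - int i) ` {..<n}"
    proof (intro set_eqI iffI)
      fix i assume i: "i \<in> {- int n..<int n}"
      show "i \<in> (\<lambda>i. int i) ` {..<n} \<union> (\<lambda>i. - 1 - int i) ` {..<n}"
      proof (cases "0 \<le> i")
        case True
        then show ?thesis using i by (intro UnI1 image_eqI[of _ _ "nat i"]) auto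
      next
        case False
        then show ?thesis using i by (intro UnI2 image_eqI[of _ _ "nat (- 1 - i)"]) auto
      qed
    qed auto
    have "{z\<in>space \<nu>_u. \<forall>i\<in>{- int n..<int n}. \<Phi> z i \<in> A i} = block ?E ?G"
      unfolding ivl space_\<nu>_u by (auto simp: block_def rug_def tower_level_def \<Phi>_def ball_Un)
    then have "emeasure \<nu>_u {z\<in>space \<nu>_u. \<forall>i\<in>{- int n..<int n}. \<Phi> z i \<in> A i} =
        emeasure base_measure (?E \<inter> X) * emeasure tiling.fibre_measure ?G"
      by (simp only: emeasure_\<nu>_u_block[OF E G])
    also have "emeasure base_measure (?E \<inter> X) =
        emeasure base_measure {x\<in>space base_measure. \<forall>i<n. letter ((return_map ^^ i) x) \<in> A (int i)}"
    proof (rule emeasure_eq_AE)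
      show "AE x in base_measure. x \<in> ?E \<inter> X \<longleftrightarrow>
          x \<in> {x\<in>space base_measure. \<forall>i<n. letter ((return_map ^^ i) x) \<in> A (int i)}"
        using c_all by eventually_elim (auto simp: base_code_def space_M)
      have "?E \<inter> X \<in> sets M" using E compact_imp_closed[OF compact_X] by (intro borel_subset_in_sets sets.Int) auto
      then show "?E \<inter> X \<in> sets base_measure" by simp
      have "{x\<in>space base_measure. \<forall>i\<in>{..<n}. letter ((return_map ^^ i) x) \<in> A (int i)} \<in> sets base_measure"
      proof (rule sets.sets_Collect_finite_All)
        fix i
        show "{x\<in>space base_measure. letter ((return_map ^^ i) x) \<in> A (int i)} \<in> sets base_measure"
          using measurable_sets[OF base_code_component_measurable[of i], of "A (int i)"]
          by (simp add: vimage_def base_code_def Int_def conj_commute)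
      qed simp
      then show "{x\<in>space base_measure. \<forall>i<n. letter ((return_map ^^ i) x) \<in> A (int i)} \<in> sets base_measure"
        unfolding Ball_def lessThan_iff .
    qed
    also have "\<dots> = (\<Prod>i<n. ?p (int i))"
      by (rule word_law[OF prob_space_base letter_measurable return_map_base_measurable base_law])
    also have "emeasure tiling.fibre_measure ?G = (\<Prod>i<n. ?p (- 1 - int i))"
      using word_law[OF tiling.prob_space_fibre tiling.expand_fibre_measurable(2,1) tiling.fibre_law, of n "\<lambda>i. A (- 1 - int i)"]
      by (simp only: Ball_def lessThan_iff space_uniform_measure space_lborel space_borel)
    also have "(\<Prod>i<n. ?p (int i)) * (\<Prod>i<n. ?p (- 1 - int i)) = (\<Prod>i\<in>{- int n..<int n}. ?p i)"
      unfolding ivl by (subst prod.union_disjoint) (auto simp: prod.reindex inj_on_def)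
    finally show "emeasure \<nu>_u {z\<in>space \<nu>_u. \<forall>i\<in>{- int n..<int n}. \<Phi> z i \<in> A i} = (\<Prod>i\<in>{- int n..<int n}. ?p i)" .
  qed
  have good: "AE x in base_measure. (\<forall>i. c i x = base_code x i) \<and> g (base_code x) = x \<and> returns x \<and>
      letter x \<in> set_pmf loop_pmf"
  proof -
    have "AE x in base_measure. letter x \<in> set_pmf loop_pmf"
      by (rule AE_letter) (simp add: measure_pmf.emeasure_eq_measure measure_measure_pmf_not_zero measure_pmf.prob_eq_1 AE_measure_pmf)
    then show ?thesis using c_all g(2) AE_always_returns
    proof eventually_elim
      case (elim x)
      have "returns x" using elim(4)[rule_format, of 0] by simp
      then show ?case using elim by blast
    qed
  qed
  have inv: "AE z in \<nu>_u. \<Psi> (\<Phi> z) = z \<and> \<Psi> (left_shift (\<Phi> z)) = induced_map F R_u z"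
    using AE_\<nu>_u[OF AE_base_orbit[OF good] tiling.AE_coded] AE_space
  proof eventually_elim
    case (elim z)
    obtain x t y where z: "z = ((x, t), y)" by (metis surj_pair)
    have xy: "x \<in> D u" "t = u" "y \<in> {0..\<rho> u}" using elim(2) unfolding space_\<nu>_u z mem_rug_iff by auto
    have y: "y \<in> tiling.coded" using elim(1) by (simp add: z)
    have x0: "\<And>i. c i x = base_code x i" "g (base_code x) = x" "returns x" "letter x \<in> set_pmf loop_pmf"
      using elim(1) by (auto simp: z dest: spec[of _ 0])
    have x1: "g (base_code (return_map x)) = return_map x"
      using elim(1) by (auto simp: z dest: spec[of _ 1])
    have pos: "(\<lambda>i. \<Phi> z (int i)) = base_code x" by (simp add: \<Phi>_def z x0(1) fun_eq_iff)
    have neg: "(\<lambda>i. \<Phi> z (- 1 - int i)) = tiling.fibre_code y" by (simp add: \<Phi>_def z)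
    have "\<psi> (\<Phi> z) = z"
      by (simp add: \<psi>_def pos neg x0(2) tiling.fibre_point_code[OF y pmf_less_1]) (simp add: z xy(2))
    then have 1: "\<Psi> (\<Phi> z) = z" using elim(2) by (simp add: \<Psi>_def space_\<nu>_u)
    let ?y = "tiling.tile_map (letter x) y"
    have y': "?y \<in> tiling.coded" "tiling.tile_index ?y = letter x" "tiling.expand ?y = y"
      using tiling.coded_tile_map[OF y x0(4)] by auto
    have pos': "(\<lambda>i. left_shift (\<Phi> z) (int i)) = base_code (return_map x)"
    proof
      fix i
      have "left_shift (\<Phi> z) (int i) = \<Phi> z (int (Suc i))" by (simp add: left_shift_def add.commute)
      also have "\<dots> = base_code x (Suc i)" using fun_cong[OF pos, of "Suc i"] .
      finally show "left_shift (\<Phi> z) (int i) = base_code (return_map x) i" by (simp add: base_code_def funpow_swap1)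
    qed
    have neg': "(\<lambda>i. left_shift (\<Phi> z) (- 1 - int i)) = tiling.fibre_code ?y"
    proof
      fix i
      show "left_shift (\<Phi> z) (- 1 - int i) = tiling.fibre_code ?y i"
      proof (cases i)
        case 0
        then show ?thesis using fun_cong[OF pos, of 0] by (simp add: left_shift_def y' base_code_def)
      next
        case (Suc j)
        have "left_shift (\<Phi> z) (- 1 - int i) = \<Phi> z (- 1 - int j)" by (simp add: left_shift_def Suc)
        also have "\<dots> = tiling.fibre_code y j" using fun_cong[OF neg, of j] .
        finally show ?thesis by (simp add: Suc funpow_swap1 y'(3))
      qed
    qed
    have "induced_map F R_u z = ((return_map x, u), ?y)"
      using F_induced(1)[OF x0(3) xy(3)] by (simp add: z xy(2) tile_map_letter[OF x0(4)])
    moreover have "\<psi> (left_shift (\<Phi> z)) = ((return_map x, u), ?y)"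
      by (simp add: \<psi>_def pos' neg' x1 tiling.fibre_point_code[OF y'(1) pmf_less_1])
    moreover have "((return_map x, u), ?y) \<in> R_u"
      using return_map_in[OF x0(3)] tiling.coded_range[OF y'(1)] by (auto simp: mem_rug_iff)
    ultimately have "\<Psi> (left_shift (\<Phi> z)) = induced_map F R_u z" by (simp add: \<Psi>_def)
    with 1 show ?case by simp
  qed
  show "isomorphic_mod_null \<nu>_u (induced_map F R_u) ?B left_shift"
    by (rule isomorphic_mod_nullI[OF prob_space_\<nu>_u \<Phi>_meas law \<Psi>_meas inv])
qed

end

theorem theorem3:
  fixes X :: "(real ^ 'n) set" and M :: "(real ^ 'n) measure" and T :: "real ^ 'n \<Rightarrow> real ^ 'n"
    and N :: nat and Z :: "nat \<Rightarrow> (real ^ 'n) set" and s :: "nat \<Rightarrow> real"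
    and \<alpha> :: "nat set" and D :: "nat \<Rightarrow> (real ^ 'n) set" and \<mu>h :: "((real ^ 'n) \<times> nat) measure"
  assumes X: "compact X" "lebesgue_prob_on X M"
    and Z: "partition_mod_null M N Z"
    and T: "T \<in> X \<rightarrow> X"
    and c1: "\<And>j. j \<in> {1..N} \<Longrightarrow> extends_uniquely X T (Z j)"
    and c2: "\<And>A. A \<in> sets M \<Longrightarrow> T ` A \<in> sets M"
      "\<And>A. A \<in> sets M \<Longrightarrow> T -` A \<inter> X \<in> sets M"
      "\<And>A. A \<in> sets M \<Longrightarrow> emeasure M A = 0 \<Longrightarrow> emeasure M (T -` A \<inter> X) = 0"
    and c3: "generating_mod_null M N Z T"
    and c4: "\<And>j. j \<in> {1..N} \<Longrightarrow> s j \<ge> 1"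
      "\<And>j A. j \<in> {1..N} \<Longrightarrow> A \<in> sets M \<Longrightarrow> A \<subseteq> Z j \<Longrightarrow> emeasure M (T ` A) = ennreal (s j) * emeasure M A"
    and c5: "\<And>A. A \<in> sets M \<Longrightarrow> T -` A \<inter> X = A \<Longrightarrow> emeasure M A = 0 \<or> emeasure M A = 1"
    and c6: "emeasure M (\<Union>n. (T ^^ n) ` (\<Union>j\<in>{1..N}. top_of_set X frontier_of Z j)) = 0"
    and nonatomic: "\<And>x. x \<in> X \<Longrightarrow> emeasure M {x} = 0"
    and tower: "tower_enumeration M N Z T \<alpha> D"
    and liftable: "lifts_to M N Z T \<alpha> D \<mu>h"
  shows "\<forall>u\<in>charged_levels \<alpha> D \<mu>h.
    (AE z in normalized_restriction (rug_measure M \<alpha> D \<mu>h) (rug M \<alpha> D \<mu>h u).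
       \<exists>n\<ge>1. (rug_map M N Z T s \<alpha> D \<mu>h ^^ n) z \<in> rug M \<alpha> D \<mu>h u) \<and>
    is_bernoulli (normalized_restriction (rug_measure M \<alpha> D \<mu>h) (rug M \<alpha> D \<mu>h u))
      (induced_map (rug_map M N Z T s \<alpha> D \<mu>h) (rug M \<alpha> D \<mu>h u))"
proof
  fix u assume u: "u \<in> charged_levels \<alpha> D \<mu>h"
  interpret generated_charged_level X M T N Z s \<alpha> D \<mu>h u
    by unfold_locales (fact X Z T c2 c4 tower liftable c3 nonatomic u)+
  show "(AE z in normalized_restriction (rug_measure M \<alpha> D \<mu>h) (rug M \<alpha> D \<mu>h u).
       \<exists>n\<ge>1. (rug_map M N Z T s \<alpha> D \<mu>h ^^ n) z \<in> rug M \<alpha> D \<mu>h u) \<and>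
    is_bernoulli (normalized_restriction (rug_measure M \<alpha> D \<mu>h) (rug M \<alpha> D \<mu>h u))
      (induced_map (rug_map M N Z T s \<alpha> D \<mu>h) (rug M \<alpha> D \<mu>h u))"
    using AE_return_rug is_bernoulli_rug by (rule conjI)
qed

end
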